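(* Finding an $m$-separator $Z$ with $I\subseteq Z\subseteq R$ which is strongly-minimum can be done in time $O(n^3)$: there is an algorithm that, given an ancestral graph $G=(V,E)$ with $n$ nodes, pairwise disjoint sets $X,Y,R\subseteq V$ with $X,Y$ non-empty, a set $I\subseteq R$, and a cost function $w$ on $V$ that is positive real on $R$ and satisfies $w(U)=\infty$ for $U\notin R$, outputs in time $O(n^3)$ a strongly-minimum $m$-separator $Z$ relative to $(X,Y)$ with $I\subseteq Z\subseteq R$, or outputs $\bot$ if no such set exists.
   Context: A mixed graph has directed ($A\to B$), undirected ($A-B$) and bidirected ($A\leftrightarrow B$) edges. A path is a sequence of distinct nodes with consecutive nodes adjacent. $U$ is an ancestor of $W$ if there is a directed path $U\to\cdots\to W$; $U$ is an anterior of $W$ if there is a path from $U$ to $W$ that becomes directed after replacing each undirected edge $S-T$ on it (traversed from $S$ to $T$) by $S\to T$. Every node is its own ancestor and anterior. A mixed graph is an ancestral graph if (1) for each edge $A\gets B$ or $A\leftrightarrow B$, $A$ is not an anterior of $B$, and (2) for each edge $A-B$ there are no edges $A\gets C$, $A\leftrightarrow C$, $B\gets C$ or $B\leftrightarrow C$. A node on a path is a collider if two arrowheads of the path meet at it. Nodes $U,W$ are $m$-connected by $Z$ if there is a path between them on which every collider is in $An(Z)$ (the set of ancestors of $Z$) and every non-collider is not in $Z$; otherwise $Z$ $m$-separates them. $Z$ $m$-separates sets $X,Y$ (is an $m$-separator relative to $(X,Y)$) if it $m$-separates every $U\in X$ from every $W\in Y$. An $m$-separator $Z$ relative to $(X,Y)$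 is strongly-minimum ($\emptyset$-minimum) according to $w$ if there is no $m$-separator $Z'$ relative to $(X,Y)$ (not required to contain $I$) with $\sum_{U\in Z'}w(U)<\sum_{U\in Z}w(U)$. Running times count elementary operations, with arithmetic on costs at unit cost. *)

theory Defs
  imports Complex_Main "HOL-Library.Extended_Real" "HOL-Library.Landau_Symbols"
begin

section \<open>Ancestral graphs\<close>

text \<open>
  \<open>(a, b) \<in> dir G\<close> is the edge \<open>a \<rightarrow> b\<close>.  Undirected and bidirected edges are stored in both
  orientations, as symmetric relations.
\<close>

record 'v mixed_graph =
  verts :: "'v set"
  dir :: "('v \<times> 'v) set"
  und :: "('v \<times> 'v) set"
  bid :: "('v \<times> 'v) set"

definition mixed_graph :: "'v mixed_graph \<Rightarrow> bool" where
  "mixed_graph G \<longleftrightarrow>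
     finite (verts G) \<and>
     dir G \<subseteq> verts G \<times> verts G \<and> und G \<subseteq> verts G \<times> verts G \<and> bid G \<subseteq> verts G \<times> verts G \<and>
     sym (und G) \<and> sym (bid G) \<and>
     irrefl (dir G) \<and> irrefl (und G) \<and> irrefl (bid G)"

definition adjacent :: "'v mixed_graph \<Rightarrow> 'v \<Rightarrow> 'v \<Rightarrow> bool" where
  "adjacent G a b \<longleftrightarrow> (a, b) \<in> dir G \<or> (b, a) \<in> dir G \<or> (a, b) \<in> und G \<or> (a, b) \<in> bid G"

text \<open>
  A path is a sequence of nodes, so the edges it uses are determined only if no two nodes are joined
  by more than one edge.  This is the case in every ancestral graph (lemma
  \<open>ancestral_graph_simple\<close> below).
\<close>

definition path_between :: "'v mixed_graph \<Rightarrow> 'v \<Rightarrow> 'v list \<Rightarrow> 'v \<Rightarrow> bool" where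
  "path_between G u p v \<longleftrightarrow>
     p \<noteq> [] \<and> hd p = u \<and> last p = v \<and> set p \<subseteq> verts G \<and> distinct p \<and>
     (\<forall>i. Suc i < length p \<longrightarrow> adjacent G (p ! i) (p ! Suc i))"

definition ancestor :: "'v mixed_graph \<Rightarrow> 'v \<Rightarrow> 'v \<Rightarrow> bool" where
  "ancestor G u v \<longleftrightarrow>
     (\<exists>p. path_between G u p v \<and> (\<forall>i. Suc i < length p \<longrightarrow> (p ! i, p ! Suc i) \<in> dir G))"

definition anterior :: "'v mixed_graph \<Rightarrow> 'v \<Rightarrow> 'v \<Rightarrow> bool" where
  "anterior G u v \<longleftrightarrow>
     (\<exists>p. path_between G u p v \<and>
          (\<forall>i. Suc i < length p \<longrightarrow> (p ! i, p ! Suc i) \<in> dir G \<union> und G))"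

definition An :: "'v mixed_graph \<Rightarrow> 'v set \<Rightarrow> 'v set" where
  "An G Z = {u. \<exists>z\<in>Z. ancestor G u z}"

definition ancestral_graph :: "'v mixed_graph \<Rightarrow> bool" where
  "ancestral_graph G \<longleftrightarrow>
     mixed_graph G \<and>
     (\<forall>a b. (b, a) \<in> dir G \<or> (a, b) \<in> bid G \<longrightarrow> \<not> anterior G a b) \<and>
     (\<forall>a b. (a, b) \<in> und G \<longrightarrow>
        (\<forall>c. (c, a) \<notin> dir G \<and> (a, c) \<notin> bid G \<and> (c, b) \<notin> dir G \<and> (b, c) \<notin> bid G))"

lemma ancestral_graph_simple:
  assumes "ancestral_graph G"
  shows "dir G \<inter> (dir G)\<inverse> = {}" "dir G \<inter> bid G = {}" "dir G \<inter> und G = {}" "und G \<inter> bid G = {}"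
proof -
  have ant: "anterior G a b" if "(a, b) \<in> dir G" for a b
  proof -
    have "a \<noteq> b" "a \<in> verts G" "b \<in> verts G"
      using assms that by (auto simp: ancestral_graph_def mixed_graph_def irrefl_def)
    then show ?thesis
      using that unfolding anterior_def path_between_def adjacent_def
      by (intro exI[of _ "[a, b]"]) (auto simp: less_Suc_eq)
  qed
  show "dir G \<inter> (dir G)\<inverse> = {}" "dir G \<inter> bid G = {}"
    using assms ant by (auto simp: ancestral_graph_def)
  show "dir G \<inter> und G = {}" "und G \<inter> bid G = {}"
    using assms by (auto simp: ancestral_graph_def)
qed

section \<open>m-separation\<close>

definition arrowhead :: "'v mixed_graph \<Rightarrow> 'v \<Rightarrow> 'v \<Rightarrow> bool" where
  "arrowhead G a b \<longleftrightarrow> (a, b) \<in> dir G \<or> (a, b) \<in> bid G"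

definition collider :: "'v mixed_graph \<Rightarrow> 'v list \<Rightarrow> nat \<Rightarrow> bool" where
  "collider G p i \<longleftrightarrow>
     0 < i \<and> Suc i < length p \<and>
     arrowhead G (p ! (i - 1)) (p ! i) \<and> arrowhead G (p ! Suc i) (p ! i)"

text \<open>The end nodes of a path are non-colliders.\<close>

definition m_connected :: "'v mixed_graph \<Rightarrow> 'v set \<Rightarrow> 'v \<Rightarrow> 'v \<Rightarrow> bool" where
  "m_connected G Z u v \<longleftrightarrow>
     (\<exists>p. path_between G u p v \<and>
          (\<forall>i<length p. if collider G p i then p ! i \<in> An G Z else p ! i \<notin> Z))"

definition m_separator :: "'v mixed_graph \<Rightarrow> 'v set \<Rightarrow> 'v set \<Rightarrow> 'v set \<Rightarrow> bool" where
  "m_separator G X Y Z \<longleftrightarrow> Z \<subseteq> verts G \<and> (\<forall>u\<in>X. \<forall>v\<in>Y. \<not> m_connected G Z u v)"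

definition strongly_minimum ::
    "'v mixed_graph \<Rightarrow> 'v set \<Rightarrow> 'v set \<Rightarrow> ('v \<Rightarrow> ereal) \<Rightarrow> 'v set \<Rightarrow> bool" where
  "strongly_minimum G X Y w Z \<longleftrightarrow>
     m_separator G X Y Z \<and>
     \<not> (\<exists>Z'. m_separator G X Y Z' \<and> (\<Sum>u\<in>Z'. w u) < (\<Sum>u\<in>Z. w u))"

section \<open>Machine model\<close>

text \<open>
  Programs of a random access machine with two sorts of data.  Natural numbers serve as counters,
  node names and addresses; they have addition, truncated subtraction and comparison but no
  multiplication, so that no superpolynomially long number can be built in polynomial time.  Costs are
  extended reals, again with addition, subtraction and comparison only; there is no conversion
  between costs and numbers.  For each sort there are scalar variables and unbounded arrays with one
  or two indices.
\<close>

type_synonym name = string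

datatype nexp =
    NConst nat
  | NVar name
  | NArr name nexp
  | NMat name nexp nexp
  | NAdd nexp nexp
  | NSub nexp nexp

datatype cexp =
    CZero
  | CInf
  | CVar name
  | CArr name nexp
  | CMat name nexp nexp
  | CAdd cexp cexp
  | CSub cexp cexp

datatype bexp =
    NLess nexp nexp
  | NEq nexp nexp
  | CLess cexp cexp
  | CEq cexp cexp
  | BNot bexp
  | BAnd bexp bexp

datatype com =
    Skip
  | SetNVar name nexp
  | SetNArr name nexp nexp
  | SetNMat name nexp nexp nexp
  | SetCVar name cexp
  | SetCArr name nexp cexp
  | SetCMat name nexp nexp cexp
  | Seq com com
  | Cond bexp com com
  | While bexp com

record state =
  nvar :: "name \<Rightarrow> nat"
  narr :: "name \<Rightarrow> nat \<Rightarrow> nat"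
  nmat :: "name \<Rightarrow> nat \<Rightarrow> nat \<Rightarrow> nat"
  cvar :: "name \<Rightarrow> ereal"
  carr :: "name \<Rightarrow> nat \<Rightarrow> ereal"
  cmat :: "name \<Rightarrow> nat \<Rightarrow> nat \<Rightarrow> ereal"

primrec nval :: "nexp \<Rightarrow> state \<Rightarrow> nat" where
  "nval (NConst k) s = k"
| "nval (NVar x) s = nvar s x"
| "nval (NArr x e) s = narr s x (nval e s)"
| "nval (NMat x e f) s = nmat s x (nval e s) (nval f s)"
| "nval (NAdd e f) s = nval e s + nval f s"
| "nval (NSub e f) s = nval e s - nval f s"

primrec cval :: "cexp \<Rightarrow> state \<Rightarrow> ereal" where
  "cval CZero s = 0"
| "cval CInf s = \<infinity>"
| "cval (CVar x) s = cvar s x"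
| "cval (CArr x e) s = carr s x (nval e s)"
| "cval (CMat x e f) s = cmat s x (nval e s) (nval f s)"
| "cval (CAdd e f) s = cval e s + cval f s"
| "cval (CSub e f) s = cval e s - cval f s"

primrec bval :: "bexp \<Rightarrow> state \<Rightarrow> bool" where
  "bval (NLess e f) s \<longleftrightarrow> nval e s < nval f s"
| "bval (NEq e f) s \<longleftrightarrow> nval e s = nval f s"
| "bval (CLess e f) s \<longleftrightarrow> cval e s < cval f s"
| "bval (CEq e f) s \<longleftrightarrow> cval e s = cval f s"
| "bval (BNot b) s \<longleftrightarrow> \<not> bval b s"
| "bval (BAnd b c) s \<longleftrightarrow> bval b s \<and> bval c s"

text \<open>Every constant, memory access, arithmetic operation, comparison and connective costs 1.\<close>

primrec ntime :: "nexp \<Rightarrow> nat" where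
  "ntime (NConst k) = 1"
| "ntime (NVar x) = 1"
| "ntime (NArr x e) = 1 + ntime e"
| "ntime (NMat x e f) = 1 + ntime e + ntime f"
| "ntime (NAdd e f) = 1 + ntime e + ntime f"
| "ntime (NSub e f) = 1 + ntime e + ntime f"

primrec ctime :: "cexp \<Rightarrow> nat" where
  "ctime CZero = 1"
| "ctime CInf = 1"
| "ctime (CVar x) = 1"
| "ctime (CArr x e) = 1 + ntime e"
| "ctime (CMat x e f) = 1 + ntime e + ntime f"
| "ctime (CAdd e f) = 1 + ctime e + ctime f"
| "ctime (CSub e f) = 1 + ctime e + ctime f"

primrec btime :: "bexp \<Rightarrow> nat" where
  "btime (NLess e f) = 1 + ntime e + ntime f"
| "btime (NEq e f) = 1 + ntime e + ntime f"
| "btime (CLess e f) = 1 + ctime e + ctime f"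
| "btime (CEq e f) = 1 + ctime e + ctime f"
| "btime (BNot b) = 1 + btime b"
| "btime (BAnd b c) = 1 + btime b + btime c"

text \<open>\<open>exec c s t s'\<close>: started in \<open>s\<close>, the program \<open>c\<close> halts in \<open>s'\<close> after \<open>t\<close> elementary operations.\<close>

inductive exec :: "com \<Rightarrow> state \<Rightarrow> nat \<Rightarrow> state \<Rightarrow> bool" where
  Skip: "exec Skip s 1 s"
| SetNVar: "exec (SetNVar x e) s (1 + ntime e) (s\<lparr>nvar := (nvar s)(x := nval e s)\<rparr>)"
| SetNArr: "exec (SetNArr x i e) s (1 + ntime i + ntime e)
    (s\<lparr>narr := (narr s)(x := (narr s x)(nval i s := nval e s))\<rparr>)"
| SetNMat: "exec (SetNMat x i j e) s (1 + ntime i + ntime j + ntime e)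
    (s\<lparr>nmat := (nmat s)(x := (nmat s x)(nval i s :=
        (nmat s x (nval i s))(nval j s := nval e s)))\<rparr>)"
| SetCVar: "exec (SetCVar x e) s (1 + ctime e) (s\<lparr>cvar := (cvar s)(x := cval e s)\<rparr>)"
| SetCArr: "exec (SetCArr x i e) s (1 + ntime i + ctime e)
    (s\<lparr>carr := (carr s)(x := (carr s x)(nval i s := cval e s))\<rparr>)"
| SetCMat: "exec (SetCMat x i j e) s (1 + ntime i + ntime j + ctime e)
    (s\<lparr>cmat := (cmat s)(x := (cmat s x)(nval i s :=
        (cmat s x (nval i s))(nval j s := cval e s)))\<rparr>)"
| Seq: "exec c s t s' \<Longrightarrow> exec d s' t' s'' \<Longrightarrow> exec (Seq c d) s (t + t') s''"
| CondTrue: "bval b s \<Longrightarrow> exec c s t s' \<Longrightarrow> exec (Cond b c d) s (1 + btime b + t) s'"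
| CondFalse: "\<not> bval b s \<Longrightarrow> exec d s t s' \<Longrightarrow> exec (Cond b c d) s (1 + btime b + t) s'"
| WhileFalse: "\<not> bval b s \<Longrightarrow> exec (While b c) s (1 + btime b) s"
| WhileTrue: "bval b s \<Longrightarrow> exec c s t s' \<Longrightarrow> exec (While b c) s' t' s'' \<Longrightarrow>
    exec (While b c) s (1 + btime b + t + t') s''"

lemma exec_deterministic:
  "exec c s t s' \<Longrightarrow> exec c s u s'' \<Longrightarrow> t = u \<and> s' = s''"
proof (induction arbitrary: u s'' rule: exec.induct)
  case (Seq c s t s' d t' s'')
  from Seq.prems show ?case by (cases rule: exec.cases) (auto dest: Seq.IH)
next
  case (CondTrue b s c t s' d)
  from CondTrue.prems CondTrue.hyps show ?case by (cases rule: exec.cases) (auto dest: CondTrue.IH)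
next
  case (CondFalse b s d t s' c)
  from CondFalse.prems CondFalse.hyps show ?case by (cases rule: exec.cases) (auto dest: CondFalse.IH)
next
  case (WhileTrue b s c t s' t' s'')
  from WhileTrue.prems WhileTrue.hyps show ?case
    by (cases rule: exec.cases) (auto dest: WhileTrue.IH)
qed (erule exec.cases; simp)+

section \<open>Input and output\<close>

text \<open>
  The nodes are \<open>0, \<dots>, n - 1\<close>.  The graph is given by the number \<open>n\<close> and one adjacency matrix for
  each kind of edge, the node sets by characteristic vectors, and the costs by a vector that may
  contain \<open>\<infinity>\<close>.  All other memory cells are initially zero.
\<close>

definition input_state ::
    "nat mixed_graph \<Rightarrow> nat set \<Rightarrow> nat set \<Rightarrow> nat set \<Rightarrow> nat set \<Rightarrow> (nat \<Rightarrow> ereal) \<Rightarrow> state" where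
  "input_state G X Y R I w = \<lparr>
     nvar = (\<lambda>_. 0)(''n'' := card (verts G)),
     narr = (\<lambda>_ _. 0)(
       ''X'' := \<lambda>u. of_bool (u \<in> X),
       ''Y'' := \<lambda>u. of_bool (u \<in> Y),
       ''R'' := \<lambda>u. of_bool (u \<in> R),
       ''I'' := \<lambda>u. of_bool (u \<in> I)),
     nmat = (\<lambda>_ _ _. 0)(
       ''dir'' := \<lambda>u v. of_bool ((u, v) \<in> dir G),
       ''und'' := \<lambda>u v. of_bool ((u, v) \<in> und G),
       ''bid'' := \<lambda>u v. of_bool ((u, v) \<in> bid G)),
     cvar = (\<lambda>_. 0),
     carr = (\<lambda>_ _. 0)(''w'' := \<lambda>u. if u \<in> verts G then w u else 0),
     cmat = (\<lambda>_ _ _. 0)\<rparr>"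

text \<open>\<open>None\<close> is the answer \<open>\<bottom>\<close>.\<close>

definition result :: "nat \<Rightarrow> state \<Rightarrow> nat set option" where
  "result n s =
     (if nvar s ''found'' = 0 then None else Some {u. u < n \<and> narr s ''Z'' u \<noteq> 0})"

end

theory Submission
  imports Defs
begin

text \<open>
  Write \<open>A\<close> for the set of anteriors of \<open>X \<union> Y\<close>.  Restricting an \<open>m\<close>-separator to \<open>A\<close> keeps it an
  \<open>m\<close>-separator, and inside \<open>A\<close> the condition that colliders lie in \<open>An Z\<close> can be dropped: a collider
  outside \<open>An Z\<close> is an ancestor of \<open>X\<close> or \<open>Y\<close> along a directed path that avoids \<open>Z\<close>, along which the
  walk can be rerouted, and in an ancestral graph a shortest open walk is a path.  So \<open>m\<close>-separation by
  \<open>Z \<subseteq> A\<close> is vertex separation in a network with three copies of each node: \<open>u\<close> is entered at \<open>u\<close> and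
  left at \<open>n + u\<close>, with an arc between them that \<open>Z\<close> can cut, and \<open>2 n + u\<close> is a passage through \<open>u\<close> as a
  collider.

  Minimum cuts are computed by push-relabel in \<open>O(n\<^sup>3)\<close>.  A minimum separator containing \<open>I\<close>, found by
  giving capacity \<open>0\<close> to \<open>I\<close>, is strongly minimum iff it is no more expensive than an unconstrained
  minimum; otherwise there is no strongly minimum separator containing \<open>I\<close>.
\<close>

section \<open>Walks in ancestral graphs\<close>

text \<open>Two obstacles shape the development. The network sees only nodes of \<open>A\<close>,
  whereas \<open>I\<close> may leave \<open>A\<close>, and conditioning on a node outside
  \<open>A\<close> can open walks by activating colliders; so the union of \<open>I\<close> and a
  separating set need not separate. Positivity of the costs resolves this: if the constrained answer
  costs no more than the unconstrained minimum, nothing outside \<open>A\<close> was paid for, hence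
  \<open>I \<subseteq> A\<close>. The other obstacle is to keep the flow computation simple enough
  for a verified cubic bound on plain arrays. There is no source: all supply is initial excess,
  excess that cannot reach a sink is abandoned where it lies, and the cut is read off from a label
  that no node carries. Nodes are scanned cyclically without any queue; a counter that bounds the
  labels of active nodes limits the number of passes, and a single potential function bounds the
  number of steps.\<close>

lemma path_iff_rtrancl:
  assumes E: "E \<subseteq> verts G \<times> verts G" "\<And>a b. (a, b) \<in> E \<Longrightarrow> adjacent G a b"
  shows "(\<exists>p. path_between G u p v \<and> (\<forall>i. Suc i < length p \<longrightarrow> (p ! i, p ! Suc i) \<in> E)) \<longleftrightarrow>
    u \<in> verts G \<and> (u, v) \<in> E\<^sup>*"
proof
  assume "\<exists>p. path_between G u p v \<and> (\<forall>i. Suc i < length p \<longrightarrow> (p ! i, p ! Suc i) \<in> E)"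
  then obtain p where p: "path_between G u p v" "\<And>i. Suc i < length p \<Longrightarrow> (p ! i, p ! Suc i) \<in> E"
    by blast
  have "i < length p \<Longrightarrow> (p ! 0, p ! i) \<in> E\<^sup>*" for i
    by (induction i) (use p(2) in \<open>auto intro: rtrancl_into_rtrancl\<close>)
  from this[of "length p - 1"] show "u \<in> verts G \<and> (u, v) \<in> E\<^sup>*"
    using p(1) by (auto simp: path_between_def hd_conv_nth last_conv_nth)
next
  assume uv: "u \<in> verts G \<and> (u, v) \<in> E\<^sup>*"
  then have "v \<in> verts G" using E(1) by (auto elim: rtranclE)
  from uv have "(u, v) \<in> E\<^sup>*" by blast
  then have "\<exists>p. p \<noteq> [] \<and> hd p = u \<and> last p = v \<and> set p \<subseteq> verts G \<and> distinct p \<and>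
      successively (\<lambda>a b. (a, b) \<in> E) p"
  proof (induction rule: converse_rtrancl_induct)
    case base
    then show ?case using \<open>v \<in> verts G\<close> by (intro exI[of _ "[v]"]) auto
  next
    case (step y z)
    then obtain p where p: "p \<noteq> []" "hd p = z" "last p = v" "set p \<subseteq> verts G" "distinct p"
      "successively (\<lambda>a b. (a, b) \<in> E) p" by blast
    show ?case
    proof (cases "y \<in> set p")
      case True
      then obtain xs ys where "p = xs @ y # ys" by (meson split_list)
      then show ?thesis using p
        by (intro exI[of _ "y # ys"]) (auto simp: successively_append_iff)
    next
      case False
      then show ?thesis using p step E(1)
        by (intro exI[of _ "y # p"]) (auto simp: successively_Cons)
    qed
  qed
  then show "\<exists>p. path_between G u p v \<and> (\<forall>i. Suc i < length p \<longrightarrow> (p ! i, p ! Suc i) \<in> E)"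
    unfolding path_between_def successively_conv_nth using E(2) by blast
qed

section \<open>Edge marks and reachability in an ancestral graph\<close>

locale ancestral =
  fixes G :: "'v mixed_graph"
  assumes ancestral: "ancestral_graph G"
begin

lemma mixed: "mixed_graph G"
  using ancestral by (simp add: ancestral_graph_def)

lemma ancestor_iff: "ancestor G u v \<longleftrightarrow> u \<in> verts G \<and> (u, v) \<in> (dir G)\<^sup>*"
  unfolding ancestor_def
  by (rule path_iff_rtrancl) (use mixed in \<open>auto simp: mixed_graph_def adjacent_def\<close>)

lemma anterior_iff: "anterior G u v \<longleftrightarrow> u \<in> verts G \<and> (u, v) \<in> (dir G \<union> und G)\<^sup>*"
  unfolding anterior_def
  by (rule path_iff_rtrancl) (use mixed in \<open>auto simp: mixed_graph_def adjacent_def\<close>)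

lemma An_eq: "An G Z = {u \<in> verts G. \<exists>z\<in>Z. (u, z) \<in> (dir G)\<^sup>*}"
  by (auto simp: An_def ancestor_iff)

lemma edge_verts:
  "(a, b) \<in> dir G \<Longrightarrow> a \<in> verts G \<and> b \<in> verts G"
  "adjacent G a b \<Longrightarrow> a \<in> verts G \<and> b \<in> verts G"
  using mixed by (auto simp: mixed_graph_def adjacent_def)

lemma sym_edges: "(a, b) \<in> und G \<Longrightarrow> (b, a) \<in> und G" "(a, b) \<in> bid G \<Longrightarrow> (b, a) \<in> bid G"
  using mixed by (auto simp: mixed_graph_def sym_def)

lemma adjacent_sym: "adjacent G a b \<Longrightarrow> adjacent G b a"
  using sym_edges by (auto simp: adjacent_def)

lemma arrowhead_adjacent: "arrowhead G a b \<Longrightarrow> adjacent G a b" "arrowhead G a b \<Longrightarrow> adjacent G b a"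
  using sym_edges by (auto simp: adjacent_def arrowhead_def)

lemma dir_no_arrowhead: "(a, b) \<in> dir G \<Longrightarrow> \<not> arrowhead G b a"
  using ancestral_graph_simple[OF ancestral] sym_edges by (auto simp: arrowhead_def)

lemma und_no_arrowhead: "(a, b) \<in> und G \<Longrightarrow> \<not> arrowhead G c a"
  using ancestral sym_edges by (fastforce simp: arrowhead_def ancestral_graph_def)

lemma no_arrowhead_edge: "adjacent G b c \<Longrightarrow> \<not> arrowhead G c b \<Longrightarrow> (b, c) \<in> dir G \<union> und G"
  using sym_edges by (auto simp: adjacent_def arrowhead_def)

text \<open>An arrowhead at \<open>b\<close> excludes undirected edges at \<open>b\<close>. So a
  walk that enters \<open>b\<close> through an arrowhead and does not collide there leaves along a
  directed edge; this is the form in which condition (2) of ancestral graphs is mostly used.\<close>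

lemma no_collider_dir:
  "arrowhead G a b \<Longrightarrow> adjacent G b c \<Longrightarrow> \<not> arrowhead G c b \<Longrightarrow> (b, c) \<in> dir G"
  using no_arrowhead_edge und_no_arrowhead by blast

lemma arrowheads_bid: "arrowhead G a b \<Longrightarrow> arrowhead G b a \<Longrightarrow> (a, b) \<in> bid G"
  using dir_no_arrowhead by (auto simp: arrowhead_def)

text \<open>A directed cycle through the edge from \<open>a\<close> to \<open>b\<close> would make
  \<open>b\<close> an anterior of \<open>a\<close>, which condition (1) forbids.\<close>

lemma dir_acyclic: "(a, a) \<notin> (dir G)\<^sup>+"
proof
  assume "(a, a) \<in> (dir G)\<^sup>+"
  then obtain b where b: "(a, b) \<in> dir G" "(b, a) \<in> (dir G)\<^sup>*" by (meson tranclD)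
  then have "anterior G b a"
    unfolding anterior_iff using edge_verts rtrancl_mono[of "dir G" "dir G \<union> und G"] by blast
  then show False using ancestral b(1) by (auto simp: ancestral_graph_def)
qed

lemma An_step: "(a, b) \<in> dir G \<Longrightarrow> b \<in> An G Z \<Longrightarrow> a \<in> An G Z"
  by (auto simp: An_eq dest: edge_verts intro: converse_rtrancl_into_rtrancl)

lemma An_rtrancl: "(a, b) \<in> (dir G)\<^sup>* \<Longrightarrow> b \<in> An G Z \<Longrightarrow> a \<in> An G Z"
  by (induction rule: converse_rtrancl_induct) (auto intro: An_step)

lemma An_base: "a \<in> Z \<Longrightarrow> a \<in> verts G \<Longrightarrow> a \<in> An G Z"
  by (auto simp: An_eq)

section \<open>Open walks and their reduction to paths\<close>

definition walk :: "'v list \<Rightarrow> bool" where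
  "walk p \<longleftrightarrow> p \<noteq> [] \<and> set p \<subseteq> verts G \<and> (\<forall>i. Suc i < length p \<longrightarrow> adjacent G (p ! i) (p ! Suc i))"

definition passable :: "'v set \<Rightarrow> 'v list \<Rightarrow> nat \<Rightarrow> bool" where
  "passable Z p i \<longleftrightarrow> (if collider G p i then p ! i \<in> An G Z else p ! i \<notin> Z)"

definition open_walk :: "'v set \<Rightarrow> 'v list \<Rightarrow> bool" where
  "open_walk Z p \<longleftrightarrow> walk p \<and> (\<forall>i<length p. passable Z p i)"

text \<open>After a directed edge the walk stays directed as long as it meets no collider, because a
  non-collider entered through an arrowhead is left along a directed edge. The first collider would
  lie in \<open>An G Z\<close>, and then so would its ancestor \<open>p ! k\<close>.\<close>

lemma directed_until_collider:
  assumes p: "open_walk Z p" and k: "Suc k < length p" "(p ! k, p ! Suc k) \<in> dir G"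
    and j: "k < j" "j < length p"
  shows "p ! k \<in> An G Z \<or> (p ! k, p ! j) \<in> (dir G)\<^sup>+ \<and> (p ! (j - 1), p ! j) \<in> dir G"
  using j
proof (induction j)
  case (Suc j)
  show ?case
  proof (cases "k = j")
    case True
    then show ?thesis using k by auto
  next
    case False
    then have j: "k < j" "j < length p" using Suc.prems by auto
    show ?thesis
    proof (cases "p ! k \<in> An G Z")
      case notAn: False
      then have d: "(p ! k, p ! j) \<in> (dir G)\<^sup>+" "(p ! (j - 1), p ! j) \<in> dir G"
        using Suc.IH[OF j] by auto
      have "\<not> collider G p j"
      proof
        assume "collider G p j"
        then have "p ! j \<in> An G Z" using p j by (auto simp: open_walk_def passable_def)
        then have "p ! k \<in> An G Z"
          using d(1) An_rtrancl trancl_into_rtrancl by metis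
        then show False using notAn by blast
      qed
      moreover have "arrowhead G (p ! (j - 1)) (p ! j)" using d by (auto simp: arrowhead_def)
      moreover have "adjacent G (p ! j) (p ! Suc j)"
        using p Suc.prems by (auto simp: open_walk_def walk_def)
      ultimately have "(p ! j, p ! Suc j) \<in> dir G"
        using no_collider_dir j Suc.prems by (auto simp: collider_def)
      then show ?thesis using d(1) by (simp add: trancl_into_trancl)
    qed auto
  qed
qed auto

text \<open>Cutting out the loop between two visits of a node can change passability only at that
  node. The critical case is that it becomes a collider: unless it lies in \<open>An G Z\<close>,
  the removed loop would be a directed cycle.\<close>

lemma open_walk_shorten:
  assumes p: "open_walk Z p" and rep: "i < j" "j < length p" "p ! i = p ! j"
  defines "q \<equiv> take (Suc i) p @ drop (Suc j) p"
  shows "open_walk Z q" "hd q = hd p" "last q = last p" "length q < length p"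
proof -
  let ?l = "j - i"
  have len: "length q = length p - ?l" using rep by (auto simp: q_def)
  then show "length q < length p" using rep by auto
  have lo: "q ! k = p ! k" if "k \<le> i" for k
    using that rep by (auto simp: q_def nth_append)
  have hi: "q ! k = p ! (k + ?l)" if "i \<le> k" "k < length q" for k
  proof (cases "k = i")
    case True
    then show ?thesis using lo[of i] rep by auto
  next
    case False
    then have "q ! k = p ! (Suc j + (k - Suc i))"
      using that rep len by (simp add: q_def nth_append min_def)
    also have "Suc j + (k - Suc i) = k + ?l" using that rep False by simp
    finally show ?thesis .
  qed
  have pne: "p \<noteq> []" "q \<noteq> []" using rep by (auto simp: q_def)
  then show "hd q = hd p" using lo[of 0] by (simp add: hd_conv_nth)
  show "last q = last p"
    using pne hi[of "length q - 1"] len rep by (simp add: last_conv_nth)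
  have "walk q"
    unfolding walk_def
  proof (intro conjI allI impI)
    show "set q \<subseteq> verts G" using p set_take_subset[of "Suc i" p] set_drop_subset[of "Suc j" p]
      by (auto simp: open_walk_def walk_def q_def)
    fix k assume k: "Suc k < length q"
    show "adjacent G (q ! k) (q ! Suc k)"
    proof (cases "k < i")
      case True
      then show ?thesis using lo[of k] lo[of "Suc k"] p k len by (auto simp: open_walk_def walk_def)
    next
      case False
      then show ?thesis using hi[of k] hi[of "Suc k"] p k len by (auto simp: open_walk_def walk_def)
    qed
  qed (use pne in auto)
  moreover have "passable Z q k" if k: "k < length q" for k
  proof -
    consider "k < i" | "k > i" | "k = i" by linarith
    then show ?thesis
    proof cases
      case 1
      then have "collider G q k \<longleftrightarrow> collider G p k"
        using lo[of k] lo[of "Suc k"] lo[of "k - 1"] len rep by (auto simp: collider_def)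
      then show ?thesis using p 1 rep lo[of k] by (auto simp: open_walk_def passable_def)
    next
      case 2
      have "collider G q k \<longleftrightarrow> collider G p (k + ?l)"
        unfolding collider_def using hi[of k] hi[of "Suc k"] hi[of "k - 1"] len rep 2 k by auto
      then show ?thesis using p 2 k len hi[of k] by (auto simp: open_walk_def passable_def)
    next
      case 3
      let ?b = "p ! i"
      have col: "collider G q i \<longleftrightarrow> 0 < i \<and> Suc j < length p \<and>
          arrowhead G (p ! (i - 1)) ?b \<and> arrowhead G (p ! Suc j) ?b"
        unfolding collider_def using lo[of i] lo[of "i - 1"] hi[of "Suc i"] len rep by auto
      have pi: "passable Z p i" "passable Z p j" using p rep by (auto simp: open_walk_def)
      show ?thesis
      proof (cases "collider G q i")
        case False
        \<comment> \<open>A member of \<open>Z\<close> must be a collider at both visits; then both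
          outer edges have arrowheads at it, and it would be a collider of \<open>q\<close>
          too.\<close>
        have "?b \<notin> Z"
        proof
          assume "?b \<in> Z"
          then have "collider G p i" "collider G p j"
            using pi rep by (auto simp: passable_def split: if_splits)
          then show False using False col rep by (auto simp: collider_def)
        qed
        then show ?thesis using False 3 lo[of i] by (auto simp: passable_def)
      next
        case True
        have "?b \<in> An G Z"
        proof (cases "collider G p i")
          case True
          then show ?thesis using pi by (auto simp: passable_def)
        next
          case False
          \<comment> \<open>As \<open>q\<close> has a collider here, \<open>p ! (i - 1)\<close>
            sends an arrowhead to \<open>?b\<close>; since \<open>p\<close> has none at position
            \<open>i\<close>, its next edge points away from \<open>?b\<close>. Following it to
            position \<open>j\<close> yields an ancestor of \<open>Z\<close> or a directed
            cycle.\<close>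
          have "Suc i < length p" using rep by simp
          then have "adjacent G ?b (p ! Suc i)"
            using p unfolding open_walk_def walk_def by blast
          then have "(?b, p ! Suc i) \<in> dir G"
            using False True col no_collider_dir rep by (auto simp: collider_def)
          then have "?b \<in> An G Z \<or> (?b, ?b) \<in> (dir G)\<^sup>+"
            using directed_until_collider[OF p, of i j] rep by auto
          then show ?thesis using dir_acyclic by auto
        qed
        then show ?thesis using True 3 lo[of i] by (auto simp: passable_def)
      qed
    qed
  qed
  ultimately show "open_walk Z q" by (simp add: open_walk_def)
qed

text \<open>Rerouting and concatenation may revisit nodes, so the rest of the proof works with
  walks. One repetition is removed at a time, by induction on the length.\<close>

lemma m_connected_iff_open_walk:
  "m_connected G Z u v \<longleftrightarrow> (\<exists>p. open_walk Z p \<and> hd p = u \<and> last p = v)"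
proof
  assume "m_connected G Z u v"
  then show "\<exists>p. open_walk Z p \<and> hd p = u \<and> last p = v"
    unfolding m_connected_def path_between_def open_walk_def walk_def passable_def by blast
next
  assume "\<exists>p. open_walk Z p \<and> hd p = u \<and> last p = v"
  then obtain p where p: "open_walk Z p" "hd p = u" "last p = v" by blast
  then show "m_connected G Z u v"
  proof (induction "length p" arbitrary: p rule: less_induct)
    case less
    show ?case
    proof (cases "distinct p")
      case True
      then show ?thesis using less.prems
        unfolding m_connected_def path_between_def open_walk_def walk_def passable_def by blast
    next
      case False
      then obtain i j where "i < j" "j < length p" "p ! i = p ! j"
        by (metis distinct_conv_nth nat_neq_iff)
      from open_walk_shorten[OF less.prems(1) this] less.hyps less.prems show ?thesis by metis
    qed
  qed
qed

section \<open>Anteriors of a set and the restriction of separators to them\<close>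

definition Ant :: "'v set \<Rightarrow> 'v set" where
  "Ant W = {u. \<exists>z\<in>W. anterior G u z}"

lemma Ant_step: "(a, b) \<in> dir G \<union> und G \<Longrightarrow> b \<in> Ant W \<Longrightarrow> a \<in> Ant W"
  using mixed
  by (auto simp: Ant_def anterior_iff mixed_graph_def intro: converse_rtrancl_into_rtrancl)

lemma Ant_verts: "Ant W \<subseteq> verts G"
  by (auto simp: Ant_def anterior_iff)

lemma An_subset_Ant: "Z \<subseteq> Ant W \<Longrightarrow> An G Z \<subseteq> Ant W"
proof
  fix u assume Z: "Z \<subseteq> Ant W" and "u \<in> An G Z"
  then obtain z where z: "(u, z) \<in> (dir G)\<^sup>*" "z \<in> Ant W" by (auto simp: An_eq)
  then show "u \<in> Ant W" by (induction rule: converse_rtrancl_induct) (auto intro: Ant_step)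
qed

text \<open>An anterior path from a node with an incoming arrowhead cannot begin with an undirected
  edge. Its first edge is directed and puts an arrowhead at the next node, so by induction the whole
  path is directed.\<close>

lemma Ant_arrowhead:
  assumes "arrowhead G a c" "c \<in> Ant W"
  shows "\<exists>z\<in>W. (c, z) \<in> (dir G)\<^sup>*"
proof -
  obtain z where z: "z \<in> W" "(c, z) \<in> (dir G \<union> und G)\<^sup>*"
    using assms by (auto simp: Ant_def anterior_iff)
  from z(2) assms(1) have "(c, z) \<in> (dir G)\<^sup>*"
  proof (induction arbitrary: a rule: converse_rtrancl_induct)
    case (step y y')
    then have "(y, y') \<in> dir G" using und_no_arrowhead by blast
    then show ?case using step.IH[of y] by (auto simp: arrowhead_def intro: converse_rtrancl_into_rtrancl)
  qed auto
  then show ?thesis using z by blast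
qed

text \<open>An inner non-collider has an edge of the walk without arrowhead at it. Following the
  walk in that direction, the edges remain forward directed or undirected until a collider, which
  lies in \<open>An G Z\<close>, or an end is reached, and both are in \<open>Ant W\<close>. The
  facts \<open>right\<close> and \<open>left\<close> carry this out for the two directions.\<close>

lemma open_walk_in_Ant:
  assumes p: "open_walk Z p" and Z: "Z \<subseteq> Ant W" and ends: "hd p \<in> Ant W" "last p \<in> Ant W"
  shows "set p \<subseteq> Ant W"
proof -
  have col: "p ! i \<in> Ant W" if "collider G p i" for i
    proof -
    have "i < length p" using that by (simp add: collider_def)
    then show ?thesis using p that An_subset_Ant[OF Z] by (auto simp: open_walk_def passable_def)
  qed
  have adj: "adjacent G (p ! i) (p ! Suc i)" if "Suc i < length p" for i
    using p that by (auto simp: open_walk_def walk_def)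
  have pne: "p \<noteq> []" using p by (auto simp: open_walk_def walk_def)
  have right: "Suc i < length p \<Longrightarrow> (p ! i, p ! Suc i) \<in> dir G \<union> und G \<Longrightarrow> p ! i \<in> Ant W" for i
  proof (induction "length p - i" arbitrary: i rule: less_induct)
    case less
    have "p ! Suc i \<in> Ant W"
    proof (cases "Suc (Suc i) < length p")
      case False
      then have "Suc i = length p - 1" using less.prems(1) by linarith
      then have "p ! Suc i = last p" using pne by (simp add: last_conv_nth)
      then show ?thesis using ends by auto
    next
      case True
      show ?thesis
      proof (cases "collider G p (Suc i)")
        case False
        \<comment> \<open>With a directed edge before it, such an arrowhead would create a collider;
          with an undirected one, the node admits no arrowhead at all.\<close>
        have "\<not> arrowhead G (p ! Suc (Suc i)) (p ! Suc i)"
        proof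
          assume a: "arrowhead G (p ! Suc (Suc i)) (p ! Suc i)"
          then have "(p ! i, p ! Suc i) \<in> dir G"
            using less.prems(2) und_no_arrowhead sym_edges(1) by blast
          then show False using False True a by (simp add: collider_def arrowhead_def)
        qed
        then have "(p ! Suc i, p ! Suc (Suc i)) \<in> dir G \<union> und G"
          using no_arrowhead_edge adj True by blast
        then show ?thesis using less.hyps[of "Suc i"] True by auto
      qed (use col in auto)
    qed
    then show ?case using Ant_step less.prems by blast
  qed
  have left: "Suc i < length p \<Longrightarrow> (p ! Suc i, p ! i) \<in> dir G \<union> und G \<Longrightarrow> p ! Suc i \<in> Ant W" for i
  proof (induction i)
    case 0
    have "p ! 0 \<in> Ant W" using ends(1) pne by (simp add: hd_conv_nth)
    with 0 show ?case using Ant_step by blast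
  next
    case (Suc i)
    have "p ! Suc i \<in> Ant W"
    proof (cases "collider G p (Suc i)")
      case False
      have "\<not> arrowhead G (p ! i) (p ! Suc i)"
      proof
        assume a: "arrowhead G (p ! i) (p ! Suc i)"
        then have "(p ! Suc (Suc i), p ! Suc i) \<in> dir G"
          using Suc.prems(2) und_no_arrowhead sym_edges(1) by blast
        then show False using False Suc.prems(1) a by (simp add: collider_def arrowhead_def)
      qed
      then have "(p ! Suc i, p ! i) \<in> dir G \<union> und G"
        using no_arrowhead_edge adj[of i] Suc.prems adjacent_sym by (meson Suc_lessD)
      then show ?thesis using Suc by auto
    qed (use col in auto)
    then show ?case using Ant_step Suc.prems by blast
  qed
  have "p ! i \<in> Ant W" if i: "i < length p" for i
  proof (cases "i = 0 \<or> Suc i = length p")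
    case True
    then have "i = 0 \<or> i = length p - 1" by linarith
    then have "p ! i = hd p \<or> p ! i = last p"
      using pne hd_conv_nth[of p] last_conv_nth[of p] by metis
    then show ?thesis using ends by auto
  next
    case False
    then obtain k where k: "i = Suc k" "Suc i < length p" using i by (cases i) auto
    consider "collider G p i" | "\<not> arrowhead G (p ! k) (p ! i)" | "\<not> arrowhead G (p ! Suc i) (p ! i)"
      using k by (auto simp: collider_def)
    then show ?thesis
    proof cases
      case 2
      moreover have "adjacent G (p ! i) (p ! k)" using adj[of k] adjacent_sym k i by blast
      ultimately show ?thesis using left[of k] no_arrowhead_edge k i by blast
    next
      case 3
      then show ?thesis using right[of i] no_arrowhead_edge adj[of i] k by blast
    qed (use col in auto)
  qed
  then show ?thesis by (auto simp: in_set_conv_nth)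
qed

text \<open>A walk that is open for the restricted set stays inside the anteriors, where the
  restricted set and \<open>Z\<close> have the same members. Since restriction only loses ancestors,
  the walk is open for \<open>Z\<close> as well.\<close>

lemma m_separator_Int_Ant:
  assumes "m_separator G X Y Z" "X \<subseteq> verts G" "Y \<subseteq> verts G"
  shows "m_separator G X Y (Z \<inter> Ant (X \<union> Y))"
proof -
  let ?A = "Ant (X \<union> Y)"
  have "m_connected G Z u v" if uv: "u \<in> X" "v \<in> Y" and mc: "m_connected G (Z \<inter> ?A) u v" for u v
  proof -
    obtain p where p: "open_walk (Z \<inter> ?A) p" "hd p = u" "last p = v"
      using mc unfolding m_connected_iff_open_walk by blast
    have "u \<in> ?A" "v \<in> ?A" using uv assms by (auto simp: Ant_def anterior_iff)
    then have "set p \<subseteq> ?A" using open_walk_in_Ant[OF p(1)] p by auto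
    then have "passable Z p i" if "i < length p" for i
    proof -
      have "p ! i \<in> ?A" using \<open>set p \<subseteq> ?A\<close> that by auto
      moreover have "An G (Z \<inter> ?A) \<subseteq> An G Z" by (auto simp: An_eq)
      ultimately show ?thesis using p(1) that
        by (simp add: open_walk_def passable_def split: if_splits) blast+
    qed
    then have "open_walk Z p"
      using p(1) by (simp add: open_walk_def)
    then show ?thesis using p unfolding m_connected_iff_open_walk by blast
  qed
  then show ?thesis using assms(1) unfolding m_separator_def by blast
qed

end

section \<open>The separation network\<close>

text \<open>The value is \<open>2\<close> for the arcs of finite capacity, \<open>1\<close> for the other arcs, and \<open>0\<close> if there is
  no arc.\<close>

fun kind :: "nat \<Rightarrow> nat mixed_graph \<Rightarrow> nat set \<Rightarrow> nat set \<Rightarrow> nat \<Rightarrow> nat \<Rightarrow> nat" where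
  "kind n G A R a b =
    (if a < n then (if b = n + a \<and> a \<in> A then (if a \<in> R then 2 else 1) else 0)
     else if a < n + n then
       (if b < n then of_bool (a - n \<in> A \<and> b \<in> A \<and> adjacent G (a - n) b)
        else if b < n + n then 0
        else of_bool (a - n \<in> A \<and> b - (n + n) \<in> A \<and> arrowhead G (a - n) (b - (n + n))))
     else
       (if b < n then of_bool (a - (n + n) \<in> A \<and> b \<in> A \<and> arrowhead G b (a - (n + n)))
        else if b < n + n then 0
        else of_bool (a - (n + n) \<in> A \<and> b - (n + n) \<in> A \<and> (a - (n + n), b - (n + n)) \<in> bid G)))"

declare kind.simps [simp del]

locale network = ancestral G for G :: "nat mixed_graph" +
  fixes n :: nat and X Y R :: "nat set"
  assumes verts: "verts G = {..<n}"
    and subsets: "X \<subseteq> {..<n}" "Y \<subseteq> {..<n}" "R \<subseteq> {..<n}"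
    and disjoint: "X \<inter> Y = {}" "X \<inter> R = {}" "Y \<inter> R = {}"
begin

abbreviation A :: "nat set" where "A \<equiv> Ant (X \<union> Y)"

text \<open>The arcs of kind \<open>2\<close> run from \<open>u\<close> to \<open>n + u\<close>, so
  the tail of such an arc is itself the graph node, and \<open>a \<notin> Z\<close> needs no
  translation.\<close>

definition net :: "nat set \<Rightarrow> (nat \<times> nat) set" where
  "net Z = {(a, b). a < n + n + n \<and> b < n + n + n \<and>
     (kind n G A R a b = 1 \<or> kind n G A R a b = 2 \<and> a \<notin> Z)}"

text \<open>Paths run from the exit copies \<open>n + x\<close> to the entry copies
  \<open>y\<close>. The arcs within the two end nodes are skipped because the ends of a walk, being
  outside \<open>R\<close>, are never members of a separator \<open>Z \<subseteq> R\<close>.\<close>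

definition separates :: "nat set \<Rightarrow> bool" where
  "separates Z \<longleftrightarrow> (\<forall>x\<in>X. \<forall>y\<in>Y. (n + x, y) \<notin> (net Z)\<^sup>*)"

lemma separates_mono: "Z \<subseteq> Z' \<Longrightarrow> separates Z \<Longrightarrow> separates Z'"
  using rtrancl_mono[of "net Z'" "net Z"] unfolding separates_def net_def by blast

lemma A_lt: "A \<subseteq> {..<n}"
  using Ant_verts verts by auto

lemma ends_in_A: "X \<subseteq> A" "Y \<subseteq> A"
  using subsets verts by (auto simp: Ant_def anterior_iff)

lemma netI:
  assumes "u \<in> A" "v \<in> A"
  shows "u \<notin> Z \<Longrightarrow> (u, n + u) \<in> net Z"
    and "adjacent G u v \<Longrightarrow> (n + u, v) \<in> net Z"
    and "arrowhead G u v \<Longrightarrow> (n + u, n + n + v) \<in> net Z"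
    and "arrowhead G u v \<Longrightarrow> (n + n + v, u) \<in> net Z"
    and "(u, v) \<in> bid G \<Longrightarrow> (n + n + u, n + n + v) \<in> net Z"
  using assms A_lt by (auto simp: net_def kind.simps)

lemma netE:
  assumes "(a, b) \<in> net Z" "Z \<subseteq> R"
  obtains
    u where "u \<in> A" "u \<notin> Z" "a = u" "b = n + u"
  | u v where "u \<in> A" "v \<in> A" "adjacent G u v" "a = n + u" "b = v"
  | u v where "u \<in> A" "v \<in> A" "arrowhead G u v" "a = n + u" "b = n + n + v"
  | u v where "u \<in> A" "v \<in> A" "arrowhead G u v" "a = n + n + v" "b = u"
  | u v where "u \<in> A" "v \<in> A" "(u, v) \<in> bid G" "a = n + n + u" "b = n + n + v"
proof -
  have ab: "a < n + n + n" "b < n + n + n" "kind n G A R a b = 1 \<or> kind n G A R a b = 2 \<and> a \<notin> Z"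
    using assms by (auto simp: net_def)
  consider "a < n" | u where "a = n + u" "u < n" | u where "a = n + n + u"
    by (metis add.assoc le_add_diff_inverse linorder_not_less nat_add_left_cancel_less)
  then show ?thesis
  proof cases
    case 1
    then show ?thesis using ab assms(2) that(1)[of a] by (auto simp: kind.simps split: if_splits split_of_bool_asm)
  next
    case (2 u)
    then show ?thesis using ab that(2)[of u b] that(3)[of u "b - (n + n)"]
      by (auto simp: kind.simps split: if_splits split_of_bool_asm)
  next
    case (3 u)
    then show ?thesis using ab that(4)[of b u] that(5)[of u "b - (n + n)"]
      by (auto simp: kind.simps split: if_splits split_of_bool_asm)
  qed
qed

text \<open>The implication leads from \<open>separates\<close> to \<open>m_separator\<close>. An
  open walk lifts to a network path: colliders are traversed through their third copy,
  non-colliders, which avoid \<open>Z\<close>, from entry to exit copy. That colliders lie in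
  \<open>An G Z\<close> is used only to keep the walk inside \<open>A\<close>.\<close>

lemma separates_if_m_separator:
  assumes sep: "separates Z" and Z: "Z \<subseteq> R" "Z \<subseteq> A"
  shows "m_separator G X Y Z"
proof -
  have False if uv: "u \<in> X" "v \<in> Y" and mc: "m_connected G Z u v" for u v
  proof -
    obtain p where p: "open_walk Z p" "hd p = u" "last p = v"
      using mc unfolding m_connected_iff_open_walk by blast
    have "set p \<subseteq> A" using open_walk_in_Ant[OF p(1) Z(2)] p uv ends_in_A by blast
    then have inA: "p ! i \<in> A" if "i < length p" for i using that by auto
    have pne: "p \<noteq> []" using p by (auto simp: open_walk_def walk_def)
    have adj: "adjacent G (p ! i) (p ! Suc i)" if "Suc i < length p" for i
      using p that by (auto simp: open_walk_def walk_def)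
    \<comment> \<open>The copy from which the walk leaves position \<open>i\<close>. Two consecutive
      colliders have arrowheads at both ends of their common edge, so this edge is
      bidirected.\<close>
    let ?pos = "\<lambda>i. if collider G p i then n + n + p ! i else n + p ! i"
    have step: "(?pos i, ?pos (Suc i)) \<in> (net Z)\<^sup>*" if i: "Suc i < length p" for i
    proof (cases "collider G p (Suc i)")
      case True
      then have h: "arrowhead G (p ! i) (p ! Suc i)" by (simp add: collider_def)
      have "(?pos i, n + n + p ! Suc i) \<in> net Z"
      proof (cases "collider G p i")
        case True
        then have "(p ! i, p ! Suc i) \<in> bid G" using h arrowheads_bid by (simp add: collider_def)
        then show ?thesis using True netI(5) inA i by simp
      next
        case False
        then show ?thesis using h netI(3) inA i by simp
      qed
      then show ?thesis using True by auto
    next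
      case False
      have "(?pos i, p ! Suc i) \<in> net Z"
      proof (cases "collider G p i")
        case True
        then have "arrowhead G (p ! Suc i) (p ! i)" by (simp add: collider_def)
        then show ?thesis using True netI(4) inA i by simp
      next
        case False
        then show ?thesis using adj[OF i] netI(2) inA i by simp
      qed
      moreover have "p ! Suc i \<notin> Z" using p(1) i False by (auto simp: open_walk_def passable_def)
      then have "(p ! Suc i, n + p ! Suc i) \<in> net Z" using netI(1) inA i by blast
      ultimately show ?thesis using False by simp
    qed
    have reach: "i < length p \<Longrightarrow> (?pos 0, ?pos i) \<in> (net Z)\<^sup>*" for i
    proof (induction i)
      case (Suc i)
      then show ?case using step[of i] by (meson Suc_lessD rtrancl_trans)
    qed auto
    \<comment> \<open>Since \<open>X\<close> and \<open>Y\<close> are disjoint, the walk has at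
      least one edge. The last arc is treated separately because the target is the entry copy of the
      last node.\<close>
    obtain k where k: "length p = Suc (Suc k)"
    proof (cases p rule: rev_cases)
      case (snoc q y)
      then show ?thesis using p uv disjoint that[of "length q - 1"] by (cases q) auto
    qed (use pne in auto)
    have "p ! 0 = u" "p ! Suc k = v" using p pne k by (auto simp: hd_conv_nth last_conv_nth)
    moreover have "(?pos k, p ! Suc k) \<in> net Z"
    proof (cases "collider G p k")
      case True
      then have "arrowhead G (p ! Suc k) (p ! k)" by (simp add: collider_def)
      then show ?thesis using True netI(4) inA k by simp
    next
      case False
      then show ?thesis using adj[of k] netI(2) inA k by simp
    qed
    moreover have "\<not> collider G p 0" by (simp add: collider_def)
    ultimately have "(n + u, v) \<in> (net Z)\<^sup>*" using reach[of k] k by auto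
    then show False using sep uv unfolding separates_def by blast
  qed
  then show ?thesis using Z A_lt verts unfolding m_separator_def by blast
qed

section \<open>Open walks recovered from network paths\<close>

definition half_open :: "nat set \<Rightarrow> nat list \<Rightarrow> bool" where
  "half_open Z p \<longleftrightarrow> walk p \<and> hd p \<in> X \<and> (\<forall>i. Suc i < length p \<longrightarrow> passable Z p i)"

text \<open>Whether the last node of a \<open>half_open\<close> walk is a collider depends on the
  next edge, so its passability is left undecided there; \<open>arrow_end\<close> keeps the half of
  the answer that is already known.\<close>

definition arrow_end :: "nat list \<Rightarrow> bool" where
  "arrow_end p \<longleftrightarrow> 2 \<le> length p \<and> arrowhead G (p ! (length p - 2)) (last p)"

lemma half_open_snoc:
  assumes p: "half_open Z p" and adj: "adjacent G (last p) v"
    and pass: "if arrow_end p \<and> arrowhead G v (last p) then last p \<in> An G Z else last p \<notin> Z"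
  shows "half_open Z (p @ [v])" "last (p @ [v]) = v"
    "arrow_end (p @ [v]) \<longleftrightarrow> arrowhead G (last p) v"
proof -
  have pne: "p \<noteq> []" and lst: "last p = p ! (length p - 1)"
    using p by (auto simp: half_open_def walk_def last_conv_nth)
  have "walk (p @ [v])" unfolding walk_def
  proof (intro conjI allI impI)
    fix i assume "Suc i < length (p @ [v])"
    then consider "Suc i < length p" | "Suc i = length p" by fastforce
    then show "adjacent G ((p @ [v]) ! i) ((p @ [v]) ! Suc i)"
    proof cases
      case 1
      then show ?thesis using p by (auto simp: half_open_def walk_def nth_append)
    next
      case 2
      then have "(p @ [v]) ! i = last p" using lst by (simp add: nth_append flip: 2)
      then show ?thesis using 2 adj by (simp add: nth_append)
    qed
  qed (use p adj edge_verts in \<open>auto simp: half_open_def walk_def\<close>)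
  moreover have "passable Z (p @ [v]) i" if i: "Suc i < length (p @ [v])" for i
  proof -
    consider "Suc i < length p" | "Suc i = length p" using i by fastforce
    then show ?thesis
    proof cases
      case 1
      then show ?thesis using p
        by (auto simp: half_open_def passable_def collider_def nth_append)
    next
      case 2
      then have i: "(p @ [v]) ! i = last p" "(p @ [v]) ! Suc i = v" using lst
        by (simp_all add: nth_append flip: 2)
      have "collider G (p @ [v]) i \<longleftrightarrow> arrow_end p \<and> arrowhead G v (last p)"
        unfolding collider_def arrow_end_def i using 2 by (auto simp: nth_append simp flip: 2)
      then show ?thesis using pass i by (simp add: passable_def)
    qed
  qed
  ultimately show "half_open Z (p @ [v])" using p pne by (simp add: half_open_def)
  show "last (p @ [v]) = v" by simp
  show "arrow_end (p @ [v]) \<longleftrightarrow> arrowhead G (last p) v"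
    using pne lst by (auto simp: arrow_end_def nth_append Suc_le_eq)
qed

text \<open>A collider outside \<open>An Z\<close> is an ancestor of \<open>X\<close> or of \<open>Y\<close> along a directed path that
  avoids \<open>Z\<close>; the next two lemmas restart, respectively finish, the walk along this path.\<close>

lemma half_open_from_descendant:
  assumes "(c, x) \<in> (dir G)\<^sup>*" "x \<in> X" "c \<notin> An G Z"
  shows "\<exists>p. half_open Z p \<and> last p = c \<and> \<not> arrow_end p"
  using assms
proof (induction rule: converse_rtrancl_induct)
  case base
  then show ?case using subsets verts
    by (intro exI[of _ "[x]"]) (auto simp: half_open_def walk_def arrow_end_def)
next
  case (step c c')
  then have c': "c' \<notin> An G Z" using An_step by blast
  then obtain p where p: "half_open Z p" "last p = c'" "\<not> arrow_end p" using step by blast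
  have "c' \<notin> Z" using c' An_base edge_verts(1)[OF step(1)] by blast
  moreover have "adjacent G c' c" using step by (simp add: adjacent_def)
  ultimately show ?case
    using half_open_snoc[OF p(1), of c] p dir_no_arrowhead step by metis
qed

lemma open_walk_to_descendant:
  assumes p: "half_open Z p" "last p = c" "c \<in> verts G" and c: "(c, y) \<in> (dir G)\<^sup>*" "y \<in> Y" "c \<notin> An G Z"
  shows "\<exists>p. open_walk Z p \<and> hd p \<in> X \<and> last p \<in> Y"
proof -
  from c(1) have "\<exists>p. half_open Z p \<and> last p = y"
  proof (induction rule: rtrancl_induct)
    case base
    then show ?case using p by blast
  next
    case (step c' d)
    then obtain q where q: "half_open Z q" "last q = c'" by blast
    have "c' \<notin> An G Z" using An_rtrancl step(1) c(3) by blast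
    then have "c' \<notin> Z" using An_base edge_verts(1)[OF step(2)] by blast
    moreover have "adjacent G c' d" using step by (simp add: adjacent_def)
    ultimately show ?case
      using half_open_snoc[OF q(1), of d] q dir_no_arrowhead step(2) by metis
  qed
  then obtain q where q: "half_open Z q" "last q = y" by blast
  have "y \<notin> An G Z" using An_rtrancl c by blast
  then have "y \<notin> Z" using An_base c(2) subsets verts by blast
  have "passable Z q i" if "i < length q" for i
  proof (cases "Suc i < length q")
    case True
    then show ?thesis using q by (simp add: half_open_def)
  next
    case False
    then have "q ! i = last q" using that
      by (metis Suc_lessI diff_Suc_1 last_conv_nth length_0_conv not_less_zero)
    then show ?thesis using False \<open>y \<notin> Z\<close> q by (simp add: passable_def collider_def)
  qed
  then show ?thesis using q c(2) unfolding half_open_def open_walk_def by blast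
qed

lemma m_separator_if_separates:
  assumes sep: "m_separator G X Y Z" and Z: "Z \<subseteq> R" "Z \<subseteq> A"
  shows "separates Z"
proof -
  have no: "\<not> (\<exists>p. open_walk Z p \<and> hd p \<in> X \<and> last p \<in> Y)"
    using sep m_connected_iff_open_walk unfolding m_separator_def by blast
  \<comment> \<open>The critical case is that \<open>u\<close> becomes a collider outside
    \<open>An G Z\<close>. By \<open>Ant_arrowhead\<close> it has a descendant in
    \<open>X \<union> Y\<close>. One in \<open>Y\<close> would complete an open walk, contrary to
    \<open>no\<close>; from one in \<open>X\<close> a new walk arrives at \<open>u\<close> against a
    directed path, hence without arrowhead, and passes \<open>u\<close> as a non-collider.\<close>
  have snoc: "\<exists>q. half_open Z q \<and> last q = v \<and> (arrow_end q \<longleftrightarrow> arrowhead G u v)"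
    if p: "half_open Z p" "last p = u" and u: "u \<in> A" and uv: "adjacent G u v"
      and pass: "u \<notin> Z \<or> arrow_end p \<and> arrowhead G v u" for p u v
  proof (cases "arrow_end p \<and> arrowhead G v u \<and> u \<notin> An G Z")
    case False
    then show ?thesis using half_open_snoc[OF p(1), of v] p uv pass by metis
  next
    case True
    then obtain z where z: "z \<in> X \<union> Y" "(u, z) \<in> (dir G)\<^sup>*" using Ant_arrowhead u by blast
    have uG: "u \<in> verts G" using uv edge_verts(2) by blast
    then have "z \<notin> Y" using open_walk_to_descendant[OF p uG z(2)] no True by blast
    then obtain q where q: "half_open Z q" "last q = u" "\<not> arrow_end q"
      using half_open_from_descendant[OF z(2)] z(1) True by blast
    have "u \<notin> Z" using True An_base uG by blast
    then show ?thesis using half_open_snoc[OF q(1), of v] q uv by metis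
  qed
  \<comment> \<open>The walk in this invariant need not project the network path, since
    \<open>snoc\<close> may restart it elsewhere in \<open>X\<close>. Only its last node and, at a
    third copy, the arrowhead there are remembered.\<close>
  define P where "P a \<longleftrightarrow>
      (\<exists>u\<in>A. \<exists>p. half_open Z p \<and> last p = u \<and>
        (a = u \<or> a = n + u \<and> u \<notin> Z \<or> a = n + n + u \<and> arrow_end p))" for a
  have P: "P a" if x: "x \<in> X" and "(n + x, a) \<in> (net Z)\<^sup>*" for x a
    using that(2)
  proof (induction rule: rtrancl_induct)
    case base
    have "half_open Z [x]" using x subsets verts by (auto simp: half_open_def walk_def)
    moreover have "x \<notin> Z" using x Z disjoint by blast
    ultimately show ?case using x ends_in_A unfolding P_def by fastforce
  next
    case (step a b)
    from step(3) obtain u p where p: "u \<in> A" "half_open Z p" "last p = u"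
      "a = u \<or> a = n + u \<and> u \<notin> Z \<or> a = n + n + u \<and> arrow_end p"
      unfolding P_def by blast
    have lt: "u < n" using p A_lt by blast
    from step(2) Z(1) show ?case
    proof (cases rule: netE)
      case (1 u')
      then have "u' < n" using A_lt by blast
      then have "u' = u" using 1 lt p(4) by auto
      then show ?thesis using 1 p unfolding P_def by blast
    next
      case (2 u' v)
      then have "u' < n" "v < n" using A_lt by blast+
      then have "u' = u" "u \<notin> Z" using 2 lt p(4) by auto
      then show ?thesis using 2 snoc[OF p(2,3,1)] unfolding P_def by blast
    next
      case (3 u' v)
      then have "u' < n" "v < n" using A_lt by blast+
      then have "u' = u" "u \<notin> Z" using 3 lt p(4) by auto
      then show ?thesis using 3 snoc[OF p(2,3,1)] arrowhead_adjacent unfolding P_def by blast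
    next
      case (4 v c)
      then have "c < n" "v < n" using A_lt by blast+
      then have "c = u" "arrow_end p" using 4 lt p(4) by auto
      then show ?thesis using 4 snoc[OF p(2,3,1)] arrowhead_adjacent unfolding P_def by blast
    next
      case (5 c v)
      then have "c < n" "v < n" using A_lt by blast+
      then have "c = u" "arrow_end p" using 5 lt p(4) by auto
      moreover have "arrowhead G c v" "arrowhead G v c" "adjacent G c v"
        using 5 sym_edges by (auto simp: arrowhead_def adjacent_def)
      ultimately show ?thesis using 5 snoc[OF p(2,3,1)] unfolding P_def by blast
    qed
  qed
  show ?thesis
    unfolding separates_def
  proof (intro ballI notI)
    fix x y assume xy: "x \<in> X" "y \<in> Y" and "(n + x, y) \<in> (net Z)\<^sup>*"
    then obtain u p where u: "u \<in> A" "half_open Z p" "last p = u" and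
      "y = u \<or> y = n + u \<or> y = n + n + u" using P unfolding P_def by blast
    moreover have "y < n" using xy subsets by auto
    ultimately have [simp]: "u = y" by auto
    have "y \<notin> Z" "y \<in> verts G" using xy Z disjoint subsets verts by auto
    then show False
    proof (cases "y \<in> An G Z")
      case False
      then show False using open_walk_to_descendant[of Z p y y] u \<open>y \<in> verts G\<close> xy no by auto
    next
      case True
      have "passable Z p i" if "i < length p" for i
      proof (cases "Suc i < length p")
        case True
        then show ?thesis using u by (simp add: half_open_def)
      next
        case False
        then have "p ! i = last p" using that
          by (metis Suc_lessI diff_Suc_1 last_conv_nth length_0_conv not_less_zero)
        then show ?thesis using False \<open>y \<notin> Z\<close> u by (simp add: passable_def collider_def)
      qed
      then show ?thesis using u xy no unfolding half_open_def open_walk_def by auto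
    qed
  qed
qed

end

section \<open>Push-relabel without a source\<close>

locale supply_net =
  fixes m :: nat and cap :: "nat \<Rightarrow> nat \<Rightarrow> real" and src :: "nat \<Rightarrow> real" and sinks :: "nat set"
  assumes cap_nonneg: "a < m \<Longrightarrow> b < m \<Longrightarrow> 0 \<le> cap a b"
    and src_nonneg: "a < m \<Longrightarrow> 0 \<le> src a"
    and sinks: "sinks \<subseteq> {..<m}" "sinks \<noteq> {}"
begin

text \<open>The usual value of a cut after adding a super source with an arc of capacity
  \<open>src b\<close> to each \<open>b\<close>: the super source is on the side of
  \<open>S\<close>, so the supplies of nodes outside \<open>S\<close> are cut as well.\<close>

definition cut_value :: "nat set \<Rightarrow> real" where
  "cut_value S = (\<Sum>b\<in>{..<m} - S. src b + (\<Sum>a\<in>S. cap a b))"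

lemma cut_value_ge:
  assumes S: "S \<subseteq> {..<m}" and b: "b < m" "b \<notin> S"
  shows "src b \<le> cut_value S" "a \<in> S \<Longrightarrow> cap a b \<le> cut_value S"
proof -
  have fin: "finite S" using S finite_subset by blast
  have nn: "0 \<le> (\<Sum>a\<in>S. cap a b)" if "b < m" for b
    using that S cap_nonneg by (intro sum_nonneg) auto
  have *: "src b + (\<Sum>a\<in>S. cap a b) \<le> cut_value S"
    unfolding cut_value_def
    by (rule member_le_sum[of b _ "\<lambda>b. src b + (\<Sum>a\<in>S. cap a b)"])
       (use b nn src_nonneg in \<open>auto intro: add_nonneg_nonneg\<close>)
  then show "src b \<le> cut_value S" using nn[OF b(1)] by linarith
  assume "a \<in> S"
  then have "cap a b \<le> (\<Sum>a\<in>S. cap a b)"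
    by (intro member_le_sum) (use S b cap_nonneg fin in auto)
  then show "cap a b \<le> cut_value S" using * src_nonneg[OF b(1)] by linarith
qed

text \<open>The net flow from \<open>a\<close> to \<open>b\<close> is
  \<open>cap a b - r a b\<close>; the first condition makes it antisymmetric. All supply counts as
  excess from the start, so there is no source to which excess could return.\<close>

definition preflow :: "(nat \<Rightarrow> nat \<Rightarrow> real) \<Rightarrow> (nat \<Rightarrow> real) \<Rightarrow> bool" where
  "preflow r e \<longleftrightarrow>
     (\<forall>a<m. \<forall>b<m. 0 \<le> r a b \<and> r a b + r b a = cap a b + cap b a) \<and>
     (\<forall>b<m. 0 \<le> e b \<and> e b = src b + (\<Sum>a<m. cap a b - r a b))"

text \<open>In the total excess of the complement of \<open>S\<close> the flow inside the complement
  cancels by antisymmetry (\<open>inner\<close>). What remains is its supply plus the net flow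
  arriving from \<open>S\<close>.\<close>

lemma excess_sum:
  assumes r: "preflow r e" and S: "S \<subseteq> {..<m}"
  shows "(\<Sum>b\<in>{..<m} - S. e b) = cut_value S - (\<Sum>b\<in>{..<m} - S. \<Sum>a\<in>S. r a b)"
proof -
  let ?W = "{..<m} - S"
  have fin: "finite S" using S finite_subset by blast
  let ?f = "\<lambda>a b. cap a b - r a b"
  have anti: "?f a b = - ?f b a" if "a \<in> ?W" "b \<in> ?W" for a b
  proof -
    have "r a b + r b a = cap a b + cap b a" using r that by (auto simp: preflow_def)
    then show ?thesis by linarith
  qed
  have "(\<Sum>b\<in>?W. \<Sum>a\<in>?W. ?f a b) = (\<Sum>b\<in>?W. \<Sum>a\<in>?W. ?f b a)"
    by (rule sum.swap)
  also have "\<dots> = (\<Sum>b\<in>?W. \<Sum>a\<in>?W. - ?f a b)"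
    by (intro sum.cong refl) (use anti in blast)
  also have "\<dots> = - (\<Sum>b\<in>?W. \<Sum>a\<in>?W. ?f a b)"
    by (simp only: sum_negf)
  finally have inner: "(\<Sum>b\<in>?W. \<Sum>a\<in>?W. ?f a b) = 0" by linarith
  have "(\<Sum>b\<in>?W. e b) = (\<Sum>b\<in>?W. src b + ((\<Sum>a\<in>S. ?f a b) + (\<Sum>a\<in>?W. ?f a b)))"
  proof (rule sum.cong[OF refl])
    fix b assume "b \<in> ?W"
    then have "e b = src b + (\<Sum>a<m. ?f a b)" using r by (simp add: preflow_def)
    also have "(\<Sum>a<m. ?f a b) = (\<Sum>a\<in>S. ?f a b) + (\<Sum>a\<in>?W. ?f a b)"
      using sum.subset_diff[OF S, of "\<lambda>a. ?f a b"] by simp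
    finally show "e b = src b + ((\<Sum>a\<in>S. ?f a b) + (\<Sum>a\<in>?W. ?f a b))" .
  qed
  also have "\<dots> = (\<Sum>b\<in>?W. (src b + (\<Sum>a\<in>S. cap a b)) - (\<Sum>a\<in>S. r a b)) + (\<Sum>b\<in>?W. \<Sum>a\<in>?W. ?f a b)"
    by (simp add: sum.distrib sum_subtractf algebra_simps)
  also have "\<dots> = cut_value S - (\<Sum>b\<in>?W. \<Sum>a\<in>S. r a b)"
    using inner by (simp add: cut_value_def sum_subtractf)
  finally show ?thesis .
qed

text \<open>Max-flow min-cut duality: the total excess of the sinks equals the value of
  \<open>S\<close> and is at most the value of any \<open>T\<close>. Excess stranded inside
  \<open>S\<close> does no harm, which is why it never has to be sent back.\<close>

lemma min_cut:
  assumes r: "preflow r e"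
    and S: "S \<subseteq> {..<m}" "S \<inter> sinks = {}"
    and saturated: "\<And>a b. a \<in> S \<Longrightarrow> b < m \<Longrightarrow> b \<notin> S \<Longrightarrow> r a b = 0"
    and drained: "\<And>b. b < m \<Longrightarrow> b \<notin> S \<Longrightarrow> b \<notin> sinks \<Longrightarrow> e b = 0"
    and T: "T \<subseteq> {..<m}" "T \<inter> sinks = {}"
  shows "cut_value S \<le> cut_value T"
proof -
  have "(\<Sum>b\<in>{..<m} - S. \<Sum>a\<in>S. r a b) = 0"
    using saturated by (intro sum.neutral ballI) auto
  then have "cut_value S = (\<Sum>b\<in>{..<m} - S. e b)" using excess_sum[OF r S(1)] by simp
  also have "\<dots> = (\<Sum>b\<in>sinks. e b)"
    by (rule sum.mono_neutral_right) (use sinks S drained in auto)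
  also have "\<dots> \<le> (\<Sum>b\<in>{..<m} - T. e b)"
    by (rule sum_mono2) (use sinks T r in \<open>auto simp: preflow_def\<close>)
  also have "\<dots> \<le> cut_value T"
  proof -
    have "0 \<le> (\<Sum>b\<in>{..<m} - T. \<Sum>a\<in>T. r a b)"
      by (intro sum_nonneg) (use r T in \<open>auto simp: preflow_def\<close>)
    then show ?thesis using excess_sum[OF r T(1)] by simp
  qed
  finally show ?thesis .
qed

lemma preflow_push:
  assumes r: "preflow r e" and uv: "u < m" "v < m" "u \<noteq> v" and x: "0 \<le> x" "x \<le> e v" "x \<le> r v u"
  shows "preflow (r(u := (r u)(v := r u v + x), v := (r v)(u := r v u - x)))
    (e(u := e u + x, v := e v - x))" (is "preflow ?r ?e")
proof -
  have r_eq: "?r a b = r a b + (if a = u \<and> b = v then x else if a = v \<and> b = u then - x else 0)" for a b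
    using uv by auto
  have sum: "(\<Sum>a<m. cap a b - ?r a b) = (\<Sum>a<m. cap a b - r a b) + (if b = u then x else if b = v then - x else 0)"
    if "b < m" for b
  proof -
    have *: "cap a b - ?r a b = (cap a b - r a b)
        + ((if a = u then (if b = v then - x else 0) else 0) + (if a = v then (if b = u then x else 0) else 0))" for a
      using uv(3) unfolding r_eq by simp
    have "(\<Sum>a<m. cap a b - ?r a b) = (\<Sum>a<m. (cap a b - r a b)
        + ((if a = u then (if b = v then - x else 0) else 0) + (if a = v then (if b = u then x else 0) else 0)))"
      by (rule sum.cong[OF refl *])
    also have "\<dots> = (\<Sum>a<m. cap a b - r a b) + (if b = u then x else if b = v then - x else 0)"
      using uv unfolding sum.distrib by simp
    finally show ?thesis .
  qed
  have r1: "0 \<le> r a b" "r a b + r b a = cap a b + cap b a" if "a < m" "b < m" for a b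
    using r that by (auto simp: preflow_def)
  have e1: "0 \<le> e b" "e b = src b + (\<Sum>a<m. cap a b - r a b)" if "b < m" for b
    using r that by (auto simp: preflow_def)
  show ?thesis
    unfolding preflow_def
  proof (intro conjI allI impI)
    fix a b assume ab: "a < m" "b < m"
    show "0 \<le> ?r a b"
      unfolding r_eq using r1(1)[OF ab] x by (cases "a = u"; cases "b = v"; cases "a = v"; cases "b = u") auto
    show "?r a b + ?r b a = cap a b + cap b a"
    proof -
      have "?r a b + ?r b a = r a b + r b a"
        unfolding r_eq using uv(3) by (cases "a = u"; cases "b = v"; cases "a = v"; cases "b = u") auto
      then show ?thesis using r1(2)[OF ab] by linarith
    qed
  next
    fix b assume b: "b < m"
    show "0 \<le> ?e b" using e1(1)[OF b] e1(1)[OF uv(1)] x by (cases "b = v"; cases "b = u") auto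
    have "?e b = e b + (if b = u then x else if b = v then - x else 0)" using uv(3) by simp
    then show "?e b = src b + (\<Sum>a<m. cap a b - ?r a b)"
      unfolding sum[OF b] using e1(2)[OF b] by linarith
  qed
qed

section \<open>Labels, current arcs and the potential\<close>

definition active :: "(nat \<Rightarrow> real) \<Rightarrow> (nat \<Rightarrow> nat) \<Rightarrow> nat \<Rightarrow> bool" where
  "active e d a \<longleftrightarrow> 0 < e a \<and> d a < m + 1 \<and> a \<notin> sinks"

text \<open>The state of the algorithm: residual capacities \<open>r\<close>, excesses \<open>e\<close>, labels \<open>d\<close>, current arcs
  \<open>c\<close>, and the node \<open>v\<close> reached by the current pass over \<open>0, \<dots>, m - 1\<close>.  The counter \<open>L\<close> bounds the
  labels of active nodes, strictly for those already visited in this pass; so it can be decreased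
  when the pass ends.  Nodes with label \<open>m + 1\<close> are given up, since they cannot reach a sink.\<close>

definition invariant ::
    "(nat \<Rightarrow> nat \<Rightarrow> real) \<Rightarrow> (nat \<Rightarrow> real) \<Rightarrow> (nat \<Rightarrow> nat) \<Rightarrow> (nat \<Rightarrow> nat) \<Rightarrow> nat \<Rightarrow> nat \<Rightarrow> bool" where
  "invariant r e d c v L \<longleftrightarrow> preflow r e \<and> v \<le> m \<and>
     (\<forall>a<m. \<forall>b<m. 0 < r a b \<longrightarrow> d a \<le> d b + 1) \<and>
     (\<forall>a<m. c a \<le> m \<and> d a \<le> m + 1) \<and> (\<forall>a\<in>sinks. d a = 0) \<and>
     (\<forall>a<m. \<forall>b<c a. 0 < r a b \<longrightarrow> d a \<le> d b) \<and>
     (\<forall>a<m. active e d a \<longrightarrow> (if a < v then d a < L else d a \<le> L))"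

text \<open>\<open>L\<close> grows only by relabelling, so \<open>L\<close> plus the label increases
  still possible does not grow, and it drops at the end of a pass; its factor \<open>m + 1\<close>
  pays for resetting \<open>v\<close> from \<open>m\<close> to \<open>0\<close>. In the last sum the
  same factor pays for resetting the current arc after a relabelling. Thus every step lowers the
  total, which is cubic at the start.\<close>

definition potential :: "(nat \<Rightarrow> nat) \<Rightarrow> (nat \<Rightarrow> nat) \<Rightarrow> nat \<Rightarrow> nat \<Rightarrow> nat" where
  "potential d c v L = (m + 1) * (L + (\<Sum>a<m. m + 1 - d a)) + (m - v) +
     (\<Sum>a<m. (m + 1) * (m + 1 - d a) + (m - c a))"

lemma invariant_init:
  "(\<And>a. a < m \<Longrightarrow> d a = 0 \<and> c a = 0) \<Longrightarrow> invariant cap src d c 0 0"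
  using cap_nonneg src_nonneg sinks(1) by (auto simp: invariant_def preflow_def active_def)

lemma potential_init:
  assumes "\<And>a. a < m \<Longrightarrow> d a = 0 \<and> c a = 0"
  shows "potential d c 0 0 \<le> 3 * (m + 1) ^ 3"
proof -
  have "(\<Sum>a<m. m + 1 - d a) = (\<Sum>a<m. m + 1)"
    "(\<Sum>a<m. (m + 1) * (m + 1 - d a) + (m - c a)) = (\<Sum>a<m. (m + 1) * (m + 1) + m)"
    using assms by (intro sum.cong; simp)+
  then have "potential d c 0 0 = m * ((m + 1) * (m + 1) + m) + (m + 1) * (m * (m + 1)) + m"
    by (simp add: potential_def)
  also have "\<dots> \<le> 3 * (m + 1) ^ 3"
    by (simp add: power3_eq_cube algebra_simps)
  finally show ?thesis .
qed

lemma sum_decrease: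
  fixes f g :: "nat \<Rightarrow> nat"
  assumes "v < m" "\<And>a. a \<noteq> v \<Longrightarrow> g a = f a" "g v + k = f v"
  shows "(\<Sum>a<m. g a) + k = (\<Sum>a<m. f a)"
proof -
  have "(\<Sum>a<m. g a) = g v + (\<Sum>a\<in>{..<m} - {v}. g a)"
    using assms(1) by (simp add: sum.remove)
  moreover have "(\<Sum>a<m. f a) = f v + (\<Sum>a\<in>{..<m} - {v}. f a)"
    using assms(1) by (simp add: sum.remove)
  moreover have "(\<Sum>a\<in>{..<m} - {v}. g a) = (\<Sum>a\<in>{..<m} - {v}. f a)"
    using assms(2) by (intro sum.cong) auto
  ultimately show ?thesis using assms(3) by linarith
qed

lemma potential_advance:
  assumes "v < m" "c v < m"
  shows "potential d (c(v := c v + 1)) v L < potential d c v L"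
proof -
  have "(\<Sum>a<m. (m + 1) * (m + 1 - d a) + (m - (c(v := c v + 1)) a)) + 1
      = (\<Sum>a<m. (m + 1) * (m + 1 - d a) + (m - c a))"
    by (rule sum_decrease[OF assms(1)]) (use assms in auto)
  then show ?thesis unfolding potential_def by linarith
qed

lemma potential_relabel:
  assumes "v < m" "c v = m" "d v < m + 1"
  shows "potential (d(v := d v + 1)) (c(v := 0)) v (L + 1) < potential d c v L"
proof -
  let ?d = "d(v := d v + 1)" and ?c = "c(v := 0)"
  have "(m + 1) * (m + 1 - (d v + 1)) + (m + 1) = (m + 1) * (m + 1 - d v)"
  proof -
    obtain q where q: "m + 1 - d v = Suc q" using assms(3) by (metis Suc_diff_Suc add.commute plus_1_eq_Suc)
    then have "m + 1 - (d v + 1) = q" by linarith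
    then show ?thesis using q by simp
  qed
  then have "(\<Sum>a<m. (m + 1) * (m + 1 - ?d a) + (m - ?c a)) + 1
      = (\<Sum>a<m. (m + 1) * (m + 1 - d a) + (m - c a))"
    by (intro sum_decrease[OF assms(1)]) (use assms in auto)
  moreover have "(\<Sum>a<m. m + 1 - ?d a) + 1 = (\<Sum>a<m. m + 1 - d a)"
    by (rule sum_decrease[OF assms(1)]) (use assms in auto)
  then have *: "L + 1 + (\<Sum>a<m. m + 1 - ?d a) = L + (\<Sum>a<m. m + 1 - d a)" by linarith
  ultimately show ?thesis unfolding potential_def * by linarith
qed

lemma potential_next: "v < m \<Longrightarrow> potential d c (v + 1) L < potential d c v L"
  unfolding potential_def by linarith

lemma potential_wrap: "0 < L \<Longrightarrow> potential d c 0 (L - 1) < potential d c m L"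
  by (cases L) (simp_all add: potential_def)

section \<open>Preservation of the invariant, and the cut at termination\<close>

context
  fixes r e d c v L assumes inv: "invariant r e d c v L"
begin

lemma
  shows invariant_preflow: "preflow r e"
    and invariant_label: "a < m \<Longrightarrow> b < m \<Longrightarrow> 0 < r a b \<Longrightarrow> d a \<le> d b + 1"
    and invariant_bounds: "v \<le> m" "a < m \<Longrightarrow> c a \<le> m" "a < m \<Longrightarrow> d a \<le> m + 1"
    and invariant_sinks: "a \<in> sinks \<Longrightarrow> d a = 0"
    and invariant_current: "a < m \<Longrightarrow> b < c a \<Longrightarrow> 0 < r a b \<Longrightarrow> d a \<le> d b"
    and invariant_active: "a < m \<Longrightarrow> active e d a \<Longrightarrow> if a < v then d a < L else d a \<le> L"
  using inv unfolding invariant_def by blast+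

lemma invariant_next: "v < m \<Longrightarrow> \<not> active e d v \<Longrightarrow> invariant r e d c (v + 1) L"
  using inv unfolding invariant_def by (auto simp: less_Suc_eq)

lemma invariant_wrap:
  assumes "v = m" "0 < L" shows "invariant r e d c 0 (L - 1)"
proof -
  have "d a \<le> L - 1" if "a < m" "active e d a" for a
    using invariant_active[OF that] assms that(1) by simp
  then show ?thesis using inv unfolding invariant_def by auto
qed

text \<open>Residual arcs satisfy \<open>d a \<le> d b + 1\<close>. If the current arc is residual
  without equality, then \<open>d v \<le> d (c v)\<close>, which is what the invariant demands of
  arcs passed over.\<close>

lemma invariant_advance:
  assumes "v < m" "c v < m" "\<not> (0 < r v (c v) \<and> d v = d (c v) + 1)"
  shows "invariant r e d (c(v := c v + 1)) v L"
proof -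
  have "d v \<le> d b" if "b < c v + 1" "0 < r v b" for b
  proof (cases "b = c v")
    case True
    then show ?thesis using invariant_label[of v b] assms that by fastforce
  next
    case False
    then show ?thesis using invariant_current[of v b] assms that by auto
  qed
  then show ?thesis using inv assms unfolding invariant_def by auto
qed

text \<open>Once all arcs are passed over, every residual arc out of \<open>v\<close> satisfies
  \<open>d v \<le> d b\<close>, so the label may rise by one. Raising \<open>L\<close> along with it
  keeps the bounds on active labels.\<close>

lemma invariant_relabel:
  assumes v: "v < m" "c v = m" "active e d v"
  shows "invariant r e (d(v := d v + 1)) (c(v := 0)) v (L + 1)"
proof -
  have cur: "d v \<le> d b" if "b < m" "0 < r v b" for b
    using invariant_current[of v b] v that by auto
  let ?d = "d(v := d v + 1)" and ?c = "c(v := 0)"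
  have vs: "v \<notin> sinks" "d v < m + 1" using v by (auto simp: active_def)
  have "\<forall>a<m. \<forall>b<m. 0 < r a b \<longrightarrow> ?d a \<le> ?d b + 1"
    using cur invariant_label by (fastforce intro: le_SucI)
  moreover have "\<forall>a<m. \<forall>b<?c a. 0 < r a b \<longrightarrow> ?d a \<le> ?d b"
    using invariant_current by (fastforce intro: le_SucI)
  moreover have "\<forall>a<m. ?c a \<le> m \<and> ?d a \<le> m + 1" "\<forall>a\<in>sinks. ?d a = 0"
    using vs invariant_bounds invariant_sinks by auto
  moreover have "\<forall>a<m. active e ?d a \<longrightarrow> (if a < v then ?d a < L + 1 else ?d a \<le> L + 1)"
  proof (intro allI impI)
    fix a assume a: "a < m" "active e ?d a"
    then have "active e d a" by (auto simp: active_def split: if_splits)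
    then show "if a < v then ?d a < L + 1 else ?d a \<le> L + 1"
      using invariant_active[of a] a by (auto split: if_splits)
  qed
  ultimately show ?thesis
    unfolding invariant_def using invariant_preflow invariant_bounds(1) by blast
qed

text \<open>The common part of both kinds of push: either the arc is saturated and the current arc
  may move on, or the excess is used up and the pass may move on. Only the reverse arc can become
  residual, and it goes up in label. The receiving node has a label below
  \<open>d v \<le> L\<close>, hence strictly below \<open>L\<close>, as required even if the pass
  has already visited it.\<close>

lemma push_keeps:
  assumes uv: "v < m" "u < m" "0 < r v u" "d v = d u + 1" "active e d v" and x: "0 \<le> x" "x \<le> e v" "x \<le> r v u"
    and c': "c' v \<le> m" "\<And>b. b < c' v \<Longrightarrow> b < c v \<or> b = u \<and> x = r v u" "\<And>a. a \<noteq> v \<Longrightarrow> c' a = c a"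
    and v': "v' = v \<or> v' = v + 1 \<and> x = e v"
  shows "invariant (r(u := (r u)(v := r u v + x), v := (r v)(u := r v u - x)))
    (e(u := e u + x, v := e v - x)) d c' v' L" (is "invariant ?r ?e d c' v' L")
proof -
  have ne: "u \<noteq> v" using uv by auto
  have r: "?r a b = r a b + (if a = u \<and> b = v then x else if a = v \<and> b = u then - x else 0)" for a b
    using ne by auto
  have r': "0 < r a b \<or> a = u \<and> b = v" if "0 < ?r a b" for a b
    using that x unfolding r by (auto split: if_splits)
  have "preflow ?r ?e"
    by (rule preflow_push) (use invariant_preflow uv ne x in auto)
  moreover have "d a \<le> d b + 1" if "a < m" "b < m" "0 < ?r a b" for a b
    using r'[OF that(3)] invariant_label[of a b] that uv by auto
  moreover have "c' a \<le> m" if "a < m" for a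
    using invariant_bounds(2)[OF that] c' by (cases "a = v") auto
  moreover have "d a \<le> d b" if a: "a < m" "b < c' a" "0 < ?r a b" for a b
  proof -
    consider "a = u \<and> b = v" | "0 < r a b" "b < c a" | "a = v" "b = u" "x = r v u"
      using r'[OF a(3)] c'(2)[of b] c'(3)[of a] a(2) by (cases "a = v") auto
    then show ?thesis
    proof cases
      case 3
      then show ?thesis using a(3) ne by simp
    qed (use uv invariant_current[of a b] a in auto)
  qed
  moreover have "if a < v' then d a < L else d a \<le> L" if a: "a < m" "active ?e d a" for a
  proof -
    have dv: "d v \<le> L" using invariant_active[of v] uv by simp
    show ?thesis
    proof (cases "a = u")
      case True
      then show ?thesis using dv uv by auto
    next
      case False
      then have act: "active e d a" using a uv by (auto simp: active_def split: if_splits)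
      show ?thesis
      proof (cases "a = v")
        case True
        then show ?thesis using v' a dv by (auto simp: active_def)
      next
        case False
        then show ?thesis using invariant_active[OF a(1) act] v' by (auto split: if_splits)
      qed
    qed
  qed
  moreover have "v' \<le> m" using uv v' by auto
  ultimately show ?thesis
    unfolding invariant_def using invariant_bounds(3) invariant_sinks by blast
qed

lemma invariant_push_all:
  assumes "v < m" "c v < m" "0 < r v (c v)" "d v = d (c v) + 1" "active e d v" "e v \<le> r v (c v)"
  shows "invariant (r(c v := (r (c v))(v := r (c v) v + e v), v := (r v)(c v := r v (c v) - e v)))
    (e(c v := e (c v) + e v, v := 0)) d c (v + 1) L"
proof -
  have "invariant (r(c v := (r (c v))(v := r (c v) v + e v), v := (r v)(c v := r v (c v) - e v)))
      (e(c v := e (c v) + e v, v := e v - e v)) d c (v + 1) L"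
    using assms invariant_bounds(2) by (intro push_keeps) (simp_all add: active_def)
  then show ?thesis by simp
qed

lemma invariant_push_saturating:
  assumes "v < m" "c v < m" "0 < r v (c v)" "d v = d (c v) + 1" "active e d v" "r v (c v) < e v"
  shows "invariant (r(c v := (r (c v))(v := r (c v) v + r v (c v)), v := (r v)(c v := 0)))
    (e(c v := e (c v) + r v (c v), v := e v - r v (c v))) d (c(v := c v + 1)) v L"
proof -
  have "invariant (r(c v := (r (c v))(v := r (c v) v + r v (c v)), v := (r v)(c v := r v (c v) - r v (c v))))
      (e(c v := e (c v) + r v (c v), v := e v - r v (c v))) d (c(v := c v + 1)) v L"
    using assms by (intro push_keeps) (auto simp: less_Suc_eq)
  then show ?thesis by simp
qed

lemma gap_min_cut:
  assumes stop: "v = m" "L = 0" and k: "1 \<le> k" "k \<le> m" "\<And>a. a < m \<Longrightarrow> d a \<noteq> k"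
    and S: "S = {a. a < m \<and> k < d a}"
  shows "S \<inter> sinks = {}"
    and "T \<subseteq> {..<m} \<Longrightarrow> T \<inter> sinks = {} \<Longrightarrow> cut_value S \<le> cut_value T"
proof -
  show SS: "S \<inter> sinks = {}" using invariant_sinks S by auto
  assume T: "T \<subseteq> {..<m}" "T \<inter> sinks = {}"
  show "cut_value S \<le> cut_value T"
  proof (rule min_cut[OF invariant_preflow _ SS _ _ T])
    fix a b assume ab: "a \<in> S" "b < m" "b \<notin> S"
    then have "k < d a" "d b < k" using k(3)[of b] S by auto
    then have "\<not> d a \<le> d b + 1" by simp
    then have "\<not> 0 < r a b" using invariant_label[of a b] ab S by auto
    moreover have "0 \<le> r a b" using invariant_preflow ab S unfolding preflow_def by blast
    ultimately show "r a b = 0" by simp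
  next
    fix b assume b: "b < m" "b \<notin> S" "b \<notin> sinks"
    then have "\<not> active e d b" using invariant_active[of b] stop by auto
    then have "\<not> 0 < e b" using b S k(2) by (auto simp: active_def)
    moreover have "0 \<le> e b" using invariant_preflow b unfolding preflow_def by blast
    ultimately show "e b = 0" by simp
  qed (use S in auto)
qed

text \<open>Pigeonhole: some sink has label \<open>0\<close>, so the other \<open>m - 1\<close>
  nodes cannot occupy all of the labels from \<open>1\<close> to \<open>m\<close>. Hence a gap
  exists below the label at which nodes are given up.\<close>

lemma gap_bound:
  assumes "\<And>j. 1 \<le> j \<Longrightarrow> j < k \<Longrightarrow> \<exists>a<m. d a = j"
  shows "k \<le> m"
proof -
  obtain t where t: "t \<in> sinks" using sinks by blast
  have "{1..<k} \<subseteq> d ` ({..<m} - {t})"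
    using assms invariant_sinks[OF t] by fastforce
  then have "card {1..<k} \<le> card (d ` ({..<m} - {t}))" by (intro card_mono) auto
  also have "\<dots> \<le> card ({..<m} - {t})" by (intro card_image_le) auto
  also have "\<dots> = m - 1" using t sinks by auto
  finally have "k - 1 \<le> m - 1" by simp
  moreover have "0 < m" using t sinks by auto
  ultimately show ?thesis by linarith
qed

end

end

section \<open>Minimum cuts of the separation network\<close>

locale weighted_network = network +
  fixes wt :: "nat \<Rightarrow> real"
  assumes Y_nonempty: "Y \<noteq> {}" and wt_pos: "u \<in> R \<Longrightarrow> 0 < wt u"
begin

text \<open>A stand-in for infinity. If some subset of \<open>R\<close> separates, a minimum cut
  costs at most \<open>sum wt R\<close>; the doubled sum is strictly larger as soon as
  \<open>R\<close> is non-empty.\<close>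

definition big :: real where "big = sum wt R + sum wt R"

definition capacity :: "nat set \<Rightarrow> nat \<Rightarrow> nat \<Rightarrow> real" where
  "capacity J a b =
     (if kind n G A R a b = 1 then big else if kind n G A R a b = 2 \<and> a \<notin> J then wt a else 0)"

definition inflow :: "nat \<Rightarrow> real" where
  "inflow a = (if n \<le> a \<and> a < n + n \<and> a - n \<in> X then big else 0)"

lemma finR: "finite R" using subsets finite_subset by blast

lemma sum_wt_nonneg: "Z \<subseteq> R \<Longrightarrow> 0 \<le> sum wt Z"
  using wt_pos by (intro sum_nonneg) (auto intro: less_imp_le)

lemma kind_2: "kind n G A R a b = 2 \<Longrightarrow> a \<in> R \<and> a \<in> A \<and> b = n + a \<and> a < n"
  by (auto simp: kind.simps split: if_splits split_of_bool_asm)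

lemma supply_net: "supply_net (n + n + n) (capacity J) inflow Y"
proof
  have "0 \<le> big" using sum_wt_nonneg[of R] by (simp add: big_def)
  then show "0 \<le> capacity J a b" for a b
    using kind_2[of a b] wt_pos[of a] by (auto simp: capacity_def intro: less_imp_le)
  show "0 \<le> inflow a" for a using \<open>0 \<le> big\<close> by (simp add: inflow_def)
qed (use subsets Y_nonempty in auto)

text \<open>A separating \<open>Z'\<close> yields the cut \<open>T\<close> of all nodes still
  reachable, of value at most \<open>sum wt (Z' - J)\<close>, while \<open>S\<close> pays at least
  \<open>sum wt (Z - J)\<close>. Taking \<open>R \<inter> A\<close> for \<open>Z'\<close> puts the
  value of \<open>S\<close> below \<open>big\<close>, so only arcs of kind \<open>2\<close> leave
  \<open>S\<close>. Those belonging to \<open>J\<close> are free but still recorded in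
  \<open>Z\<close>, which therefore separates.\<close>

lemma minimum_cut_separator:
  assumes S: "S \<subseteq> {..<n + n + n}" "S \<inter> Y = {}"
    and min: "\<And>T. T \<subseteq> {..<n + n + n} \<Longrightarrow> T \<inter> Y = {} \<Longrightarrow>
      supply_net.cut_value (n + n + n) (capacity J) inflow S
      \<le> supply_net.cut_value (n + n + n) (capacity J) inflow T"
    and feasible: "separates (R \<inter> A)"
    and J: "J \<subseteq> R"
    and Z: "Z = {u \<in> R \<inter> A. u \<in> S \<and> n + u \<notin> S}"
  shows "separates Z"
    and "Z' \<subseteq> R \<inter> A \<Longrightarrow> separates Z' \<Longrightarrow> sum wt (Z - J) \<le> sum wt (Z' - J)"
proof -
  let ?m = "n + n + n"
  interpret supply_net ?m "capacity J" inflow Y by (rule supply_net)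
  have upper: "cut_value S \<le> sum wt (Z' - J)" if Z': "Z' \<subseteq> R \<inter> A" "separates Z'" for Z'
  proof -
    define T where "T = {a. a < ?m \<and> (\<exists>x\<in>X. (n + x, a) \<in> (net Z')\<^sup>*)}"
    have closed: "b \<in> T" if "a \<in> T" "(a, b) \<in> net Z'" for a b
    proof -
      have "b < ?m" using that by (simp add: net_def)
      then show ?thesis using that by (auto simp: T_def intro: rtrancl_into_rtrancl)
    qed
    have T: "T \<subseteq> {..<?m}" "T \<inter> Y = {}" using Z' by (auto simp: T_def separates_def)
    \<comment> \<open>\<open>T\<close> is closed under \<open>net Z'\<close>, so an arc leaving it
      is one that \<open>Z'\<close> cuts.\<close>
    have "capacity J a b \<le> (if a \<in> Z' - J \<and> b = n + a then wt a else 0)"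
      if ab: "a \<in> T" "b < ?m" "b \<notin> T" for a b
    proof -
      have "kind n G A R a b \<noteq> 1" using closed[OF ab(1)] ab T by (auto simp: net_def)
      moreover have "a \<in> Z'" if "kind n G A R a b = 2"
        using that closed[OF ab(1)] ab T by (auto simp: net_def)
      ultimately show ?thesis
        using kind_2[of a b] Z' wt_pos[of a] by (auto simp: capacity_def intro: less_imp_le)
    qed
    moreover have "inflow b = 0" if "b < ?m" "b \<notin> T" for b
      using that by (auto simp: inflow_def T_def)
    ultimately have "cut_value T \<le>
        (\<Sum>b\<in>{..<?m} - T. \<Sum>a\<in>T. if a \<in> Z' - J \<and> b = n + a then wt a else 0)"
      unfolding cut_value_def by (intro sum_mono) (auto intro: sum_mono)
    also have "\<dots> = (\<Sum>a\<in>T. \<Sum>b\<in>{..<?m} - T. if a \<in> Z' - J \<and> b = n + a then wt a else 0)"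
      by (rule sum.swap)
    also have "\<dots> \<le> (\<Sum>a\<in>T. if a \<in> Z' - J then wt a else 0)"
    proof (rule sum_mono)
      fix a
      have "(\<Sum>b\<in>{..<?m} - T. if a \<in> Z' - J \<and> b = n + a then wt a else 0)
          = (\<Sum>b\<in>{..<?m} - T. if b = n + a then (if a \<in> Z' - J then wt a else 0) else 0)"
        by (intro sum.cong) auto
      also have "\<dots> \<le> (if a \<in> Z' - J then wt a else 0)"
        using Z' wt_pos[of a] by (auto simp: sum.delta intro: less_imp_le)
      finally show "(\<Sum>b\<in>{..<?m} - T. if a \<in> Z' - J \<and> b = n + a then wt a else 0)
          \<le> (if a \<in> Z' - J then wt a else 0)" .
    qed
    also have "\<dots> = sum wt (T \<inter> (Z' - J))"
      using T by (simp add: sum.inter_restrict finite_subset[OF T(1)])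
    also have "\<dots> \<le> sum wt (Z' - J)"
      using Z' wt_pos finR finite_subset[of "Z' - J" R]
      by (intro sum_mono2) (auto intro: less_imp_le)
    finally show ?thesis using min[OF T] by linarith
  qed
  have lower: "sum wt (Z - J) \<le> cut_value S"
  proof -
    have "sum wt (Z - J) = (\<Sum>u\<in>Z - J. capacity J u (n + u))"
      using A_lt by (intro sum.cong refl) (auto simp: Z capacity_def kind.simps)
    also have "\<dots> = (\<Sum>b\<in>(+) n ` (Z - J). capacity J (b - n) b)"
      by (subst sum.reindex) auto
    also have "\<dots> \<le> (\<Sum>b\<in>(+) n ` (Z - J). inflow b + (\<Sum>a\<in>S. capacity J a b))"
    proof (rule sum_mono)
      fix b assume "b \<in> (+) n ` (Z - J)"
      then have b: "b - n \<in> S" "b < ?m" using Z A_lt by auto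
      have "capacity J (b - n) b \<le> (\<Sum>a\<in>S. capacity J a b)"
        by (rule member_le_sum[of "b - n" S "\<lambda>a. capacity J a b"])
           (use b S cap_nonneg finite_subset[OF S(1)] in auto)
      then show "capacity J (b - n) b \<le> inflow b + (\<Sum>a\<in>S. capacity J a b)"
        using src_nonneg[OF b(2)] by linarith
    qed
    also have "\<dots> \<le> cut_value S"
      unfolding cut_value_def
      by (rule sum_mono2)
         (use Z A_lt S cap_nonneg src_nonneg in \<open>auto intro!: add_nonneg_nonneg sum_nonneg\<close>)
    finally show ?thesis .
  qed
  show "Z' \<subseteq> R \<inter> A \<Longrightarrow> separates Z' \<Longrightarrow> sum wt (Z - J) \<le> sum wt (Z' - J)"
    using lower upper[of Z'] by linarith
  show "separates Z"
  \<comment> \<open>In this case \<open>big\<close> is \<open>0\<close> and gives no strict bound,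
    but \<open>Z\<close> and \<open>R \<inter> A\<close> are both empty, so \<open>feasible\<close>
    is the claim.\<close>
  proof (cases "R = {}")
    case True
    then show ?thesis using feasible Z by simp
  next
    case False
    have "sum wt (R \<inter> A - J) \<le> sum wt R"
      using wt_pos finR by (intro sum_mono2) (auto intro: less_imp_le)
    moreover have "0 < sum wt R" using wt_pos finR False by (intro sum_pos) auto
    ultimately have lt: "cut_value S < big" using upper[OF _ feasible] by (simp add: big_def)
    have closed: "b \<in> S" if "a \<in> S" "(a, b) \<in> net Z" for a b
    proof (rule ccontr)
      assume b: "b \<notin> S"
      have ab: "b < ?m" "kind n G A R a b = 1 \<or> kind n G A R a b = 2 \<and> a \<notin> Z"
        using that by (auto simp: net_def)
      have "capacity J a b < big" using cut_value_ge(2)[OF S(1) ab(1) b that(1)] lt by linarith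
      then have "kind n G A R a b = 2" "a \<notin> Z" using ab by (auto simp: capacity_def)
      then show False using kind_2[of a b] Z that(1) b by auto
    qed
    show ?thesis
      unfolding separates_def
    proof (intro ballI notI)
      fix x y assume xy: "x \<in> X" "y \<in> Y" and reach: "(n + x, y) \<in> (net Z)\<^sup>*"
      have "x < n" using xy subsets by auto
      then have "n + x \<in> S" using cut_value_ge(1)[of S "n + x"] S lt xy
        by (fastforce simp: inflow_def)
      with reach have "y \<in> S" by (induction rule: rtrancl_induct) (use closed in auto)
      then show False using xy S by blast
    qed
  qed
qed

end

section \<open>Total correctness with running time\<close>

datatype loc = NV name | NA name | NM name | CV name | CA name | CM name

primrec writes :: "com \<Rightarrow> loc set" where
  "writes Skip = {}"
| "writes (SetNVar x e) = {NV x}"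
| "writes (SetNArr x i e) = {NA x}"
| "writes (SetNMat x i j e) = {NM x}"
| "writes (SetCVar x e) = {CV x}"
| "writes (SetCArr x i e) = {CA x}"
| "writes (SetCMat x i j e) = {CM x}"
| "writes (Seq c d) = writes c \<union> writes d"
| "writes (Cond b c d) = writes c \<union> writes d"
| "writes (While b c) = writes c"

text \<open>The frame condition. \<open>runs_Seq\<close> and \<open>runs_weaken\<close> supply it to
  the continuation, so a postcondition has to mention only what a program changes.\<close>

definition agree :: "loc set \<Rightarrow> state \<Rightarrow> state \<Rightarrow> bool" where
  "agree W s s' \<longleftrightarrow>
     (\<forall>x. NV x \<notin> W \<longrightarrow> nvar s' x = nvar s x) \<and> (\<forall>x. NA x \<notin> W \<longrightarrow> narr s' x = narr s x) \<and>
     (\<forall>x. NM x \<notin> W \<longrightarrow> nmat s' x = nmat s x) \<and> (\<forall>x. CV x \<notin> W \<longrightarrow> cvar s' x = cvar s x) \<and>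
     (\<forall>x. CA x \<notin> W \<longrightarrow> carr s' x = carr s x) \<and> (\<forall>x. CM x \<notin> W \<longrightarrow> cmat s' x = cmat s x)"

lemma agree_refl: "agree W s s"
  by (simp add: agree_def)

lemma agree_trans: "agree W s s' \<Longrightarrow> agree W' s' s'' \<Longrightarrow> agree (W \<union> W') s s''"
  by (simp add: agree_def)

lemma agree_mono: "agree W s s' \<Longrightarrow> W \<subseteq> W' \<Longrightarrow> agree W' s s'"
  unfolding agree_def by blast

lemma agreeD:
  assumes "agree W s s'"
  shows "NV x \<notin> W \<Longrightarrow> nvar s' x = nvar s x" "NA x \<notin> W \<Longrightarrow> narr s' x = narr s x"
    "NM x \<notin> W \<Longrightarrow> nmat s' x = nmat s x" "CV x \<notin> W \<Longrightarrow> cvar s' x = cvar s x"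
    "CA x \<notin> W \<Longrightarrow> carr s' x = carr s x" "CM x \<notin> W \<Longrightarrow> cmat s' x = cmat s x"
  using assms by (simp_all add: agree_def)

lemma exec_agree: "exec c s t s' \<Longrightarrow> agree (writes c) s s'"
proof (induction rule: exec.induct)
  case (Seq c s t s' d t' s'')
  then show ?case using agree_trans by simp
next
  case (WhileTrue b s c t s' t' s'')
  then show ?case using agree_trans[of "writes c" s s' "writes c" s''] by simp
qed (auto simp: agree_def)

definition runs :: "com \<Rightarrow> state \<Rightarrow> nat \<Rightarrow> (state \<Rightarrow> bool) \<Rightarrow> bool" where
  "runs c s k Q \<longleftrightarrow> (\<exists>t s'. exec c s t s' \<and> t \<le> k \<and> Q s')"

lemma runs_weaken:
  "runs c s k Q \<Longrightarrow> k \<le> k' \<Longrightarrow> (\<And>s'. agree (writes c) s s' \<Longrightarrow> Q s' \<Longrightarrow> Q' s') \<Longrightarrow> runs c s k' Q'"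
  unfolding runs_def using exec_agree order_trans by blast

lemma runs_Seq:
  assumes "runs c s k P" "\<And>s'. agree (writes c) s s' \<Longrightarrow> P s' \<Longrightarrow> runs d s' l Q"
  shows "runs (Seq c d) s (k + l) Q"
proof -
  obtain t s' where 1: "exec c s t s'" "t \<le> k" "P s'" using assms(1) by (auto simp: runs_def)
  then obtain t' s'' where "exec d s' t' s''" "t' \<le> l" "Q s''"
    using assms(2)[OF exec_agree[OF 1(1)] 1(3)] unfolding runs_def by blast
  then show ?thesis using 1 exec.Seq unfolding runs_def by (meson add_mono)
qed

lemma runs_Cond:
  assumes "bval b s \<Longrightarrow> runs c s k Q" "\<not> bval b s \<Longrightarrow> runs d s k Q"
  shows "runs (Cond b c d) s (1 + btime b + k) Q"
  using assms exec.CondTrue exec.CondFalse unfolding runs_def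
  by (cases "bval b s") (meson add_le_cancel_left)+

text \<open>There are at most \<open>meas s\<close> iterations; the summand \<open>1\<close>
  accounts for the final test, charged like a full iteration.\<close>

lemma runs_While:
  assumes "Inv s"
    and "\<And>s'. agree (writes c) s s' \<Longrightarrow> Inv s' \<Longrightarrow> bval b s' \<Longrightarrow>
      runs c s' k (\<lambda>s''. Inv s'' \<and> (meas s'' :: nat) < meas s')"
  shows "runs (While b c) s ((meas s + 1) * (k + btime b + 1)) (\<lambda>s'. Inv s' \<and> \<not> bval b s')"
proof -
  have "runs (While b c) s1 ((meas s1 + 1) * (k + btime b + 1)) (\<lambda>s'. Inv s' \<and> \<not> bval b s')"
    if "agree (writes c) s s1" "Inv s1" for s1
    using that
  proof (induction "meas s1" arbitrary: s1 rule: less_induct)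
    case less
    show ?case
    proof (cases "bval b s1")
      case False
      then have "exec (While b c) s1 (1 + btime b) s1" by (rule exec.WhileFalse)
      moreover have "1 + btime b \<le> (meas s1 + 1) * (k + btime b + 1)" by simp
      ultimately show ?thesis using False less.prems unfolding runs_def by blast
    next
      case True
      then obtain t s2 where s2: "exec c s1 t s2" "t \<le> k" "Inv s2" "meas s2 < meas s1"
        using assms(2) less.prems unfolding runs_def by blast
      have "agree (writes c) s s2"
        using agree_trans[OF less.prems(1) exec_agree[OF s2(1)]] by simp
      then obtain t' s3 where s3: "exec (While b c) s2 t' s3"
        "t' \<le> (meas s2 + 1) * (k + btime b + 1)" "Inv s3" "\<not> bval b s3"
        using less.hyps[OF s2(4)] s2(3) unfolding runs_def by blast
      have "exec (While b c) s1 (1 + btime b + t + t') s3"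
        using True s2(1) s3(1) by (rule exec.WhileTrue)
      moreover have "1 + btime b + t + t' \<le> (meas s1 + 1) * (k + btime b + 1)"
      proof -
        have "1 + btime b + t + t' \<le> (meas s2 + 1 + 1) * (k + btime b + 1)"
          using s2(2) s3(2) by simp
        also have "\<dots> \<le> (meas s1 + 1) * (k + btime b + 1)"
          using s2(4) by (intro mult_le_mono1) simp
        finally show ?thesis .
      qed
      ultimately show ?thesis using s3 unfolding runs_def by blast
    qed
  qed
  then show ?thesis using agree_refl assms(1) by blast
qed

primrec straight :: "com \<Rightarrow> bool" where
  "straight Skip = True"
| "straight (SetNVar x e) = True"
| "straight (SetNArr x i e) = True"
| "straight (SetNMat x i j e) = True"
| "straight (SetCVar x e) = True"
| "straight (SetCArr x i e) = True"
| "straight (SetCMat x i j e) = True"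
| "straight (Seq c d) = (straight c \<and> straight d)"
| "straight (Cond b c d) = (straight c \<and> straight d)"
| "straight (While b c) = False"

text \<open>On loops, which are not \<open>straight\<close>, the values of \<open>run\<close> and \<open>cost\<close> are arbitrary.\<close>

primrec run :: "com \<Rightarrow> state \<Rightarrow> state" where
  "run Skip s = s"
| "run (SetNVar x e) s = s\<lparr>nvar := (nvar s)(x := nval e s)\<rparr>"
| "run (SetNArr x i e) s = s\<lparr>narr := (narr s)(x := (narr s x)(nval i s := nval e s))\<rparr>"
| "run (SetNMat x i j e) s = s\<lparr>nmat := (nmat s)(x := (nmat s x)(nval i s :=
        (nmat s x (nval i s))(nval j s := nval e s)))\<rparr>"
| "run (SetCVar x e) s = s\<lparr>cvar := (cvar s)(x := cval e s)\<rparr>"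
| "run (SetCArr x i e) s = s\<lparr>carr := (carr s)(x := (carr s x)(nval i s := cval e s))\<rparr>"
| "run (SetCMat x i j e) s = s\<lparr>cmat := (cmat s)(x := (cmat s x)(nval i s :=
        (cmat s x (nval i s))(nval j s := cval e s)))\<rparr>"
| "run (Seq c d) s = run d (run c s)"
| "run (Cond b c d) s = (if bval b s then run c s else run d s)"
| "run (While b c) s = s"

primrec cost :: "com \<Rightarrow> nat" where
  "cost Skip = 1"
| "cost (SetNVar x e) = 1 + ntime e"
| "cost (SetNArr x i e) = 1 + ntime i + ntime e"
| "cost (SetNMat x i j e) = 1 + ntime i + ntime j + ntime e"
| "cost (SetCVar x e) = 1 + ctime e"
| "cost (SetCArr x i e) = 1 + ntime i + ctime e"
| "cost (SetCMat x i j e) = 1 + ntime i + ntime j + ctime e"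
| "cost (Seq c d) = cost c + cost d"
| "cost (Cond b c d) = 1 + btime b + max (cost c) (cost d)"
| "cost (While b c) = 0"

lemma straight_exec: "straight c \<Longrightarrow> \<exists>t. exec c s t (run c s) \<and> t \<le> cost c"
proof (induction c arbitrary: s)
  case (Seq c d)
  then obtain t t' where "exec c s t (run c s)" "t \<le> cost c"
    "exec d (run c s) t' (run d (run c s))" "t' \<le> cost d" by fastforce
  then show ?case by (intro exI[of _ "t + t'"]) (simp add: exec.Seq)
next
  case (Cond b c d)
  show ?case
  proof (cases "bval b s")
    case True
    obtain t where "exec c s t (run c s)" "t \<le> cost c" using Cond by fastforce
    then show ?thesis using True by (intro exI[of _ "1 + btime b + t"]) (simp add: exec.CondTrue[simplified])
  next
    case False
    obtain t where "exec d s t (run d s)" "t \<le> cost d" using Cond by fastforce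
    then show ?thesis using False by (intro exI[of _ "1 + btime b + t"]) (simp add: exec.CondFalse[simplified])
  qed
qed (simp; blast intro: exec.intros[simplified])+

lemma runs_straight:
  "straight c \<Longrightarrow> cost c \<le> k \<Longrightarrow> Q (run c s) \<Longrightarrow> runs c s k Q"
  unfolding runs_def using straight_exec order_trans by blast

definition For :: "name \<Rightarrow> name \<Rightarrow> com \<Rightarrow> com" where
  "For x bnd c = Seq (SetNVar x (NConst 0))
     (While (NLess (NVar x) (NVar bnd)) (Seq c (SetNVar x (NAdd (NVar x) (NConst 1)))))"

lemma writes_For [simp]: "writes (For x bnd c) = insert (NV x) (writes c)"
  by (auto simp: For_def)

text \<open>Test and loop step take \<open>4\<close> and the increment \<open>4\<close>; the
  \<open>2\<close> for the initialisation are charged to every round, which gives the overhead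
  \<open>10\<close>. The invariant is required with the counter already updated, so it refers to the
  state in which the next round starts.\<close>

lemma runs_For:
  assumes N: "nvar s bnd = N" and frame: "NV x \<notin> writes c" "NV bnd \<notin> insert (NV x) (writes c)"
    and init: "Inv 0 (s\<lparr>nvar := (nvar s)(x := 0)\<rparr>)"
    and step: "\<And>i s'. agree (insert (NV x) (writes c)) s s' \<Longrightarrow> i < N \<Longrightarrow> nvar s' x = i \<Longrightarrow> Inv i s' \<Longrightarrow>
      runs c s' k (\<lambda>s''. Inv (Suc i) (s''\<lparr>nvar := (nvar s'')(x := Suc i)\<rparr>))"
  shows "runs (For x bnd c) s ((N + 1) * (k + 10)) (Inv N)"
proof -
  let ?W = "insert (NV x) (writes c)"
  let ?s = "s\<lparr>nvar := (nvar s)(x := 0)\<rparr>"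
  let ?b = "NLess (NVar x) (NVar bnd)" and ?d = "Seq c (SetNVar x (NAdd (NVar x) (NConst 1)))"
  let ?I = "\<lambda>s'. agree ?W s s' \<and> nvar s' x \<le> N \<and> Inv (nvar s' x) s'"
  have bnd: "nvar s' bnd = N" if "agree ?W s s'" for s'
    using agreeD(1)[OF that, of bnd] N frame by simp
  have "runs (While ?b ?d) ?s ((N - nvar ?s x + 1) * ((k + 4) + btime ?b + 1)) (\<lambda>s'. ?I s' \<and> \<not> bval ?b s')"
  proof (rule runs_While[where meas = "\<lambda>s. N - nvar s x"])
    show "?I ?s" using init by (simp add: agree_def)
    fix s' assume "?I s'" "bval ?b s'"
    then have s': "agree ?W s s'" "nvar s' x < N" "Inv (nvar s' x) s'" using bnd by auto
    show "runs ?d s' (k + 4) (\<lambda>s''. ?I s'' \<and> N - nvar s'' x < N - nvar s' x)"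
    proof (rule runs_Seq[OF step[OF s'(1,2) refl s'(3)]], rule runs_straight)
      fix s'' assume s'': "agree (writes c) s' s''" "Inv (Suc (nvar s' x)) (s''\<lparr>nvar := (nvar s'')(x := Suc (nvar s' x))\<rparr>)"
      have x: "nvar s'' x = nvar s' x" using agreeD(1)[OF s''(1)] frame by simp
      have "agree ?W s s''" using agree_trans[OF s'(1) s''(1)] by simp
      then have "agree ?W s (s''\<lparr>nvar := (nvar s'')(x := Suc (nvar s' x))\<rparr>)" by (simp add: agree_def)
      then show "?I (run (SetNVar x (NAdd (NVar x) (NConst 1))) s'') \<and>
          N - nvar (run (SetNVar x (NAdd (NVar x) (NConst 1))) s'') x < N - nvar s' x"
        using s'' x s'(2) by simp
    qed simp_all
  qed
  then have W: "runs (While ?b ?d) ?s ((N + 1) * (k + 8)) (Inv N)"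
  proof (rule runs_weaken)
    fix s' assume s': "?I s' \<and> \<not> bval ?b s'"
    then have "nvar s' x = N" using bnd[of s'] by auto
    then show "Inv N s'" using s' by auto
  qed simp
  have "runs (For x bnd c) s (2 + (N + 1) * (k + 8)) (Inv N)"
    unfolding For_def
    by (rule runs_Seq[where P = "\<lambda>s'. s' = ?s"]) (use W in \<open>auto intro!: runs_straight\<close>)
  then show ?thesis by (rule runs_weaken) simp_all
qed

text \<open>The pattern for filling a matrix: \<open>Row i\<close> is meant to describe the first
  \<open>i\<close> rows, and \<open>Ent i j\<close> in addition the first \<open>j\<close> entries
  of row \<open>i\<close>. Both bodies are loop-free, so the obligations are about evaluating
  \<open>run\<close>.\<close>

lemma runs_For_For:
  assumes N: "nvar s bnd = N"
    and straight: "straight c" "straight d"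
    and frame: "distinct [x, y, bnd]" "{NV x, NV y, NV bnd} \<inter> (writes c \<union> writes d) = {}"
    and init: "Row 0 (s\<lparr>nvar := (nvar s)(x := 0)\<rparr>)"
    and row: "\<And>i s'. agree (writes (For x bnd (Seq c (For y bnd d)))) s s' \<Longrightarrow> i < N \<Longrightarrow> nvar s' x = i \<Longrightarrow>
      Row i s' \<Longrightarrow> Ent i 0 ((run c s')\<lparr>nvar := (nvar (run c s'))(y := 0)\<rparr>)"
    and entry: "\<And>i j s'. agree (writes (For x bnd (Seq c (For y bnd d)))) s s' \<Longrightarrow> i < N \<Longrightarrow> j < N \<Longrightarrow>
      nvar s' x = i \<Longrightarrow> nvar s' y = j \<Longrightarrow> Ent i j s' \<Longrightarrow>
      Ent i (Suc j) ((run d s')\<lparr>nvar := (nvar (run d s'))(y := Suc j)\<rparr>)"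
    and last: "\<And>i s'. i < N \<Longrightarrow> Ent i N s' \<Longrightarrow> Row (Suc i) (s'\<lparr>nvar := (nvar s')(x := Suc i)\<rparr>)"
  shows "runs (For x bnd (Seq c (For y bnd d))) s
    ((N + 1) * (cost c + (N + 1) * (cost d + 10) + 10)) (Row N)"
proof (rule runs_For[OF N])
  let ?W = "insert (NV x) (writes (Seq c (For y bnd d)))"
  fix i s' assume s': "agree ?W s s'" "i < N" "nvar s' x = i" "Row i s'"
  have sub: "writes c \<subseteq> ?W" "insert (NV y) (writes d) \<subseteq> ?W" by auto
  have "runs (Seq c (For y bnd d)) s' (cost c + (N + 1) * (cost d + 10)) (Ent i N)"
  proof (rule runs_Seq[where P = "\<lambda>s''. s'' = run c s'"], rule runs_straight[OF straight(1)])
    fix s'' assume s'': "agree (writes c) s' s''" "s'' = run c s'"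
    have ag: "agree ?W s s''" using agree_mono[OF agree_trans[OF s'(1) s''(1)]] sub by auto
    have x: "nvar s'' x = i" "nvar s'' bnd = N"
      using agreeD(1)[OF s''(1)] agreeD(1)[OF ag, of bnd] frame N s'(3) by auto
    show "runs (For y bnd d) s'' ((N + 1) * (cost d + 10)) (Ent i N)"
    proof (rule runs_For[OF x(2)])
      show "Ent i 0 (s''\<lparr>nvar := (nvar s'')(y := 0)\<rparr>)" using row s' s''(2) by simp
      fix j s3 assume s3: "agree (insert (NV y) (writes d)) s'' s3" "j < N" "nvar s3 y = j" "Ent i j s3"
      have "agree ?W s s3" using agree_mono[OF agree_trans[OF ag s3(1)]] sub by auto
      moreover have "nvar s3 x = i" using agreeD(1)[OF s3(1), of x] x frame by auto
      ultimately show "runs d s3 (cost d) (\<lambda>s''. Ent i (Suc j) (s''\<lparr>nvar := (nvar s'')(y := Suc j)\<rparr>))"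
        using entry s3 s'(2) by (intro runs_straight[OF straight(2)]) auto
    qed (use frame in auto)
  qed simp_all
  then show "runs (Seq c (For y bnd d)) s' (cost c + (N + 1) * (cost d + 10))
      (\<lambda>s''. Row (Suc i) (s''\<lparr>nvar := (nvar s'')(x := Suc i)\<rparr>))"
    by (rule runs_weaken) (use last s'(2) in auto)
qed (use frame init in auto)

section \<open>Closure under a relation\<close>

abbreviation va :: nexp where "va \<equiv> NVar ''a''"
abbreviation vb :: nexp where "vb \<equiv> NVar ''b''"
abbreviation pos :: "nexp \<Rightarrow> bexp" where "pos e \<equiv> NLess (NConst 0) e"

text \<open>No work list is kept: a round over all pairs that starts from a set which is not closed
  marks a new element, so as many rounds as elements suffice, and this is already cubic. Only
  entries equal to \<open>1\<close> are links, so arcs of kind \<open>2\<close> of the network count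
  as cut.\<close>

definition closure :: com where
  "closure = For ''k'' ''m'' (For ''a'' ''m'' (Seq Skip (For ''b'' ''m''
     (Cond (BAnd (pos (NArr ''Q'' va)) (NEq (NMat ''E'' va vb) (NConst 1)))
       (SetNArr ''Q'' vb (NConst 1)) Skip))))"

definition marked :: "nat \<Rightarrow> state \<Rightarrow> nat set" where
  "marked N s = {a. a < N \<and> 0 < narr s ''Q'' a}"

definition links :: "nat \<Rightarrow> state \<Rightarrow> (nat \<times> nat) set" where
  "links N s = {(a, b). a < N \<and> b < N \<and> nmat s ''E'' a b = 1}"

lemma writes_closure: "writes closure = {NV ''k'', NV ''a'', NV ''b'', NA ''Q''}"
  by (auto simp: closure_def)

lemma marked_simps [simp]: "marked N (s\<lparr>nvar := f\<rparr>) = marked N s"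
  by (simp add: marked_def)

lemma runs_closure:
  assumes N: "nvar s ''m'' = N"
  shows "runs closure s (60 * (N + 1) ^ 3) (\<lambda>s'. marked N s' = (links N s)\<^sup>* `` marked N s)"
proof -
  let ?r = "links N s"
  have r_lt: "?r \<subseteq> {..<N} \<times> {..<N}" by (auto simp: links_def)
  let ?c = "Cond (BAnd (pos (NArr ''Q'' va)) (NEq (NMat ''E'' va vb) (NConst 1)))
       (SetNArr ''Q'' vb (NConst 1)) Skip"
  let ?d = "For ''a'' ''m'' (Seq Skip (For ''b'' ''m'' ?c))"
  \<comment> \<open>Marks set in a round may be propagated in the same round, so the intermediate
    sets are only bounded: from above by every closed superset of the marks at the start of the
    round, from below by the images of those marks under the pairs \<open>P\<close> treated so
    far.\<close>
  define Rd where "Rd s1 P s' \<longleftrightarrow> marked N s1 \<subseteq> marked N s' \<and>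
      (\<forall>C. marked N s1 \<subseteq> C \<longrightarrow> ?r `` C \<subseteq> C \<longrightarrow> marked N s' \<subseteq> C) \<and>
      (\<forall>a b. (a, b) \<in> ?r \<longrightarrow> (a, b) \<in> P \<longrightarrow> a \<in> marked N s1 \<longrightarrow> b \<in> marked N s')" for s1 P s'
  have RdI: "Rd s1 P s'" if "marked N s1 \<subseteq> marked N s'"
    "\<And>C. marked N s1 \<subseteq> C \<Longrightarrow> ?r `` C \<subseteq> C \<Longrightarrow> marked N s' \<subseteq> C"
    "\<And>a b. (a, b) \<in> ?r \<Longrightarrow> (a, b) \<in> P \<Longrightarrow> a \<in> marked N s1 \<Longrightarrow> b \<in> marked N s'" for s1 P s'
    unfolding Rd_def using that by (intro conjI allI impI)
  have Rd1: "marked N s1 \<subseteq> marked N s'" if "Rd s1 P s'" for s1 P s'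
    using that[unfolded Rd_def] by (rule conjunct1)
  have Rd2: "marked N s' \<subseteq> C" if "Rd s1 P s'" "marked N s1 \<subseteq> C" "?r `` C \<subseteq> C" for s1 P s' C
    using that(1)[unfolded Rd_def, THEN conjunct2, THEN conjunct1, rule_format, OF that(2,3)] .
  have Rd3: "b \<in> marked N s'" if "Rd s1 P s'" "(a, b) \<in> ?r" "(a, b) \<in> P" "a \<in> marked N s1" for s1 P s' a b
    using that(1)[unfolded Rd_def, THEN conjunct2, THEN conjunct2, rule_format, OF that(2-4)] .
  have Rd_nvar [simp]: "Rd s1 P (s'\<lparr>nvar := f\<rparr>) = Rd s1 P s'" for s1 P s' f
    by (simp add: Rd_def)
  have round: "runs ?d s1 ((N + 1) * (1 + (N + 1) * 24 + 10)) (Rd s1 UNIV)"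
    if s1: "agree (writes closure) s s1" for s1
  proof -
    have "runs ?d s1 ((N + 1) * (cost Skip + (N + 1) * (cost ?c + 10) + 10)) (Rd s1 ({..<N} \<times> UNIV))"
    proof (rule runs_For_For[where Row = "\<lambda>i. Rd s1 ({..<i} \<times> UNIV)"
          and Ent = "\<lambda>i j. Rd s1 ({..<i} \<times> UNIV \<union> {i} \<times> {..<j})"])
      show "nvar s1 ''m'' = N" using agreeD(1)[OF s1] N by (simp add: writes_closure)
      show "Rd s1 ({..<0} \<times> UNIV) (s1\<lparr>nvar := (nvar s1)(''a'' := 0)\<rparr>)"
        unfolding Rd_nvar by (rule RdI) auto
    next
      fix i s' assume "Rd s1 ({..<i} \<times> UNIV) s'"
      then show "Rd s1 ({..<i} \<times> UNIV \<union> {i} \<times> {..<0})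
          (run Skip s'\<lparr>nvar := (nvar (run Skip s'))(''b'' := 0)\<rparr>)" by simp
    next
      fix i j s'
      assume s': "agree (writes ?d) s1 s'" "i < N" "j < N" "nvar s' ''a'' = i" "nvar s' ''b'' = j"
        and Rd: "Rd s1 ({..<i} \<times> UNIV \<union> {i} \<times> {..<j}) s'"
      have E: "nmat s' ''E'' = nmat s ''E''"
        using agreeD(3)[OF s'(1)] agreeD(3)[OF s1] by (simp add: writes_closure)
      have link: "(i, j) \<in> ?r \<longleftrightarrow> nmat s' ''E'' i j = 1" using s' E by (simp add: links_def)
      show "Rd s1 ({..<i} \<times> UNIV \<union> {i} \<times> {..<Suc j})
          ((run ?c s')\<lparr>nvar := (nvar (run ?c s'))(''b'' := Suc j)\<rparr>)"
      proof (cases "i \<in> marked N s' \<and> (i, j) \<in> ?r")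
        case True
        then have m: "marked N (run ?c s') = insert j (marked N s')"
          using s' link by (auto simp: marked_def)
        show ?thesis
          unfolding Rd_nvar
        proof (rule RdI)
          show "marked N s1 \<subseteq> marked N (run ?c s')" using Rd1[OF Rd] m by auto
        next
          fix C assume C: "marked N s1 \<subseteq> C" "?r `` C \<subseteq> C"
          then have "marked N s' \<subseteq> C" by (rule Rd2[OF Rd])
          then show "marked N (run ?c s') \<subseteq> C" using C(2) True m by auto
        next
          fix a b assume "(a, b) \<in> ?r" "(a, b) \<in> {..<i} \<times> UNIV \<union> {i} \<times> {..<Suc j}" "a \<in> marked N s1"
          then show "b \<in> marked N (run ?c s')" using Rd3[OF Rd, of a b] m by (auto simp: less_Suc_eq)
        qed
      next
        case False
        then have m: "marked N (run ?c s') = marked N s'" using s' link by (auto simp: marked_def)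
        show ?thesis
          unfolding Rd_nvar
        proof (rule RdI)
          fix a b assume ab: "(a, b) \<in> ?r" "(a, b) \<in> {..<i} \<times> UNIV \<union> {i} \<times> {..<Suc j}" "a \<in> marked N s1"
          then have "(a, b) \<noteq> (i, j)" using False Rd1[OF Rd] by auto
          then show "b \<in> marked N (run ?c s')" using Rd3[OF Rd, of a b] ab m by (auto simp: less_Suc_eq)
        qed (use m Rd1[OF Rd] Rd2[OF Rd] in simp_all)
      qed
    next
      fix i s' assume Rd: "Rd s1 ({..<i} \<times> UNIV \<union> {i} \<times> {..<N}) s'"
      show "Rd s1 ({..<Suc i} \<times> UNIV) (s'\<lparr>nvar := (nvar s')(''a'' := Suc i)\<rparr>)"
        unfolding Rd_nvar
      proof (rule RdI)
        fix a b assume "(a, b) \<in> ?r" "(a, b) \<in> {..<Suc i} \<times> UNIV" "a \<in> marked N s1"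
        then show "b \<in> marked N s'" using Rd3[OF Rd, of a b] r_lt by (auto simp: less_Suc_eq)
      qed (use Rd1[OF Rd] Rd2[OF Rd] in simp_all)
    qed simp_all
    then show ?thesis
    proof (rule runs_weaken)
      fix s' assume Rd: "Rd s1 ({..<N} \<times> UNIV) s'"
      show "Rd s1 UNIV s'"
      proof (rule RdI)
        fix a b assume "(a, b) \<in> ?r" "a \<in> marked N s1"
        then show "b \<in> marked N s'" using Rd3[OF Rd, of a b] r_lt by auto
      qed (use Rd1[OF Rd] Rd2[OF Rd] in simp_all)
    qed simp
  qed
  define Inv where "Inv i s' \<longleftrightarrow> marked N s \<subseteq> marked N s' \<and> marked N s' \<subseteq> ?r\<^sup>* `` marked N s \<and>
      (?r `` marked N s' \<subseteq> marked N s' \<or> i \<le> card (marked N s'))" for i s'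
  have fin: "finite (marked N s')" "marked N s' \<subseteq> {..<N}" for s'
    by (auto simp: marked_def)
  have closed: "?r `` (?r\<^sup>* `` B) \<subseteq> ?r\<^sup>* `` B" for B
    by (auto intro: rtrancl_into_rtrancl)
  have "runs closure s ((N + 1) * ((N + 1) * (1 + (N + 1) * 24 + 10) + 10)) (Inv N)"
    unfolding closure_def
  proof (rule runs_For[OF N, where Inv = Inv])
    show "Inv 0 (s\<lparr>nvar := (nvar s)(''k'' := 0)\<rparr>)" by (auto simp: Inv_def)
    fix i s' assume s': "agree (insert (NV ''k'') (writes ?d)) s s'" "Inv i s'"
    have ag: "agree (writes closure) s s'" by (rule agree_mono[OF s'(1)]) (auto simp: writes_closure)
    show "runs ?d s' ((N + 1) * (1 + (N + 1) * 24 + 10))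
        (\<lambda>s''. Inv (Suc i) (s''\<lparr>nvar := (nvar s'')(''k'' := Suc i)\<rparr>))"
    proof (rule runs_weaken[OF round[OF ag]])
      fix s'' assume Rd: "Rd s' UNIV s''"
      then have sub: "marked N s' \<subseteq> marked N s''" "?r `` marked N s' \<subseteq> marked N s''"
        using Rd1[OF Rd] Rd3[OF Rd] by auto
      have "marked N s'' \<subseteq> ?r\<^sup>* `` marked N s"
        by (rule Rd2[OF Rd _ closed]) (use s'(2) in \<open>simp add: Inv_def\<close>)
      moreover have "?r `` marked N s'' \<subseteq> marked N s'' \<or> Suc i \<le> card (marked N s'')"
      proof (cases "?r `` marked N s' \<subseteq> marked N s'")
        case True
        then have "marked N s'' = marked N s'" using sub(1) Rd2[OF Rd subset_refl] by simp
        then show ?thesis using True by simp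
      next
        case False
        then have "marked N s' \<subset> marked N s''" using sub by auto
        then have "card (marked N s') < card (marked N s'')" using fin psubset_card_mono by blast
        then show ?thesis using s'(2) False unfolding Inv_def by auto
      qed
      ultimately show "Inv (Suc i) (s''\<lparr>nvar := (nvar s'')(''k'' := Suc i)\<rparr>)"
        using s'(2) sub unfolding Inv_def by auto
    qed simp
  qed simp_all
  then show ?thesis
  proof (rule runs_weaken)
    show "(N + 1) * ((N + 1) * (1 + (N + 1) * 24 + 10) + 10) \<le> 60 * (N + 1) ^ 3"
      by (simp add: power3_eq_cube algebra_simps)
    fix s' assume Inv: "Inv N s'"
    have "?r `` marked N s' \<subseteq> marked N s'"
    proof (cases "N \<le> card (marked N s')")
      case True
      then have "marked N s' = {..<N}" using fin[of s'] by (intro card_seteq) auto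
      then show ?thesis using r_lt by auto
    qed (use Inv in \<open>auto simp: Inv_def\<close>)
    then have "?r\<^sup>* `` marked N s' = marked N s'" by (rule Image_closed_trancl)
    moreover have "?r\<^sup>* `` marked N s \<subseteq> ?r\<^sup>* `` marked N s'"
      using Inv by (intro Image_mono subset_refl) (simp add: Inv_def)
    ultimately have "?r\<^sup>* `` marked N s \<subseteq> marked N s'" by simp
    then show "marked N s' = ?r\<^sup>* `` marked N s" using Inv by (auto simp: Inv_def)
  qed
qed

section \<open>The program\<close>

abbreviation (input) dif :: "nexp \<Rightarrow> name \<Rightarrow> nexp" where "dif e x \<equiv> NSub e (NVar x)"

text \<open>The matrix \<open>E\<close> receives the reversed edges, since anteriors are found by
  searching backwards from \<open>X \<union> Y\<close>. The cell \<open>m\<close> is the dimension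
  for \<open>closure\<close>: \<open>n\<close> here, three times \<open>n\<close> for the
  network.\<close>

definition compute_anterior :: com where
  "compute_anterior =
     Seq (SetNVar ''m'' (NVar ''n''))
    (Seq (For ''a'' ''m'' (Seq
       (SetNArr ''Q'' va (NAdd (NArr ''X'' va) (NArr ''Y'' va)))
       (For ''b'' ''m'' (SetNMat ''E'' va vb (NAdd (NMat ''dir'' vb va) (NMat ''und'' vb va))))))
    (Seq closure
    (For ''a'' ''m'' (SetNArr ''A'' va (NArr ''Q'' va)))))"

abbreviation (input) link :: "nat \<Rightarrow> com" where
  "link k \<equiv> SetNMat ''E'' va vb (NConst k)"

abbreviation (input) link_if :: "nexp \<Rightarrow> nexp \<Rightarrow> nexp \<Rightarrow> com" where
  "link_if u v e \<equiv> Cond (BAnd (pos (NArr ''A'' u)) (BAnd (pos (NArr ''A'' v)) (pos e))) (link 1) (link 0)"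

abbreviation (input) arrow :: "nexp \<Rightarrow> nexp \<Rightarrow> nexp" where
  "arrow u v \<equiv> NAdd (NMat ''dir'' u v) (NMat ''bid'' u v)"

abbreviation (input) edge :: "nexp \<Rightarrow> nexp \<Rightarrow> nexp" where
  "edge u v \<equiv> NAdd (NAdd (NMat ''dir'' u v) (NMat ''dir'' v u)) (NAdd (NMat ''und'' u v) (NMat ''bid'' u v))"

definition set_kind :: com where
  "set_kind =
    Cond (NLess va (NVar ''n''))
      (Cond (BAnd (NEq vb (NAdd (NVar ''n'') va)) (pos (NArr ''A'' va)))
        (Cond (pos (NArr ''R'' va)) (link 2) (link 1)) (link 0))
    (Cond (NLess va (NVar ''nn''))
      (Cond (NLess vb (NVar ''n'')) (link_if (dif va ''n'') vb (edge (dif va ''n'') vb))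
      (Cond (NLess vb (NVar ''nn'')) (link 0)
        (link_if (dif va ''n'') (dif vb ''nn'') (arrow (dif va ''n'') (dif vb ''nn'')))))
      (Cond (NLess vb (NVar ''n'')) (link_if (dif va ''nn'') vb (arrow vb (dif va ''nn'')))
      (Cond (NLess vb (NVar ''nn'')) (link 0)
        (link_if (dif va ''nn'') (dif vb ''nn'') (NMat ''bid'' (dif va ''nn'') (dif vb ''nn''))))))"

abbreviation (input) out_X :: bexp where
  "out_X \<equiv> BAnd (BNot (NLess va (NVar ''n''))) (BAnd (NLess va (NVar ''nn'')) (pos (NArr ''X'' (dif va ''n''))))"

text \<open>The final search ignores the arcs of kind \<open>2\<close>, that is, it cuts all of
  \<open>R \<inter> A\<close>. If it still reaches \<open>Y\<close>, no subset of
  \<open>R \<inter> A\<close> separates, and \<open>bad\<close> is set.\<close>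

definition build_network :: com where
  "build_network =
     Seq (Seq (SetNVar ''nn'' (NAdd (NVar ''n'') (NVar ''n''))) (SetNVar ''m'' (NAdd (NVar ''nn'') (NVar ''n''))))
    (Seq (For ''a'' ''m'' (Seq
       (Cond out_X (SetNArr ''Q'' va (NConst 1)) (SetNArr ''Q'' va (NConst 0)))
       (For ''b'' ''m'' set_kind)))
    (Seq closure
    (For ''a'' ''n'' (Cond (BAnd (pos (NArr ''Y'' va)) (pos (NArr ''Q'' va))) (SetNVar ''bad'' (NConst 1)) Skip))))"

definition compute_big :: com where
  "compute_big =
     Seq (For ''a'' ''n'' (Cond (pos (NArr ''R'' va)) (SetCVar ''B'' (CAdd (CVar ''B'') (CArr ''w'' va))) Skip))
         (SetCVar ''B'' (CAdd (CVar ''B'') (CVar ''B'')))"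

definition init_flow :: com where
  "init_flow =
     Seq (For ''a'' ''m'' (Seq
       (Seq (SetNArr ''d'' va (NConst 0)) (Seq (SetNArr ''c'' va (NConst 0))
         (Cond out_X (SetCArr ''e'' va (CVar ''B'')) (SetCArr ''e'' va CZero))))
       (For ''b'' ''m''
         (Cond (NEq (NMat ''E'' va vb) (NConst 1)) (SetCMat ''r'' va vb (CVar ''B''))
         (Cond (BAnd (NEq (NMat ''E'' va vb) (NConst 2)) (NEq (NArr ''J'' va) (NConst 0)))
           (SetCMat ''r'' va vb (CArr ''w'' va)) (SetCMat ''r'' va vb CZero))))))
     (Seq (SetNVar ''v'' (NConst 0)) (SetNVar ''L'' (NConst 0)))"

abbreviation (input) vv :: nexp where "vv \<equiv> NVar ''v''"
abbreviation (input) vu :: nexp where "vu \<equiv> NVar ''u''"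

text \<open>The pushed amount is the excess of \<open>v\<close>, so this cell is cleared only after
  all others have read it. In \<open>push_saturating\<close> the residual capacity plays this part
  and is cleared after its last use.\<close>

definition push_all :: com where
  "push_all =
     Seq (SetCMat ''r'' vu vv (CAdd (CMat ''r'' vu vv) (CArr ''e'' vv)))
    (Seq (SetCMat ''r'' vv vu (CSub (CMat ''r'' vv vu) (CArr ''e'' vv)))
    (Seq (SetCArr ''e'' vu (CAdd (CArr ''e'' vu) (CArr ''e'' vv)))
    (Seq (SetCArr ''e'' vv CZero)
         (SetNVar ''v'' (NAdd vv (NConst 1))))))"

definition push_saturating :: com where
  "push_saturating =
     Seq (SetCArr ''e'' vu (CAdd (CArr ''e'' vu) (CMat ''r'' vv vu)))
    (Seq (SetCArr ''e'' vv (CSub (CArr ''e'' vv) (CMat ''r'' vv vu)))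
    (Seq (SetCMat ''r'' vu vv (CAdd (CMat ''r'' vu vv) (CMat ''r'' vv vu)))
    (Seq (SetCMat ''r'' vv vu CZero)
         (SetNArr ''c'' vv (NAdd (NArr ''c'' vv) (NConst 1))))))"

definition relabel :: com where
  "relabel =
     Seq (SetNArr ''c'' vv (NConst 0))
    (Seq (SetNArr ''d'' vv (NAdd (NArr ''d'' vv) (NConst 1)))
         (SetNVar ''L'' (NAdd (NVar ''L'') (NConst 1))))"

definition flow_step :: com where
  "flow_step =
    Cond (NLess vv (NVar ''m''))
     (Cond (BAnd (CLess CZero (CArr ''e'' vv)) (BAnd (NLess (NArr ''d'' vv) (NAdd (NVar ''m'') (NConst 1)))
           (NEq (NArr ''Y'' vv) (NConst 0))))
       (Cond (NLess (NArr ''c'' vv) (NVar ''m''))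
         (Seq (SetNVar ''u'' (NArr ''c'' vv))
           (Cond (BAnd (CLess CZero (CMat ''r'' vv vu)) (NEq (NArr ''d'' vv) (NAdd (NArr ''d'' vu) (NConst 1))))
             (Cond (CLess (CMat ''r'' vv vu) (CArr ''e'' vv)) push_saturating push_all)
             (SetNArr ''c'' vv (NAdd (NArr ''c'' vv) (NConst 1)))))
         relabel)
       (SetNVar ''v'' (NAdd vv (NConst 1))))
     (Seq (SetNVar ''v'' (NConst 0)) (SetNVar ''L'' (NSub (NVar ''L'') (NConst 1))))"

definition max_flow :: com where
  "max_flow = While (BNot (BAnd (NEq vv (NVar ''m'')) (NEq (NVar ''L'') (NConst 0)))) flow_step"

text \<open>Whenever \<open>k\<close> is found as a label, the scan restarts with the next value.
  There are at most \<open>m\<close> candidates, each with at most one scan, so quadratic time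
  suffices without counting labels.\<close>

definition find_gap :: com where
  "find_gap =
    Seq (Seq (SetNVar ''k'' (NConst 1)) (SetNVar ''a'' (NConst 0)))
        (While (NLess va (NVar ''m''))
          (Cond (NEq (NArr ''d'' va) (NVar ''k''))
            (Seq (SetNVar ''k'' (NAdd (NVar ''k'') (NConst 1))) (SetNVar ''a'' (NConst 0)))
            (SetNVar ''a'' (NAdd va (NConst 1)))))"

definition extract_cut :: com where
  "extract_cut =
    Seq (SetCVar ''cost'' CZero)
    (For ''a'' ''n''
      (Cond (BNot (BAnd (NEq (NArr ''J'' va) (NConst 0))
              (BNot (BAnd (BAnd (pos (NArr ''R'' va)) (pos (NArr ''A'' va)))
                (BAnd (NLess (NVar ''k'') (NArr ''d'' va)) (BNot (NLess (NVar ''k'') (NArr ''d'' (NAdd (NVar ''n'') va)))))))))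
        (Seq (SetNArr ''Z'' va (NConst 1)) (SetCVar ''cost'' (CAdd (CVar ''cost'') (CArr ''w'' va))))
        (SetNArr ''Z'' va (NConst 0))))"

definition min_separator :: com where
  "min_separator = Seq init_flow (Seq max_flow (Seq find_gap extract_cut))"

text \<open>The cells of \<open>J\<close> are initially zero, so the first run is the unconstrained
  one. Only its cost survives; the array \<open>Z\<close> is overwritten by the second run.\<close>

definition both_runs :: com where
  "both_runs = Seq min_separator
       (Seq (SetCVar ''cost1'' (CVar ''cost''))
       (Seq (For ''a'' ''n'' (SetNArr ''J'' va (NArr ''I'' va)))
       (Seq min_separator
         (Cond (CEq (CVar ''cost'') (CVar ''cost1'')) (SetNVar ''found'' (NConst 1)) Skip))))"

definition program :: com where
  "program = Seq compute_anterior (Seq build_network (Seq compute_big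
     (Cond (NEq (NVar ''bad'') (NConst 0)) both_runs Skip)))"

lemma run_agree: "straight c \<Longrightarrow> agree (writes c) s (run c s)"
  using straight_exec exec_agree by blast

section \<open>Specification of the memory; anteriors and network as computed\<close>

locale separation_instance = weighted_network +
  fixes I :: "nat set" and w :: "nat \<Rightarrow> ereal"
  assumes I: "I \<subseteq> R" and w: "u \<in> R \<Longrightarrow> w u = ereal (wt u)"
    and w_infinite: "u < n \<Longrightarrow> u \<notin> R \<Longrightarrow> w u = \<infinity>"
begin

text \<open>Costs are described on \<open>R\<close> only. The program reads no others, so its
  arithmetic never meets an infinite value.\<close>

definition input_ok :: "state \<Rightarrow> bool" where
  "input_ok s \<longleftrightarrow> nvar s ''n'' = n \<and>
     narr s ''X'' = (\<lambda>u. of_bool (u \<in> X)) \<and> narr s ''Y'' = (\<lambda>u. of_bool (u \<in> Y)) \<and>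
     narr s ''R'' = (\<lambda>u. of_bool (u \<in> R)) \<and> narr s ''I'' = (\<lambda>u. of_bool (u \<in> I)) \<and>
     nmat s ''dir'' = (\<lambda>u v. of_bool ((u, v) \<in> dir G)) \<and>
     nmat s ''und'' = (\<lambda>u v. of_bool ((u, v) \<in> und G)) \<and>
     nmat s ''bid'' = (\<lambda>u v. of_bool ((u, v) \<in> bid G)) \<and>
     (\<forall>u\<in>R. carr s ''w'' u = ereal (wt u))"

lemma input_ok_agree:
  assumes "agree W s s'" "input_ok s"
    and "{NV ''n'', NA ''X'', NA ''Y'', NA ''R'', NA ''I'', NM ''dir'', NM ''und'', NM ''bid'', CA ''w''} \<inter> W = {}"
  shows "input_ok s'"
proof -
  have eqs: "nvar s' ''n'' = nvar s ''n''" "narr s' ''X'' = narr s ''X''" "narr s' ''Y'' = narr s ''Y''"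
    "narr s' ''R'' = narr s ''R''" "narr s' ''I'' = narr s ''I''" "nmat s' ''dir'' = nmat s ''dir''"
    "nmat s' ''und'' = nmat s ''und''" "nmat s' ''bid'' = nmat s ''bid''" "carr s' ''w'' = carr s ''w''"
    by (rule agreeD[OF assms(1)]; use assms(3) in auto)+
  show ?thesis using assms(2) unfolding input_ok_def eqs .
qed

definition anterior_ok :: "state \<Rightarrow> bool" where
  "anterior_ok s \<longleftrightarrow> (\<forall>u<n. 0 < narr s ''A'' u \<longleftrightarrow> u \<in> A)"

lemma anterior_ok_agree:
  assumes "agree W s s'" "anterior_ok s" "NA ''A'' \<notin> W"
  shows "anterior_ok s'"
  using assms(2) agreeD(2)[OF assms(1,3)] by (simp add: anterior_ok_def)

lemma A_closure: "A = ((dir G \<union> und G)\<inverse>)\<^sup>* `` (X \<union> Y)"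
proof -
  have *: "u \<in> verts G" if "(u, z) \<in> (dir G \<union> und G)\<^sup>*" "z \<in> X \<union> Y" for u z
    using that(1)
  proof (cases rule: converse_rtranclE)
    case base
    then show ?thesis using that(2) subsets verts by auto
  next
    case (step y)
    then show ?thesis using mixed by (auto simp: mixed_graph_def)
  qed
  show ?thesis
  proof (rule set_eqI)
    fix u
    have "u \<in> A \<longleftrightarrow> (\<exists>z\<in>X \<union> Y. (u, z) \<in> (dir G \<union> und G)\<^sup>*)"
      using * unfolding Ant_def anterior_iff by blast
    also have "\<dots> \<longleftrightarrow> u \<in> ((dir G \<union> und G)\<inverse>)\<^sup>* `` (X \<union> Y)"
      unfolding rtrancl_converse Image_iff converse_iff ..
    finally show "u \<in> A \<longleftrightarrow> u \<in> ((dir G \<union> und G)\<inverse>)\<^sup>* `` (X \<union> Y)" .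
  qed
qed

lemma runs_compute_anterior:
  assumes s: "input_ok s"
  shows "runs compute_anterior s (200 * (n + 1) ^ 3) anterior_ok"
proof -
  let ?p = "SetNVar ''m'' (NVar ''n'')"
  let ?c = "SetNArr ''Q'' va (NAdd (NArr ''X'' va) (NArr ''Y'' va))"
  let ?d = "SetNMat ''E'' va vb (NAdd (NMat ''dir'' vb va) (NMat ''und'' vb va))"
  let ?f = "For ''a'' ''m'' (Seq ?c (For ''b'' ''m'' ?d))"
  let ?g = "For ''a'' ''m'' (SetNArr ''A'' va (NArr ''Q'' va))"
  let ?q = "\<lambda>a. of_bool (a \<in> X) + of_bool (a \<in> Y) :: nat"
  let ?e = "\<lambda>a b. of_bool ((b, a) \<in> dir G) + of_bool ((b, a) \<in> und G) :: nat"
  define Row where "Row i s' \<longleftrightarrow> (\<forall>a<i. narr s' ''Q'' a = ?q a \<and> (\<forall>b<n. nmat s' ''E'' a b = ?e a b))"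
    for i and s' :: state
  define Ent where "Ent i j s' \<longleftrightarrow> Row i s' \<and> narr s' ''Q'' i = ?q i \<and> (\<forall>b<j. nmat s' ''E'' i b = ?e i b)"
    for i j and s' :: state
  have last: "runs ?g s3 ((n + 1) * 20) anterior_ok"
    if s3: "nvar s3 ''m'' = n" "marked n s3 = (links n s2)\<^sup>* `` marked n s2" "Row n s2" for s2 s3
  proof -
    have "links n s2 = (dir G \<union> und G)\<inverse>"
    proof -
      \<comment> \<open>The entry is a sum of two indicators; the value \<open>2\<close> is
        impossible because directed and undirected edges are disjoint.\<close>
      have "nmat s2 ''E'' a b = 1 \<longleftrightarrow> (b, a) \<in> dir G \<union> und G" if "a < n" "b < n" for a b
        using s3(3) that ancestral_graph_simple(3)[OF ancestral] by (auto simp: Row_def)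
      moreover have "a < n \<and> b < n" if "(b, a) \<in> dir G \<union> und G" for a b
        using that mixed verts by (auto simp: mixed_graph_def)
      ultimately show ?thesis unfolding links_def by auto
    qed
    moreover have "marked n s2 = X \<union> Y"
      using s3(3) subsets by (auto simp: marked_def Row_def)
    ultimately have "marked n s3 = A" using s3(2) unfolding A_closure by simp
    then have A: "0 < narr s3 ''Q'' u \<longleftrightarrow> u \<in> A" if "u < n" for u
      using that unfolding marked_def by blast
    have "runs ?g s3 ((n + 1) * (10 + 10)) (\<lambda>s'. \<forall>u<n. 0 < narr s' ''A'' u \<longleftrightarrow> u \<in> A)"
    proof (rule runs_For[where Inv = "\<lambda>i s'. \<forall>u<i. 0 < narr s' ''A'' u \<longleftrightarrow> u \<in> A"])
      fix i s' assume s': "agree (insert (NV ''a'') (writes (SetNArr ''A'' va (NArr ''Q'' va)))) s3 s'"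
        "i < n" "nvar s' ''a'' = i" "\<forall>u<i. 0 < narr s' ''A'' u \<longleftrightarrow> u \<in> A"
      have "narr s' ''Q'' = narr s3 ''Q''" using agreeD(2)[OF s'(1)] by simp
      then show "runs (SetNArr ''A'' va (NArr ''Q'' va)) s' 10
          (\<lambda>s''. \<forall>u<Suc i. 0 < narr (s''\<lparr>nvar := (nvar s'')(''a'' := Suc i)\<rparr>) ''A'' u \<longleftrightarrow> u \<in> A)"
        using s' A by (intro runs_straight) (auto simp: less_Suc_eq)
    qed (use s3 in auto)
    then show ?thesis by (rule runs_weaken) (auto simp: anterior_ok_def)
  qed
  have fill: "runs ?f s1 ((n + 1) * (cost ?c + (n + 1) * (cost ?d + 10) + 10)) (Row n)"
    if s1: "input_ok s1" "nvar s1 ''m'' = n" for s1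
  proof (rule runs_For_For[where Row = Row and Ent = Ent])
    show "nvar s1 ''m'' = n" by (rule s1)
    show "Row 0 (s1\<lparr>nvar := (nvar s1)(''a'' := 0)\<rparr>)" by (simp add: Row_def)
  next
    fix i s' assume s': "agree (writes ?f) s1 s'" "i < n" "nvar s' ''a'' = i" "Row i s'"
    have "input_ok s'" by (rule input_ok_agree[OF s'(1) s1(1)]) simp
    then show "Ent i 0 (run ?c s'\<lparr>nvar := (nvar (run ?c s'))(''b'' := 0)\<rparr>)"
      using s' by (auto simp: Row_def Ent_def input_ok_def)
  next
    fix i j s' assume s': "agree (writes ?f) s1 s'" "i < n" "j < n" "nvar s' ''a'' = i" "nvar s' ''b'' = j" "Ent i j s'"
    have "input_ok s'" by (rule input_ok_agree[OF s'(1) s1(1)]) simp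
    then show "Ent i (Suc j) (run ?d s'\<lparr>nvar := (nvar (run ?d s'))(''b'' := Suc j)\<rparr>)"
      using s' by (auto simp: Row_def Ent_def input_ok_def less_Suc_eq)
  next
    fix i s' assume "Ent i n s'"
    then show "Row (Suc i) (s'\<lparr>nvar := (nvar s')(''a'' := Suc i)\<rparr>)"
      by (auto simp: Row_def Ent_def less_Suc_eq)
  qed simp_all
  have "runs compute_anterior s
    (2 + ((n + 1) * (cost ?c + (n + 1) * (cost ?d + 10) + 10) + (60 * (n + 1) ^ 3 + (n + 1) * 20))) anterior_ok"
    unfolding compute_anterior_def
  proof (rule runs_Seq[where P = "\<lambda>s'. nvar s' ''m'' = n"])
    show "runs ?p s 2 (\<lambda>s'. nvar s' ''m'' = n)" using s by (intro runs_straight) (auto simp: input_ok_def)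
    fix s1 assume s1: "agree (writes ?p) s s1" "nvar s1 ''m'' = n"
    have ok: "input_ok s1" by (rule input_ok_agree[OF s1(1) s]) simp
    show "runs (Seq ?f (Seq closure ?g)) s1
        ((n + 1) * (cost ?c + (n + 1) * (cost ?d + 10) + 10) + (60 * (n + 1) ^ 3 + (n + 1) * 20)) anterior_ok"
    proof (rule runs_Seq[OF fill[OF ok s1(2)]])
      fix s2 assume s2: "agree (writes ?f) s1 s2" "Row n s2"
      have m: "nvar s2 ''m'' = n" using agreeD(1)[OF s2(1), of "''m''"] s1 by simp
      show "runs (Seq closure ?g) s2 (60 * (n + 1) ^ 3 + (n + 1) * 20) anterior_ok"
      proof (rule runs_Seq[OF runs_closure[OF m]])
        fix s3 assume s3: "agree (writes closure) s2 s3" "marked n s3 = (links n s2)\<^sup>* `` marked n s2"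
        have "nvar s3 ''m'' = n" using agreeD(1)[OF s3(1), of "''m''"] m by (simp add: writes_closure)
        then show "runs ?g s3 ((n + 1) * 20) anterior_ok" using last s3(2) s2(2) by blast
      qed
    qed
  qed
  then show ?thesis by (rule runs_weaken) (simp_all add: power3_eq_cube algebra_simps)
qed

definition network_ok :: "state \<Rightarrow> bool" where
  "network_ok s \<longleftrightarrow> nvar s ''nn'' = n + n \<and> nvar s ''m'' = n + n + n \<and>
     (\<forall>a<n + n + n. \<forall>b<n + n + n. nmat s ''E'' a b = kind n G A R a b)"

lemma network_ok_agree:
  assumes "agree W s s'" "network_ok s" "{NV ''nn'', NV ''m'', NM ''E''} \<inter> W = {}"
  shows "network_ok s'"
proof -
  have eqs: "nvar s' ''nn'' = nvar s ''nn''" "nvar s' ''m'' = nvar s ''m''" "nmat s' ''E'' = nmat s ''E''"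
    by (rule agreeD[OF assms(1)]; use assms(3) in auto)+
  show ?thesis using assms(2) unfolding network_ok_def eqs .
qed

lemma run_set_kind:
  assumes "input_ok s" "anterior_ok s" "nvar s ''nn'' = n + n"
    and ab: "nvar s ''a'' = a" "nvar s ''b'' = b" "a < n + n + n" "b < n + n + n"
  shows "run set_kind s = s\<lparr>nmat := (nmat s)(''E'' := (nmat s ''E'')(a := (nmat s ''E'' a)(b := kind n G A R a b)))\<rparr>"
proof -
  have A: "0 < narr s ''A'' u \<longleftrightarrow> u \<in> A" if "u < n" for u
    using assms(2) that by (simp add: anterior_ok_def)
  have edge: "0 < nval (edge e f) s \<longleftrightarrow> adjacent G (nval e s) (nval f s)" for e f
    using assms(1) by (auto simp: input_ok_def adjacent_def)
  have arrow: "0 < nval (arrow e f) s \<longleftrightarrow> arrowhead G (nval e s) (nval f s)" for e f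
    using assms(1) by (auto simp: input_ok_def arrowhead_def)
  have link_if: "run (link_if e f g) s = s\<lparr>nmat := (nmat s)(''E'' := (nmat s ''E'')(a := (nmat s ''E'' a)
      (b := kind n G A R a b)))\<rparr>"
    if uv: "nval e s < n" "nval f s < n"
      and k: "kind n G A R a b = of_bool (nval e s \<in> A \<and> nval f s \<in> A \<and> 0 < nval g s)" for e f g
  proof (cases "nval e s \<in> A \<and> nval f s \<in> A \<and> 0 < nval g s")
    case True
    then have "bval (BAnd (pos (NArr ''A'' e)) (BAnd (pos (NArr ''A'' f)) (pos g))) s"
      using A[OF uv(1)] A[OF uv(2)] by simp
    then show ?thesis unfolding k run.simps using True ab(1,2) by (simp only: if_True) simp
  next
    case False
    then have "\<not> bval (BAnd (pos (NArr ''A'' e)) (BAnd (pos (NArr ''A'' f)) (pos g))) s"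
      using A[OF uv(1)] A[OF uv(2)] by simp
    then show ?thesis unfolding k run.simps using False ab(1,2) by (simp only: if_False) simp
  qed
  have n: "nvar s ''n'' = n" and R: "narr s ''R'' = (\<lambda>u. of_bool (u \<in> R))"
    and bid: "nmat s ''bid'' = (\<lambda>u v. of_bool ((u, v) \<in> bid G))"
    using assms(1) by (simp_all add: input_ok_def)
  consider "a < n" | "n \<le> a" "a < n + n" | "n + n \<le> a" by linarith
  then show ?thesis
  proof cases
    case 1
    then show ?thesis unfolding set_kind_def using n R A[OF 1] ab by (simp add: kind.simps)
  next
    case 2
    consider "b < n" | "n \<le> b" "b < n + n" | "n + n \<le> b" by linarith
    then show ?thesis
    proof cases
      case b: 1
      have "run set_kind s = run (link_if (dif va ''n'') vb (edge (dif va ''n'') vb)) s"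
        unfolding set_kind_def using 2 b n ab assms(3) by simp
      also have "\<dots> = s\<lparr>nmat := (nmat s)(''E'' := (nmat s ''E'')(a := (nmat s ''E'' a)(b := kind n G A R a b)))\<rparr>"
      proof (rule link_if)
        show "kind n G A R a b = of_bool (nval (dif va ''n'') s \<in> A \<and> nval vb s \<in> A \<and>
            0 < nval (edge (dif va ''n'') vb) s)"
          unfolding edge using 2 b n ab by (simp add: kind.simps)
      qed (use 2 b n ab in simp_all)
      finally show ?thesis .
    next
      case b: 2
      then show ?thesis unfolding set_kind_def using 2 n ab assms(3) by (simp add: kind.simps)
    next
      case b: 3
      have "run set_kind s = run (link_if (dif va ''n'') (dif vb ''nn'') (arrow (dif va ''n'') (dif vb ''nn''))) s"
        unfolding set_kind_def using 2 b n ab assms(3) by simp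
      also have "\<dots> = s\<lparr>nmat := (nmat s)(''E'' := (nmat s ''E'')(a := (nmat s ''E'' a)(b := kind n G A R a b)))\<rparr>"
      proof (rule link_if)
        show "kind n G A R a b = of_bool (nval (dif va ''n'') s \<in> A \<and> nval (dif vb ''nn'') s \<in> A \<and>
            0 < nval (arrow (dif va ''n'') (dif vb ''nn'')) s)"
          unfolding arrow using 2 b n ab assms(3) by (simp add: kind.simps)
      qed (use 2 b n ab assms(3) in simp_all)
      finally show ?thesis .
    qed
  next
    case 3
    consider "b < n" | "n \<le> b" "b < n + n" | "n + n \<le> b" by linarith
    then show ?thesis
    proof cases
      case b: 1
      have "run set_kind s = run (link_if (dif va ''nn'') vb (arrow vb (dif va ''nn''))) s"
        unfolding set_kind_def using 3 b n ab assms(3) by simp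
      also have "\<dots> = s\<lparr>nmat := (nmat s)(''E'' := (nmat s ''E'')(a := (nmat s ''E'' a)(b := kind n G A R a b)))\<rparr>"
      proof (rule link_if)
        show "kind n G A R a b = of_bool (nval (dif va ''nn'') s \<in> A \<and> nval vb s \<in> A \<and>
            0 < nval (arrow vb (dif va ''nn'')) s)"
          unfolding arrow using 3 b n ab assms(3) by (simp add: kind.simps)
      qed (use 3 b n ab assms(3) in simp_all)
      finally show ?thesis .
    next
      case b: 2
      then show ?thesis unfolding set_kind_def using 3 n ab assms(3) by (simp add: kind.simps)
    next
      case b: 3
      have "run set_kind s = run (link_if (dif va ''nn'') (dif vb ''nn'') (NMat ''bid'' (dif va ''nn'') (dif vb ''nn''))) s"
        unfolding set_kind_def using 3 b n ab assms(3) by simp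
      also have "\<dots> = s\<lparr>nmat := (nmat s)(''E'' := (nmat s ''E'')(a := (nmat s ''E'' a)(b := kind n G A R a b)))\<rparr>"
      proof (rule link_if)
        show "kind n G A R a b = of_bool (nval (dif va ''nn'') s \<in> A \<and> nval (dif vb ''nn'') s \<in> A \<and>
            0 < nval (NMat ''bid'' (dif va ''nn'') (dif vb ''nn'')) s)"
          using 3 b n ab assms(3) bid by (simp add: kind.simps)
      qed (use 3 b n ab assms(3) in simp_all)
      finally show ?thesis .
    qed
  qed
qed

lemma set_kind_simps: "straight set_kind" "cost set_kind \<le> 100" "writes set_kind = {NM ''E''}"
  by (auto simp: set_kind_def)

lemma runs_build_network:
  assumes s: "input_ok s" "anterior_ok s" "nvar s ''bad'' = 0"
  shows "runs build_network s (300 * (n + n + n + 1) ^ 3)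
    (\<lambda>s'. network_ok s' \<and> (nvar s' ''bad'' = 0 \<longleftrightarrow> separates (R \<inter> A)))"
proof -
  let ?m = "n + n + n"
  let ?p = "Seq (SetNVar ''nn'' (NAdd (NVar ''n'') (NVar ''n''))) (SetNVar ''m'' (NAdd (NVar ''nn'') (NVar ''n'')))"
  let ?c = "Cond out_X (SetNArr ''Q'' va (NConst 1)) (SetNArr ''Q'' va (NConst 0))"
  let ?f = "For ''a'' ''m'' (Seq ?c (For ''b'' ''m'' set_kind))"
  let ?h = "Cond (BAnd (pos (NArr ''Y'' va)) (pos (NArr ''Q'' va))) (SetNVar ''bad'' (NConst 1)) Skip"
  let ?g = "For ''a'' ''n'' ?h"
  let ?q = "\<lambda>a. n \<le> a \<and> a < n + n \<and> a - n \<in> X"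
  define Row where "Row i s' \<longleftrightarrow> (\<forall>a<i. (0 < narr s' ''Q'' a \<longleftrightarrow> ?q a) \<and>
      (\<forall>b<?m. nmat s' ''E'' a b = kind n G A R a b))" for i and s' :: state
  define Ent where "Ent i j s' \<longleftrightarrow> Row i s' \<and> (0 < narr s' ''Q'' i \<longleftrightarrow> ?q i) \<and>
      (\<forall>b<j. nmat s' ''E'' i b = kind n G A R i b)" for i j and s' :: state
  have fill: "runs ?f s1 ((?m + 1) * (cost ?c + (?m + 1) * (cost set_kind + 10) + 10)) (Row ?m)"
    if s1: "input_ok s1" "anterior_ok s1" "nvar s1 ''m'' = ?m" "nvar s1 ''nn'' = n + n" for s1
  proof (rule runs_For_For[where Row = Row and Ent = Ent])
    have keep: "input_ok s'" "anterior_ok s'" "nvar s' ''nn'' = n + n" if "agree (writes ?f) s1 s'" for s'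
      using input_ok_agree[OF that s1(1)] anterior_ok_agree[OF that s1(2)]
        agreeD(1)[OF that, of "''nn''"] s1(4) by (simp_all add: set_kind_simps)
    show "nvar s1 ''m'' = ?m" by (rule s1)
    show "Row 0 (s1\<lparr>nvar := (nvar s1)(''a'' := 0)\<rparr>)" by (simp add: Row_def)
    {
      fix i s' assume s': "agree (writes ?f) s1 s'" "i < ?m" "nvar s' ''a'' = i" "Row i s'"
      have "nvar s' ''n'' = n" "narr s' ''X'' = (\<lambda>u. of_bool (u \<in> X))"
        using keep(1)[OF s'(1)] by (simp_all add: input_ok_def)
      then show "Ent i 0 (run ?c s'\<lparr>nvar := (nvar (run ?c s'))(''b'' := 0)\<rparr>)"
        using s'(3,4) keep(3)[OF s'(1)] by (auto simp: Row_def Ent_def)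
    next
      fix i j s' assume s': "agree (writes ?f) s1 s'" "i < ?m" "j < ?m" "nvar s' ''a'' = i" "nvar s' ''b'' = j" "Ent i j s'"
      show "Ent i (Suc j) (run set_kind s'\<lparr>nvar := (nvar (run set_kind s'))(''b'' := Suc j)\<rparr>)"
        unfolding run_set_kind[OF keep[OF s'(1)] s'(4,5,2,3)]
        using s'(6) by (auto simp: Row_def Ent_def less_Suc_eq)
    next
      fix i s' assume "Ent i ?m s'"
      then show "Row (Suc i) (s'\<lparr>nvar := (nvar s')(''a'' := Suc i)\<rparr>)"
        by (auto simp: Row_def Ent_def less_Suc_eq)
    }
  qed (simp_all add: set_kind_simps)
  have last: "runs ?g s3 ((n + 1) * 25) (\<lambda>s'. nvar s' ''bad'' = 0 \<longleftrightarrow> separates (R \<inter> A))"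
    if s3: "input_ok s3" "nvar s3 ''bad'' = 0"
      "marked ?m s3 = (links ?m s2)\<^sup>* `` marked ?m s2" "Row ?m s2" for s2 s3
  proof -
    \<comment> \<open>By \<open>kind_2\<close> every arc of kind \<open>2\<close> starts in
      \<open>R \<inter> A\<close>, so cutting this set leaves exactly the arcs of kind
      \<open>1\<close>.\<close>
    have "links ?m s2 = net (R \<inter> A)"
      using s3(4) kind_2 unfolding links_def net_def Row_def by auto
    moreover have "marked ?m s2 = (+) n ` X"
    proof -
      have "a \<in> marked ?m s2 \<longleftrightarrow> ?q a" for a
        using s3(4) by (auto simp: marked_def Row_def)
      moreover have "?q a \<longleftrightarrow> a \<in> (+) n ` X" for a
        using subsets by (auto simp: image_iff intro!: bexI[of _ "a - n"])
      ultimately show ?thesis by blast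
    qed
    ultimately have m: "marked ?m s3 = (net (R \<inter> A))\<^sup>* `` ((+) n ` X)" using s3(3) by simp
    have sep: "separates (R \<inter> A) \<longleftrightarrow> (\<forall>y<n. \<not> (y \<in> Y \<and> 0 < narr s3 ''Q'' y))"
    proof -
      have "separates (R \<inter> A) \<longleftrightarrow> (\<forall>y\<in>Y. y \<notin> marked ?m s3)"
        unfolding separates_def m by blast
      also have "\<dots> \<longleftrightarrow> (\<forall>y<n. \<not> (y \<in> Y \<and> 0 < narr s3 ''Q'' y))"
        using subsets(2) by (auto simp: marked_def)
      finally show ?thesis .
    qed
    have "runs ?g s3 ((n + 1) * (15 + 10))
      (\<lambda>s'. nvar s' ''bad'' = 0 \<longleftrightarrow> (\<forall>y<n. \<not> (y \<in> Y \<and> 0 < narr s3 ''Q'' y)))"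
    proof (rule runs_For[where Inv = "\<lambda>i s'. nvar s' ''bad'' = 0 \<longleftrightarrow> (\<forall>y<i. \<not> (y \<in> Y \<and> 0 < narr s3 ''Q'' y))"])
      show "nvar s3 ''n'' = n" using s3(1) by (simp add: input_ok_def)
      fix i s' assume s': "agree (insert (NV ''a'') (writes ?h)) s3 s'" "i < n" "nvar s' ''a'' = i"
        "nvar s' ''bad'' = 0 \<longleftrightarrow> (\<forall>y<i. \<not> (y \<in> Y \<and> 0 < narr s3 ''Q'' y))"
      have "input_ok s'" by (rule input_ok_agree[OF s'(1) s3(1)]) simp
      then have "narr s' ''Y'' = (\<lambda>u. of_bool (u \<in> Y))" by (simp add: input_ok_def)
      moreover have "narr s' ''Q'' = narr s3 ''Q''" using agreeD(2)[OF s'(1), of "''Q''"] by simp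
      ultimately show "runs ?h s' 15 (\<lambda>s''. nvar (s''\<lparr>nvar := (nvar s'')(''a'' := Suc i)\<rparr>) ''bad'' = 0
          \<longleftrightarrow> (\<forall>y<Suc i. \<not> (y \<in> Y \<and> 0 < narr s3 ''Q'' y)))"
        using s'(3,4) by (intro runs_straight) (auto simp: less_Suc_eq)
    qed (use s3 in auto)
    then show ?thesis using sep by simp
  qed
  have "runs build_network s
    (20 + ((?m + 1) * (cost ?c + (?m + 1) * (cost set_kind + 10) + 10) + (60 * (?m + 1) ^ 3 + (n + 1) * 25)))
    (\<lambda>s'. network_ok s' \<and> (nvar s' ''bad'' = 0 \<longleftrightarrow> separates (R \<inter> A)))"
    unfolding build_network_def
  proof (rule runs_Seq[where P = "\<lambda>s'. nvar s' ''nn'' = n + n \<and> nvar s' ''m'' = ?m"])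
    show "runs ?p s 20 (\<lambda>s'. nvar s' ''nn'' = n + n \<and> nvar s' ''m'' = ?m)"
      using s by (intro runs_straight) (auto simp: input_ok_def)
    fix s1 assume s1: "agree (writes ?p) s s1" "nvar s1 ''nn'' = n + n \<and> nvar s1 ''m'' = ?m"
    have ok: "input_ok s1" "anterior_ok s1"
      using input_ok_agree[OF s1(1) s(1)] anterior_ok_agree[OF s1(1) s(2)] by simp_all
    have bad1: "nvar s1 ''bad'' = 0" using agreeD(1)[OF s1(1), of "''bad''"] s(3) by simp
    show "runs (Seq ?f (Seq closure ?g)) s1
      ((?m + 1) * (cost ?c + (?m + 1) * (cost set_kind + 10) + 10) + (60 * (?m + 1) ^ 3 + (n + 1) * 25))
      (\<lambda>s'. network_ok s' \<and> (nvar s' ''bad'' = 0 \<longleftrightarrow> separates (R \<inter> A)))"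
    proof (rule runs_Seq[OF fill[OF ok]])
      fix s2 assume s2: "agree (writes ?f) s1 s2" "Row ?m s2"
      have m: "nvar s2 ''m'' = ?m" using agreeD(1)[OF s2(1), of "''m''"] s1 by (simp add: set_kind_simps)
      have bad2: "nvar s2 ''bad'' = 0" using agreeD(1)[OF s2(1), of "''bad''"] bad1 by (simp add: set_kind_simps)
      have "nvar s2 ''nn'' = n + n" using agreeD(1)[OF s2(1), of "''nn''"] s1 by (simp add: set_kind_simps)
      then have net2: "network_ok s2" using s2(2) m by (simp add: network_ok_def Row_def)
      have ok2: "input_ok s2" using input_ok_agree[OF s2(1) ok(1)] by (simp add: set_kind_simps)
      show "runs (Seq closure ?g) s2 (60 * (?m + 1) ^ 3 + (n + 1) * 25)
        (\<lambda>s'. network_ok s' \<and> (nvar s' ''bad'' = 0 \<longleftrightarrow> separates (R \<inter> A)))"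
      proof (rule runs_Seq[OF runs_closure[OF m]])
        fix s3 assume s3: "agree (writes closure) s2 s3" "marked ?m s3 = (links ?m s2)\<^sup>* `` marked ?m s2"
        have ok3: "input_ok s3" using input_ok_agree[OF s3(1) ok2] by (simp add: writes_closure)
        have net3: "network_ok s3" using network_ok_agree[OF s3(1) net2] by (simp add: writes_closure)
        have bad3: "nvar s3 ''bad'' = 0" using agreeD(1)[OF s3(1), of "''bad''"] bad2 by (simp add: writes_closure)
        show "runs ?g s3 ((n + 1) * 25) (\<lambda>s'. network_ok s' \<and> (nvar s' ''bad'' = 0 \<longleftrightarrow> separates (R \<inter> A)))"
        proof (rule runs_weaken[OF last[OF ok3 bad3 s3(2) s2(2)]])
          fix s' assume "agree (writes ?g) s3 s'" "nvar s' ''bad'' = 0 \<longleftrightarrow> separates (R \<inter> A)"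
          then show "network_ok s' \<and> (nvar s' ''bad'' = 0 \<longleftrightarrow> separates (R \<inter> A))"
            using network_ok_agree[of "writes ?g" s3 s'] net3 by simp
        qed simp
      qed
    qed (use s1 in auto)
  qed
  then show ?thesis
  proof (rule runs_weaken)
    have "(?m + 1) * (cost ?c + (?m + 1) * (cost set_kind + 10) + 10) \<le> (?m + 1) * (30 + (?m + 1) * (100 + 10) + 10)"
      using set_kind_simps(2) by (intro mult_le_mono add_mono) auto
    also have "20 + (\<dots> + (60 * (?m + 1) ^ 3 + (n + 1) * 25)) \<le> 300 * (?m + 1) ^ 3"
      by (simp add: power3_eq_cube algebra_simps)
    finally show "20 + ((?m + 1) * (cost ?c + (?m + 1) * (cost set_kind + 10) + 10) +
        (60 * (?m + 1) ^ 3 + (n + 1) * 25)) \<le> 300 * (?m + 1) ^ 3" by simp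
  qed simp
qed

end

lemma push_all_effect:
  assumes "nvar s ''u'' = u" "nvar s ''v'' = v" "u \<noteq> v"
  shows "cmat (run push_all s) ''r'' = (cmat s ''r'')
      (u := (cmat s ''r'' u)(v := cmat s ''r'' u v + carr s ''e'' v),
       v := (cmat s ''r'' v)(u := cmat s ''r'' v u - carr s ''e'' v))"
    and "carr (run push_all s) ''e'' = (carr s ''e'')(u := carr s ''e'' u + carr s ''e'' v, v := 0)"
    and "narr (run push_all s) = narr s" "nvar (run push_all s) = (nvar s)(''v'' := v + 1)"
  using assms by (simp_all add: push_all_def)

lemma push_saturating_effect:
  assumes "nvar s ''u'' = u" "nvar s ''v'' = v" "u \<noteq> v"
  shows "cmat (run push_saturating s) ''r'' = (cmat s ''r'')
      (u := (cmat s ''r'' u)(v := cmat s ''r'' u v + cmat s ''r'' v u), v := (cmat s ''r'' v)(u := 0))"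
    and "carr (run push_saturating s) ''e'' = (carr s ''e'')
      (u := carr s ''e'' u + cmat s ''r'' v u, v := carr s ''e'' v - cmat s ''r'' v u)"
    and "narr (run push_saturating s) = (narr s)(''c'' := (narr s ''c'')(v := narr s ''c'' v + 1))"
    and "nvar (run push_saturating s) = nvar s"
  using assms by (simp_all add: push_saturating_def)

context separation_instance
begin

lemma runs_compute_big:
  assumes s: "input_ok s" "cvar s ''B'' = 0"
  shows "runs compute_big s (40 * (n + 1)) (\<lambda>s'. cvar s' ''B'' = ereal big)"
proof -
  let ?c = "Cond (pos (NArr ''R'' va)) (SetCVar ''B'' (CAdd (CVar ''B'') (CArr ''w'' va))) Skip"
  have "runs compute_big s ((n + 1) * (20 + 10) + 10) (\<lambda>s'. cvar s' ''B'' = ereal big)"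
    unfolding compute_big_def
  proof (rule runs_Seq, rule runs_For[where Inv = "\<lambda>i s'. cvar s' ''B'' = ereal (sum wt (R \<inter> {..<i}))"])
    show "nvar s ''n'' = n" using s by (simp add: input_ok_def)
    fix i s' assume s': "agree (insert (NV ''a'') (writes ?c)) s s'" "i < n" "nvar s' ''a'' = i"
      "cvar s' ''B'' = ereal (sum wt (R \<inter> {..<i}))"
    have "input_ok s'" by (rule input_ok_agree[OF s'(1) s(1)]) simp
    then have "narr s' ''R'' = (\<lambda>u. of_bool (u \<in> R))" "\<And>u. u \<in> R \<Longrightarrow> carr s' ''w'' u = ereal (wt u)"
      by (simp_all add: input_ok_def)
    moreover have "R \<inter> {..<Suc i} = (if i \<in> R then insert i (R \<inter> {..<i}) else R \<inter> {..<i})"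
      by (auto simp: less_Suc_eq)
    ultimately show "runs ?c s' 20
        (\<lambda>s''. cvar (s''\<lparr>nvar := (nvar s'')(''a'' := Suc i)\<rparr>) ''B'' = ereal (sum wt (R \<inter> {..<Suc i})))"
      using s'(3,4) finR by (intro runs_straight) (auto simp: add.commute)
  next
    fix s' :: state assume "cvar s' ''B'' = ereal (sum wt (R \<inter> {..<n}))"
    moreover have "R \<inter> {..<n} = R" using subsets by auto
    ultimately show "runs (SetCVar ''B'' (CAdd (CVar ''B'') (CVar ''B''))) s' 10 (\<lambda>s'. cvar s' ''B'' = ereal big)"
      by (intro runs_straight) (auto simp: big_def)
  qed (use s in auto)
  then show ?thesis by (rule runs_weaken) auto
qed

end

section \<open>One minimum cut computation, with the nodes of \<open>J\<close> free of
  charge\<close>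

locale flow_instance = separation_instance +
  fixes J :: "nat set"
  assumes J: "J \<subseteq> R"

sublocale flow_instance \<subseteq> supply_net "n + n + n" "capacity J" inflow Y
  by (rule supply_net)

context flow_instance
begin

definition ready :: "state \<Rightarrow> bool" where
  "ready s \<longleftrightarrow> input_ok s \<and> anterior_ok s \<and> network_ok s \<and> cvar s ''B'' = ereal big \<and>
     (\<forall>a<n. narr s ''J'' a = 0 \<longleftrightarrow> a \<notin> J)"

lemma ready_agree:
  assumes "agree W s s'" "ready s"
    "{NV ''n'', NA ''X'', NA ''Y'', NA ''R'', NA ''I'', NM ''dir'', NM ''und'', NM ''bid'', CA ''w'',
      NA ''A'', NV ''nn'', NV ''m'', NM ''E'', CV ''B'', NA ''J''} \<inter> W = {}"
  shows "ready s'"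
proof -
  have "cvar s' ''B'' = cvar s ''B''" "narr s' ''J'' = narr s ''J''"
    by (rule agreeD[OF assms(1)]; use assms(3) in auto)+
  moreover have "input_ok s'" "anterior_ok s'" "network_ok s'"
    using assms(2,3) unfolding ready_def
    by (auto intro!: input_ok_agree[OF assms(1)] anterior_ok_agree[OF assms(1)] network_ok_agree[OF assms(1)])
  ultimately show ?thesis using assms(2) unfolding ready_def by simp
qed

text \<open>The cells hold extended reals, whereas the invariant speaks of real-valued functions;
  these are existentially quantified and have to match the memory on the network nodes only.\<close>

definition flow_state :: "state \<Rightarrow> bool" where
  "flow_state s \<longleftrightarrow> (\<exists>r e.
     invariant r e (narr s ''d'') (narr s ''c'') (nvar s ''v'') (nvar s ''L'') \<and>
     (\<forall>a<n + n + n. \<forall>b<n + n + n. cmat s ''r'' a b = ereal (r a b)) \<and>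
     (\<forall>a<n + n + n. carr s ''e'' a = ereal (e a)))"

definition state_potential :: "state \<Rightarrow> nat" where
  "state_potential s = potential (narr s ''d'') (narr s ''c'') (nvar s ''v'') (nvar s ''L'')"

lemma runs_init_flow:
  assumes s: "ready s"
  shows "runs init_flow s (100 * (n + n + n + 1) ^ 2)
    (\<lambda>s'. flow_state s' \<and> state_potential s' \<le> 3 * (n + n + n + 1) ^ 3)"
proof -
  let ?m = "n + n + n"
  let ?c = "Seq (SetNArr ''d'' va (NConst 0)) (Seq (SetNArr ''c'' va (NConst 0))
         (Cond out_X (SetCArr ''e'' va (CVar ''B'')) (SetCArr ''e'' va CZero)))"
  let ?d = "Cond (NEq (NMat ''E'' va vb) (NConst 1)) (SetCMat ''r'' va vb (CVar ''B''))
         (Cond (BAnd (NEq (NMat ''E'' va vb) (NConst 2)) (NEq (NArr ''J'' va) (NConst 0)))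
           (SetCMat ''r'' va vb (CArr ''w'' va)) (SetCMat ''r'' va vb CZero))"
  let ?f = "For ''a'' ''m'' (Seq ?c (For ''b'' ''m'' ?d))"
  let ?g = "Seq (SetNVar ''v'' (NConst 0)) (SetNVar ''L'' (NConst 0))"
  define Row where "Row i s' \<longleftrightarrow> (\<forall>a<i. narr s' ''d'' a = 0 \<and> narr s' ''c'' a = 0 \<and>
      carr s' ''e'' a = ereal (inflow a) \<and> (\<forall>b<?m. cmat s' ''r'' a b = ereal (capacity J a b)))"
    for i and s' :: state
  define Ent where "Ent i j s' \<longleftrightarrow> Row i s' \<and> narr s' ''d'' i = 0 \<and> narr s' ''c'' i = 0 \<and>
      carr s' ''e'' i = ereal (inflow i) \<and> (\<forall>b<j. cmat s' ''r'' i b = ereal (capacity J i b))"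
    for i j and s' :: state
  have "runs init_flow s (((?m + 1) * (cost ?c + (?m + 1) * (cost ?d + 10) + 10)) + 4)
     (\<lambda>s'. flow_state s' \<and> state_potential s' \<le> 3 * (?m + 1) ^ 3)"
    unfolding init_flow_def
  proof (rule runs_Seq, rule runs_For_For[where Row = Row and Ent = Ent])
    show "nvar s ''m'' = ?m" using s by (simp add: ready_def network_ok_def)
    show "Row 0 (s\<lparr>nvar := (nvar s)(''a'' := 0)\<rparr>)" by (simp add: Row_def)
  next
    fix i s' assume s': "agree (writes ?f) s s'" "i < ?m" "nvar s' ''a'' = i" "Row i s'"
    have "ready s'" by (rule ready_agree[OF s'(1) s]) simp
    then have "nvar s' ''n'' = n" "nvar s' ''nn'' = n + n" "narr s' ''X'' = (\<lambda>u. of_bool (u \<in> X))"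
      "cvar s' ''B'' = ereal big"
      by (simp_all add: ready_def network_ok_def input_ok_def)
    then show "Ent i 0 (run ?c s'\<lparr>nvar := (nvar (run ?c s'))(''b'' := 0)\<rparr>)"
      using s'(3,4) by (auto simp: Row_def Ent_def inflow_def zero_ereal_def)
  next
    fix i j s' assume s': "agree (writes ?f) s s'" "i < ?m" "j < ?m" "nvar s' ''a'' = i" "nvar s' ''b'' = j" "Ent i j s'"
    have rdy: "ready s'" by (rule ready_agree[OF s'(1) s]) simp
    have k: "nmat s' ''E'' i j = kind n G A R i j" "cvar s' ''B'' = ereal big"
      using rdy s'(2,3) by (simp_all add: ready_def network_ok_def)
    have J: "narr s' ''J'' i = 0 \<longleftrightarrow> i \<notin> J" "carr s' ''w'' i = ereal (wt i)" if "kind n G A R i j = 2"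
      using rdy kind_2[OF that] by (auto simp: ready_def input_ok_def)
    have "run ?d s' = s'\<lparr>cmat := (cmat s')(''r'' := (cmat s' ''r'')(i := (cmat s' ''r'' i)(j := ereal (capacity J i j))))\<rparr>"
    proof (cases "kind n G A R i j = 2")
      case True
      then show ?thesis using k J[OF True] s'(4,5) by (cases "i \<in> J") (simp_all add: capacity_def zero_ereal_def)
    next
      case False
      then show ?thesis using k s'(4,5) by (simp add: capacity_def zero_ereal_def)
    qed
    then show "Ent i (Suc j) (run ?d s'\<lparr>nvar := (nvar (run ?d s'))(''b'' := Suc j)\<rparr>)"
      using s'(6) by (auto simp: Row_def Ent_def less_Suc_eq)
  next
    fix i s' assume "Ent i ?m s'"
    then show "Row (Suc i) (s'\<lparr>nvar := (nvar s')(''a'' := Suc i)\<rparr>)"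
      by (auto simp: Row_def Ent_def less_Suc_eq)
  next
    fix s' assume Row: "Row ?m s'"
    then have z: "narr s' ''d'' a = 0 \<and> narr s' ''c'' a = 0" if "a < ?m" for a
      using that by (simp add: Row_def)
    have "flow_state (run ?g s')"
      unfolding flow_state_def
      by (rule exI[of _ "capacity J"], rule exI[of _ inflow])
         (use invariant_init[OF z] Row in \<open>simp add: Row_def\<close>)
    moreover have "state_potential (run ?g s') \<le> 3 * (?m + 1) ^ 3"
      unfolding state_potential_def using potential_init[OF z] by simp
    ultimately show "runs ?g s' 4 (\<lambda>s'. flow_state s' \<and> state_potential s' \<le> 3 * (?m + 1) ^ 3)"
      by (intro runs_straight) simp_all
  qed simp_all
  then show ?thesis by (rule runs_weaken) (simp_all add: power2_eq_square algebra_simps)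
qed

text \<open>Each branch of \<open>flow_step\<close> pairs one preservation lemma with one potential
  lemma. An inadmissible arc or a saturating push advances the current arc; a push that empties
  \<open>v\<close>, like a visit to an inactive node, advances the pass.\<close>

lemma flow_step_correct:
  assumes s: "ready s" "flow_state s" and go: "\<not> (nvar s ''v'' = n + n + n \<and> nvar s ''L'' = 0)"
  shows "flow_state (run flow_step s) \<and> state_potential (run flow_step s) < state_potential s"
proof -
  let ?m = "n + n + n"
  define v d c L where defs: "v = nvar s ''v''" "d = narr s ''d''" "c = narr s ''c''" "L = nvar s ''L''"
  obtain r e where inv: "invariant r e d c v L"
    and r: "\<And>a b. a < ?m \<Longrightarrow> b < ?m \<Longrightarrow> cmat s ''r'' a b = ereal (r a b)"
    and e: "\<And>a. a < ?m \<Longrightarrow> carr s ''e'' a = ereal (e a)"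
    using s(2) unfolding flow_state_def defs by blast
  have m: "nvar s ''m'' = ?m" and Y: "narr s ''Y'' = (\<lambda>u. of_bool (u \<in> Y))"
    using s(1) by (auto simp: ready_def network_ok_def input_ok_def)
  have flowI: "flow_state s' \<and> state_potential s' < state_potential s"
    if "invariant r' e' d' c' v' L'" "potential d' c' v' L' < potential d c v L"
      "narr s' ''d'' = d'" "narr s' ''c'' = c'" "nvar s' ''v'' = v'" "nvar s' ''L'' = L'"
      "\<And>a b. a < ?m \<Longrightarrow> b < ?m \<Longrightarrow> cmat s' ''r'' a b = ereal (r' a b)"
      "\<And>a. a < ?m \<Longrightarrow> carr s' ''e'' a = ereal (e' a)" for s' r' e' d' c' v' L'
    using that unfolding flow_state_def state_potential_def defs by blast
  show ?thesis
  proof (cases "v < ?m")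
    case False
    then have v: "v = ?m" using invariant_bounds(1)[OF inv] by simp
    then have L: "0 < L" using go defs by simp
    have step: "run flow_step s = s\<lparr>nvar := (nvar s)(''v'' := 0, ''L'' := L - 1)\<rparr>"
      using v m by (simp add: flow_step_def defs)
    have "potential d c 0 (L - 1) < potential d c v L" using potential_wrap[OF L] v by simp
    then show ?thesis unfolding step
      by (rule flowI[OF invariant_wrap[OF inv v L]])
         (simp_all add: defs r e)
  next
    case v: True
    let ?active = "BAnd (CLess CZero (CArr ''e'' vv)) (BAnd (NLess (NArr ''d'' vv) (NAdd (NVar ''m'') (NConst 1)))
           (NEq (NArr ''Y'' vv) (NConst 0)))"
    have act: "bval ?active s \<longleftrightarrow> active e d v"
      using e[OF v] m Y by (simp add: active_def defs)
    show ?thesis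
    proof (cases "active e d v")
      case False
      have step: "run flow_step s = s\<lparr>nvar := (nvar s)(''v'' := v + 1)\<rparr>"
      proof -
        have *: "bval (NLess vv (NVar ''m'')) s" "\<not> bval ?active s"
          using v m act False by (simp_all only: bval.simps nval.simps defs not_False_eq_True)
        show ?thesis
          unfolding flow_step_def run.simps(9) by (simp only: * if_True if_False) (simp add: defs)
      qed
      show ?thesis unfolding step
        by (rule flowI[OF invariant_next[OF inv v False] potential_next[OF v]])
           (simp_all add: defs r e)
    next
      case True
      note active = this
      show ?thesis
      proof (cases "c v < ?m")
        case False
        then have cv: "c v = ?m" using invariant_bounds(2)[OF inv v] by simp
        have dv: "d v < ?m + 1" using active by (simp add: active_def)
        have step: "run flow_step s = run relabel s"
          using v m act active False by (simp add: flow_step_def defs)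
        show ?thesis unfolding step
          by (rule flowI[OF invariant_relabel[OF inv v cv active] potential_relabel[of v c d L, OF v cv dv]])
             (simp_all add: relabel_def defs r e)
      next
        case cv: True
        define u where "u = c v"
        define s1 where "s1 = s\<lparr>nvar := (nvar s)(''u'' := u)\<rparr>"
        have u: "u < ?m" using cv u_def by simp
        have s1: "nvar s1 ''u'' = u" "nvar s1 ''v'' = v" "nvar s1 ''L'' = L"
          "narr s1 = narr s" "cmat s1 = cmat s" "carr s1 = carr s"
          by (simp_all add: s1_def defs)
        have step: "run flow_step s = (if 0 < r v u \<and> d v = d u + 1
            then if r v u < e v then run push_saturating s1 else run push_all s1
            else s1\<lparr>narr := (narr s)(''c'' := c(v := c v + 1))\<rparr>)"
        proof -
          have "run flow_step s = run (Seq (SetNVar ''u'' (NArr ''c'' vv))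
            (Cond (BAnd (CLess CZero (CMat ''r'' vv vu)) (NEq (NArr ''d'' vv) (NAdd (NArr ''d'' vu) (NConst 1))))
             (Cond (CLess (CMat ''r'' vv vu) (CArr ''e'' vv)) push_saturating push_all)
             (SetNArr ''c'' vv (NAdd (NArr ''c'' vv) (NConst 1))))) s"
            using v m act active cv by (simp add: flow_step_def defs)
          also have "\<dots> = run (Cond (BAnd (CLess CZero (CMat ''r'' vv vu)) (NEq (NArr ''d'' vv) (NAdd (NArr ''d'' vu) (NConst 1))))
             (Cond (CLess (CMat ''r'' vv vu) (CArr ''e'' vv)) push_saturating push_all)
             (SetNArr ''c'' vv (NAdd (NArr ''c'' vv) (NConst 1)))) s1"
            by (simp add: s1_def u_def defs)
          finally show ?thesis using s1 r[OF v u] e[OF v] by (simp add: defs(2,3))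
        qed
        show ?thesis
        proof (cases "0 < r v u \<and> d v = d u + 1")
          case False
          have step': "run flow_step s = s1\<lparr>narr := (narr s)(''c'' := c(v := c v + 1))\<rparr>"
            using step unfolding if_not_P[OF False] .
          show ?thesis unfolding step'
            by (rule flowI[OF invariant_advance[OF inv v cv] potential_advance[of v c d L, OF v cv]])
               (use False in \<open>simp_all add: s1 r e u_def defs(2)\<close>)
        next
          case adm: True
          then have uv: "u \<noteq> v" by auto
          have ruv: "0 < r v (c v)" "d v = d (c v) + 1" using adm by (simp_all add: u_def)
          show ?thesis
          proof (cases "r v u < e v")
            case True
            have step': "run flow_step s = run push_saturating s1" using step adm True by simp
            show ?thesis unfolding step'
              by (rule flowI[OF invariant_push_saturating[OF inv v cv ruv active] potential_advance[of v c d L, OF v cv]])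
                 (use True u v uv in \<open>simp_all add: push_saturating_effect[OF s1(1,2) uv] s1 r e u_def[symmetric] defs(2,3)[symmetric]\<close>)
          next
            case False
            have step': "run flow_step s = run push_all s1" using step adm False by simp
            show ?thesis unfolding step'
              by (rule flowI[OF invariant_push_all[OF inv v cv ruv active] potential_next[OF v]])
                 (use False u v uv in \<open>simp_all add: push_all_effect[OF s1(1,2) uv] s1 r e u_def[symmetric] defs(2,3)[symmetric]\<close>)
          qed
        qed
      qed
    qed
  qed
qed

lemma flow_step_simps: "straight flow_step" "cost flow_step \<le> 100"
  "writes flow_step = {NV ''u'', NV ''v'', NV ''L'', NA ''c'', NA ''d'', CA ''e'', CM ''r''}"
  by (auto simp: flow_step_def push_all_def push_saturating_def relabel_def)

lemma runs_max_flow: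
  assumes s: "ready s" "flow_state s" "state_potential s \<le> 3 * (n + n + n + 1) ^ 3"
  shows "runs max_flow s (500 * (n + n + n + 1) ^ 3)
    (\<lambda>s'. flow_state s' \<and> nvar s' ''v'' = n + n + n \<and> nvar s' ''L'' = 0)"
proof -
  let ?b = "BNot (BAnd (NEq vv (NVar ''m'')) (NEq (NVar ''L'') (NConst 0)))"
  have rdy: "ready s'" if "agree (writes flow_step) s s'" for s'
    by (rule ready_agree[OF that s(1)]) (simp add: flow_step_simps)
  have "runs max_flow s ((state_potential s + 1) * (100 + btime ?b + 1)) (\<lambda>s'. (flow_state s' \<and> ready s') \<and> \<not> bval ?b s')"
    unfolding max_flow_def
  proof (rule runs_While[where meas = state_potential])
    show "flow_state s \<and> ready s" using s by simp
    fix s' assume s': "flow_state s' \<and> ready s'" "bval ?b s'"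
    have "nvar s' ''m'' = n + n + n" using s'(1) by (simp add: ready_def network_ok_def)
    then have go: "\<not> (nvar s' ''v'' = n + n + n \<and> nvar s' ''L'' = 0)" using s'(2) by simp
    have "ready (run flow_step s')"
      using ready_agree[OF run_agree[OF flow_step_simps(1)]] s'(1) by (simp add: flow_step_simps)
    then show "runs flow_step s' 100 (\<lambda>s''. (flow_state s'' \<and> ready s'') \<and> state_potential s'' < state_potential s')"
      using flow_step_correct[OF _ _ go] s'(1) flow_step_simps by (intro runs_straight) auto
  qed
  then show ?thesis
  proof (rule runs_weaken)
    have "1 \<le> (n + n + n + 1) ^ 3" by simp
    then have "state_potential s + 1 \<le> 4 * (n + n + n + 1) ^ 3" using s(3) by linarith
    \<comment> \<open>An iteration is charged \<open>100\<close> for the body, \<open>8\<close> for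
      the test and \<open>1\<close> for the loop.\<close>
    then have "(state_potential s + 1) * 109 \<le> 4 * (n + n + n + 1) ^ 3 * 109" by (intro mult_le_mono1)
    then show "(state_potential s + 1) * (100 + btime ?b + 1) \<le> 500 * (n + n + n + 1) ^ 3" by simp
    fix s' assume s': "(flow_state s' \<and> ready s') \<and> \<not> bval ?b s'"
    then have "nvar s' ''m'' = n + n + n" by (simp add: ready_def network_ok_def)
    then show "flow_state s' \<and> nvar s' ''v'' = n + n + n \<and> nvar s' ''L'' = 0" using s' by simp
  qed
qed

end

context separation_instance
begin

text \<open>The array contains \<open>J \<union> Z\<close> and the recorded cost includes all of
  \<open>J\<close>, whereas optimality of \<open>Z\<close> refers to what is paid outside
  \<open>J\<close>.\<close>

definition optimal_result :: "nat set \<Rightarrow> state \<Rightarrow> bool" where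
  "optimal_result J s \<longleftrightarrow> (\<exists>Z. Z \<subseteq> R \<inter> A \<and> separates Z \<and>
     (\<forall>Z'. Z' \<subseteq> R \<inter> A \<longrightarrow> separates Z' \<longrightarrow> sum wt (Z - J) \<le> sum wt (Z' - J)) \<and>
     {u. u < n \<and> narr s ''Z'' u \<noteq> 0} = J \<union> Z \<and> cvar s ''cost'' = ereal (sum wt (J \<union> Z)))"

end

context flow_instance
begin

lemma runs_find_gap:
  assumes s: "ready s" "flow_state s" "nvar s ''v'' = n + n + n" "nvar s ''L'' = 0"
  shows "runs find_gap s (60 * (n + n + n + 1) ^ 2)
    (\<lambda>s'. 1 \<le> nvar s' ''k'' \<and> nvar s' ''k'' \<le> n + n + n \<and> (\<forall>a<n + n + n. narr s ''d'' a \<noteq> nvar s' ''k''))"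
proof -
  let ?m = "n + n + n"
  let ?i = "Seq (SetNVar ''k'' (NConst 1)) (SetNVar ''a'' (NConst 0))"
  let ?c = "Cond (NEq (NArr ''d'' va) (NVar ''k''))
            (Seq (SetNVar ''k'' (NAdd (NVar ''k'') (NConst 1))) (SetNVar ''a'' (NConst 0)))
            (SetNVar ''a'' (NAdd va (NConst 1)))"
  let ?b = "NLess va (NVar ''m'')"
  define d where "d = narr s ''d''"
  obtain r e c where inv: "invariant r e d c ?m 0"
    using s unfolding flow_state_def d_def by metis
  define Inv where "Inv s' \<longleftrightarrow> narr s' ''d'' = d \<and> nvar s' ''m'' = ?m \<and> 1 \<le> nvar s' ''k'' \<and> nvar s' ''a'' \<le> ?m \<and>
      (\<forall>j. 1 \<le> j \<longrightarrow> j < nvar s' ''k'' \<longrightarrow> (\<exists>a<?m. d a = j)) \<and> (\<forall>a<nvar s' ''a''. d a \<noteq> nvar s' ''k'')"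
    for s' :: state
  have k: "nvar s' ''k'' \<le> ?m" if "Inv s'" for s'
    by (rule gap_bound[OF inv]) (use that in \<open>simp add: Inv_def\<close>)
  \<comment> \<open>A lexicographic measure: the factor \<open>?m + 1\<close> compensates for
    restarting the scan, and \<open>k\<close> stays at most \<open>?m\<close> by
    \<open>gap_bound\<close>.\<close>
  define meas where "meas s' = (?m + 1 - nvar s' ''k'') * (?m + 1) + (?m - nvar s' ''a'')" for s' :: state
  have loop: "runs (While ?b ?c) s1 ((meas s1 + 1) * (20 + btime ?b + 1)) (\<lambda>s'. Inv s' \<and> \<not> bval ?b s')"
    if "Inv s1" for s1
  proof (rule runs_While[where Inv = Inv and meas = meas])
    show "Inv s1" by (rule that)
    fix s' assume s': "Inv s'" "bval ?b s'"
    then have a: "nvar s' ''a'' < ?m" by (simp add: Inv_def)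
    have d: "narr s' ''d'' = d" using s' by (simp add: Inv_def)
    show "runs ?c s' 20 (\<lambda>s''. Inv s'' \<and> meas s'' < meas s')"
    proof (cases "d (nvar s' ''a'') = nvar s' ''k''")
      case True
      have "Inv (run ?c s')"
        using s'(1) True a unfolding Inv_def by (auto simp: less_Suc_eq)
      moreover have "meas (run ?c s') < meas s'"
      proof -
        obtain q where "?m + 1 - nvar s' ''k'' = Suc q" "?m + 1 - (nvar s' ''k'' + 1) = q"
          using k[OF s'(1)] by (metis Suc_diff_le add.commute diff_Suc_Suc plus_1_eq_Suc)
        then show ?thesis using True d a by (simp add: meas_def)
      qed
      ultimately show ?thesis by (intro runs_straight) simp_all
    next
      case False
      have "Inv (run ?c s')"
        using s'(1) False a unfolding Inv_def by (auto simp: less_Suc_eq)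
      moreover have "meas (run ?c s') < meas s'"
        using False d a by (simp add: meas_def)
      ultimately show ?thesis by (intro runs_straight) simp_all
    qed
  qed
  have "runs find_gap s (4 + (((?m + 1) ^ 2 + 1) * 24)) (\<lambda>s'. Inv s' \<and> \<not> bval ?b s')"
    unfolding find_gap_def
  proof (rule runs_Seq[where P = "\<lambda>s'. Inv s' \<and> meas s' \<le> (?m + 1) ^ 2"])
    have "nvar s ''m'' = ?m" using s by (simp add: ready_def network_ok_def)
    then show "runs ?i s 4 (\<lambda>s'. Inv s' \<and> meas s' \<le> (?m + 1) ^ 2)"
      by (intro runs_straight) (auto simp: Inv_def meas_def d_def power2_eq_square)
    fix s1 assume s1: "Inv s1 \<and> meas s1 \<le> (?m + 1) ^ 2"
    show "runs (While ?b ?c) s1 (((?m + 1) ^ 2 + 1) * 24) (\<lambda>s'. Inv s' \<and> \<not> bval ?b s')"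
    proof (rule runs_weaken[OF loop])
      have "(meas s1 + 1) * 24 \<le> ((?m + 1) ^ 2 + 1) * 24" using s1 by (intro mult_le_mono1) simp
      then show "(meas s1 + 1) * (20 + btime ?b + 1) \<le> ((?m + 1) ^ 2 + 1) * 24" by simp
    qed (use s1 in auto)
  qed
  then show ?thesis
  proof (rule runs_weaken)
    have "4 + (q + 1) * 24 \<le> 60 * q" if "1 \<le> q" for q :: nat using that by simp
    from this[of "(?m + 1) ^ 2"] show "4 + ((?m + 1) ^ 2 + 1) * 24 \<le> 60 * (?m + 1) ^ 2" by simp
    fix s' assume s': "Inv s' \<and> \<not> bval ?b s'"
    then have "nvar s' ''a'' = ?m" by (auto simp: Inv_def)
    then show "1 \<le> nvar s' ''k'' \<and> nvar s' ''k'' \<le> ?m \<and> (\<forall>a<?m. narr s ''d'' a \<noteq> nvar s' ''k'')"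
      using s' k[of s'] by (simp add: Inv_def d_def)
  qed
qed

lemma runs_extract_cut:
  assumes s: "ready s"
    and Z: "Z = {u \<in> R \<inter> A. nvar s ''k'' < narr s ''d'' u \<and> \<not> nvar s ''k'' < narr s ''d'' (n + u)}"
  shows "runs extract_cut s (60 * (n + 1))
    (\<lambda>s'. {u. u < n \<and> narr s' ''Z'' u \<noteq> 0} = J \<union> Z \<and> cvar s' ''cost'' = ereal (sum wt (J \<union> Z)))"
proof -
  let ?t = "BNot (BAnd (NEq (NArr ''J'' va) (NConst 0))
              (BNot (BAnd (BAnd (pos (NArr ''R'' va)) (pos (NArr ''A'' va)))
                (BAnd (NLess (NVar ''k'') (NArr ''d'' va)) (BNot (NLess (NVar ''k'') (NArr ''d'' (NAdd (NVar ''n'') va))))))))"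
  let ?y = "Seq (SetNArr ''Z'' va (NConst 1)) (SetCVar ''cost'' (CAdd (CVar ''cost'') (CArr ''w'' va)))"
  let ?n = "SetNArr ''Z'' va (NConst 0)"
  define Inv where "Inv i s' \<longleftrightarrow> (\<forall>u<i. narr s' ''Z'' u \<noteq> 0 \<longleftrightarrow> u \<in> J \<union> Z) \<and>
      cvar s' ''cost'' = ereal (sum wt ((J \<union> Z) \<inter> {..<i}))" for i and s' :: state
  have lt: "J \<union> Z \<subseteq> {..<n}" using J Z subsets by auto
  have "runs extract_cut s (2 + (n + 1) * (40 + 10)) (Inv n)"
    unfolding extract_cut_def
  proof (rule runs_Seq[where P = "\<lambda>s'. s' = run (SetCVar ''cost'' CZero) s"])
    show "runs (SetCVar ''cost'' CZero) s 2 (\<lambda>s'. s' = run (SetCVar ''cost'' CZero) s)"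
      by (intro runs_straight) simp_all
    fix s1 assume s1: "agree (writes (SetCVar ''cost'' CZero)) s s1" "s1 = run (SetCVar ''cost'' CZero) s"
    have rdy1: "ready s1" by (rule ready_agree[OF s1(1) s]) simp
    show "runs (For ''a'' ''n'' (Cond ?t ?y ?n)) s1 ((n + 1) * (40 + 10)) (Inv n)"
    proof (rule runs_For[where Inv = Inv])
      show "nvar s1 ''n'' = n" using rdy1 by (simp add: ready_def input_ok_def)
      show "Inv 0 (s1\<lparr>nvar := (nvar s1)(''a'' := 0)\<rparr>)" using s1(2) by (simp add: Inv_def zero_ereal_def)
      fix i s' assume s': "agree (insert (NV ''a'') (writes (Cond ?t ?y ?n))) s1 s'" "i < n" "nvar s' ''a'' = i" "Inv i s'"
      have rdy: "ready s'" by (rule ready_agree[OF s'(1) rdy1]) simp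
      have same: "nvar s' ''k'' = nvar s ''k''" "narr s' ''d'' = narr s ''d''"
        using agreeD(1)[OF s'(1), of "''k''"] agreeD(2)[OF s'(1), of "''d''"] s1(2) by simp_all
      have facts: "nvar s' ''n'' = n" "narr s' ''J'' i = 0 \<longleftrightarrow> i \<notin> J" "narr s' ''R'' i = of_bool (i \<in> R)"
        "0 < narr s' ''A'' i \<longleftrightarrow> i \<in> A"
        using rdy s'(2) by (simp_all add: ready_def input_ok_def anterior_ok_def)
      have w: "carr s' ''w'' i = ereal (wt i)" if "i \<in> J \<union> Z"
        using rdy that J Z by (auto simp: ready_def input_ok_def)
      have t: "bval ?t s' \<longleftrightarrow> i \<in> J \<union> Z"
        unfolding Z using facts s'(3) same by auto
      have fin: "finite ((J \<union> Z) \<inter> {..<i})" by simp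
      have ins: "(J \<union> Z) \<inter> {..<Suc i} = (if i \<in> J \<union> Z then insert i ((J \<union> Z) \<inter> {..<i}) else (J \<union> Z) \<inter> {..<i})"
        by (auto simp: less_Suc_eq)
      have "Inv (Suc i) (run (Cond ?t ?y ?n) s'\<lparr>nvar := (nvar (run (Cond ?t ?y ?n) s'))(''a'' := Suc i)\<rparr>)"
      proof (cases "i \<in> J \<union> Z")
        case True
        then have "run (Cond ?t ?y ?n) s' = run ?y s'" using t by (simp only: run.simps if_True)
        moreover have "sum wt ((J \<union> Z) \<inter> {..<Suc i}) = wt i + sum wt ((J \<union> Z) \<inter> {..<i})"
          unfolding ins using True by simp
        ultimately show ?thesis
          using s'(3,4) w[OF True] True unfolding Inv_def by (auto simp: less_Suc_eq add.commute)
      next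
        case False
        then have "run (Cond ?t ?y ?n) s' = run ?n s'" using t by (simp only: run.simps if_False)
        moreover have "sum wt ((J \<union> Z) \<inter> {..<Suc i}) = sum wt ((J \<union> Z) \<inter> {..<i})"
          unfolding ins using False by simp
        ultimately show ?thesis
          using s'(3,4) False unfolding Inv_def by (auto simp: less_Suc_eq)
      qed
      then show "runs (Cond ?t ?y ?n) s' 40
          (\<lambda>s''. Inv (Suc i) (s''\<lparr>nvar := (nvar s'')(''a'' := Suc i)\<rparr>))"
        by (intro runs_straight) simp_all
    qed simp_all
  qed
  then show ?thesis
  proof (rule runs_weaken)
    fix s' assume "Inv n s'"
    moreover have "(J \<union> Z) \<inter> {..<n} = J \<union> Z" using lt by blast
    ultimately show "{u. u < n \<and> narr s' ''Z'' u \<noteq> 0} = J \<union> Z \<and> cvar s' ''cost'' = ereal (sum wt (J \<union> Z))"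
      using lt unfolding Inv_def by auto
  qed simp
qed

lemma writes_init_flow: "writes init_flow =
    {NV ''a'', NV ''b'', NV ''v'', NV ''L'', NA ''d'', NA ''c'', CA ''e'', CM ''r''}"
  by (auto simp: init_flow_def)

lemma writes_max_flow: "writes max_flow = {NV ''u'', NV ''v'', NV ''L'', NA ''c'', NA ''d'', CA ''e'', CM ''r''}"
  by (simp add: max_flow_def flow_step_simps)

lemma writes_find_gap: "writes find_gap = {NV ''k'', NV ''a''}"
  by (auto simp: find_gap_def)

lemma runs_min_separator:
  assumes s: "ready s" and feasible: "separates (R \<inter> A)"
  shows "runs min_separator s (800 * (n + n + n + 1) ^ 3) (optimal_result J)"
proof -
  let ?m = "n + n + n"
  have "runs min_separator s
    (100 * (?m + 1) ^ 2 + (500 * (?m + 1) ^ 3 + (60 * (?m + 1) ^ 2 + 60 * (n + 1)))) (optimal_result J)"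
    unfolding min_separator_def
  proof (rule runs_Seq[OF runs_init_flow[OF s]])
    fix s1 assume s1: "agree (writes init_flow) s s1" "flow_state s1 \<and> state_potential s1 \<le> 3 * (?m + 1) ^ 3"
    have rdy1: "ready s1" by (rule ready_agree[OF s1(1) s]) (simp add: writes_init_flow)
    show "runs (Seq max_flow (Seq find_gap extract_cut)) s1
      (500 * (?m + 1) ^ 3 + (60 * (?m + 1) ^ 2 + 60 * (n + 1))) (optimal_result J)"
    proof (rule runs_Seq[OF runs_max_flow[OF rdy1]])
      fix s2 assume s2: "agree (writes max_flow) s1 s2" "flow_state s2 \<and> nvar s2 ''v'' = ?m \<and> nvar s2 ''L'' = 0"
      have rdy2: "ready s2" by (rule ready_agree[OF s2(1) rdy1]) (simp add: writes_max_flow)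
      obtain r e where inv: "invariant r e (narr s2 ''d'') (narr s2 ''c'') ?m 0"
        using s2(2) unfolding flow_state_def by metis
      show "runs (Seq find_gap extract_cut) s2 (60 * (?m + 1) ^ 2 + 60 * (n + 1)) (optimal_result J)"
      proof (rule runs_Seq[OF runs_find_gap[OF rdy2]])
        fix s3 assume s3: "agree (writes find_gap) s2 s3"
          "1 \<le> nvar s3 ''k'' \<and> nvar s3 ''k'' \<le> ?m \<and> (\<forall>a<?m. narr s2 ''d'' a \<noteq> nvar s3 ''k'')"
        have rdy3: "ready s3" by (rule ready_agree[OF s3(1) rdy2]) (simp add: writes_find_gap)
        have d: "narr s3 ''d'' = narr s2 ''d''"
          using agreeD(2)[OF s3(1), of "''d''"] by (simp add: writes_find_gap)
        define S where "S = {a. a < ?m \<and> nvar s3 ''k'' < narr s2 ''d'' a}"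
        define Z where "Z = {u \<in> R \<inter> A. u \<in> S \<and> n + u \<notin> S}"
        have k: "1 \<le> nvar s3 ''k''" "nvar s3 ''k'' \<le> ?m" "\<And>a. a < ?m \<Longrightarrow> narr s2 ''d'' a \<noteq> nvar s3 ''k''"
          using s3(2) by auto
        have S: "S \<subseteq> {..<?m}" by (auto simp: S_def)
        note cut = gap_min_cut[OF inv refl refl k S_def]
        have Z1: "separates Z" "\<And>Z'. Z' \<subseteq> R \<inter> A \<Longrightarrow> separates Z' \<Longrightarrow> sum wt (Z - J) \<le> sum wt (Z' - J)"
          by (rule minimum_cut_separator[OF S cut feasible J Z_def]; assumption)+
        have Z_eq: "Z = {u \<in> R \<inter> A. nvar s3 ''k'' < narr s3 ''d'' u \<and> \<not> nvar s3 ''k'' < narr s3 ''d'' (n + u)}"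
          using subsets(3) unfolding Z_def S_def d by auto
        show "runs extract_cut s3 (60 * (n + 1)) (optimal_result J)"
        proof (rule runs_weaken[OF runs_extract_cut[OF rdy3 Z_eq]])
          fix s' :: state assume "{u. u < n \<and> narr s' ''Z'' u \<noteq> 0} = J \<union> Z \<and> cvar s' ''cost'' = ereal (sum wt (J \<union> Z))"
          moreover have "Z \<subseteq> R \<inter> A" by (auto simp: Z_def)
          ultimately show "optimal_result J s'"
            unfolding optimal_result_def using Z1 by (intro exI[of _ Z]) simp
        qed simp
      qed (use s2 in auto)
    qed (use s1 in auto)
  qed
  then show ?thesis by (rule runs_weaken) (simp_all add: power2_eq_square power3_eq_cube algebra_simps)
qed

end

section \<open>Comparison of the two optima and correctness of the answer\<close>

context separation_instance
begin

lemma sum_w: "Z \<subseteq> R \<Longrightarrow> sum w Z = ereal (sum wt Z)"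
proof -
  assume "Z \<subseteq> R"
  then have "sum w Z = (\<Sum>u\<in>Z. ereal (wt u))" using w by (intro sum.cong) auto
  then show ?thesis by simp
qed

lemma finite_sub_R: "Z \<subseteq> R \<Longrightarrow> finite Z"
  using finR finite_subset by blast

lemma sum_wt_mono: "Z \<subseteq> Z' \<Longrightarrow> Z' \<subseteq> R \<Longrightarrow> sum wt Z \<le> sum wt Z'"
  using wt_pos finite_sub_R by (intro sum_mono2) (auto intro: less_imp_le)

lemma subset_if_sum_wt_le:
  assumes "Z \<subseteq> Z'" "Z' \<subseteq> R" "sum wt Z' \<le> sum wt Z"
  shows "Z' = Z"
proof (rule ccontr)
  assume "Z' \<noteq> Z"
  then obtain b where "b \<in> Z' - Z" using assms(1) by blast
  then have "sum wt Z < sum wt Z'"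
    using assms(1,2) wt_pos finite_sub_R[OF assms(2)]
    by (intro sum_strict_mono2[of Z' Z b]) (auto intro: less_imp_le)
  then show False using assms(3) by linarith
qed

text \<open>A competitor that leaves \<open>R\<close> has infinite cost. One inside \<open>R\<close>
  does not become dearer when restricted to \<open>A\<close>, and then it is a separating set of the
  network.\<close>

lemma m_separator_weight:
  assumes Z: "m_separator G X Y Z"
    and Z1: "Z1 \<subseteq> R \<inter> A" "\<And>Z'. Z' \<subseteq> R \<inter> A \<Longrightarrow> separates Z' \<Longrightarrow> sum wt Z1 \<le> sum wt Z'"
  shows "ereal (sum wt Z1) \<le> sum w Z"
proof (cases "Z \<subseteq> R")
  case True
  have "m_separator G X Y (Z \<inter> A)" using m_separator_Int_Ant[OF Z] subsets verts by simp
  then have "separates (Z \<inter> A)" by (rule m_separator_if_separates) (use True in auto)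
  then have "sum wt Z1 \<le> sum wt (Z \<inter> A)" using True by (intro Z1(2)) auto
  also have "\<dots> \<le> sum wt Z" using True by (intro sum_wt_mono) auto
  finally show ?thesis using sum_w[OF True] by simp
next
  case False
  have sub: "Z \<subseteq> {..<n}" using Z verts by (simp add: m_separator_def)
  obtain u where u: "u \<in> Z" "u \<notin> R" using False by blast
  then have "w u = \<infinity>" using sub by (intro w_infinite) auto
  moreover have "finite Z" using sub finite_subset by blast
  ultimately have "sum w Z = \<infinity>" using u(1) sum_Pinfty by blast
  then show ?thesis by simp
qed

context
  fixes Z1 Z2 :: "nat set"
  assumes Z1: "Z1 \<subseteq> R \<inter> A" "separates Z1"
      "\<And>Z'. Z' \<subseteq> R \<inter> A \<Longrightarrow> separates Z' \<Longrightarrow> sum wt Z1 \<le> sum wt Z'"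
    and Z2: "Z2 \<subseteq> R \<inter> A" "separates Z2"
      "\<And>Z'. Z' \<subseteq> R \<inter> A \<Longrightarrow> separates Z' \<Longrightarrow> sum wt (Z2 - I) \<le> sum wt (Z' - I)"
begin

text \<open>\<open>I \<inter> A \<union> Z2\<close> is the part of the constrained answer that the
  network can see; its cost is sandwiched between the two costs that the program compares.\<close>

lemma sum_wt_core_le: "sum wt Z1 \<le> sum wt (I \<inter> A \<union> Z2)" "sum wt (I \<inter> A \<union> Z2) \<le> sum wt (I \<union> Z2)"
proof -
  have "separates (I \<inter> A \<union> Z2)" by (rule separates_mono[OF _ Z2(2)]) auto
  then show "sum wt Z1 \<le> sum wt (I \<inter> A \<union> Z2)" using Z2(1) I by (intro Z1(3)) auto
  show "sum wt (I \<inter> A \<union> Z2) \<le> sum wt (I \<union> Z2)" using Z2(1) I by (intro sum_wt_mono) auto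
qed

text \<open>Equality collapses the sandwich of \<open>sum_wt_core_le\<close>. As costs are positive,
  \<open>I \<union> Z2\<close> coincides with its part \<open>I \<inter> A \<union> Z2\<close>, so
  it lies in \<open>A\<close>, where separation in the network implies m-separation.\<close>

lemma strongly_minimum_if_equal:
  assumes eq: "sum wt (I \<union> Z2) = sum wt Z1"
  shows "strongly_minimum G X Y w (I \<union> Z2)" "I \<union> Z2 \<subseteq> R"
proof -
  show R: "I \<union> Z2 \<subseteq> R" using I Z2 by auto
  have "I \<union> Z2 = I \<inter> A \<union> Z2"
    by (rule subset_if_sum_wt_le) (use R sum_wt_core_le eq in auto)
  then have sub: "I \<union> Z2 \<subseteq> A" using Z2(1) by auto
  have "separates (I \<union> Z2)" by (rule separates_mono[OF _ Z2(2)]) auto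
  then have "m_separator G X Y (I \<union> Z2)" using R sub by (rule separates_if_m_separator)
  moreover have "sum w (I \<union> Z2) \<le> sum w Z'" if "m_separator G X Y Z'" for Z'
    using m_separator_weight[OF that Z1(1,3)] sum_w[OF R] eq by simp
  ultimately show "strongly_minimum G X Y w (I \<union> Z2)"
    unfolding strongly_minimum_def by (auto simp: not_less)
qed

text \<open>A strongly minimum \<open>Z\<close> has no part outside \<open>A\<close>, since dropping
  it would save cost. So \<open>Z\<close> competes with \<open>Z2\<close> outside \<open>I\<close>;
  containing \<open>I\<close>, it costs at least as much as \<open>I \<union> Z2\<close>, and it
  costs at most as much as \<open>Z1\<close>.\<close>

lemma equal_if_strongly_minimum:
  assumes Z: "strongly_minimum G X Y w Z" "I \<subseteq> Z" "Z \<subseteq> R"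
  shows "sum wt (I \<union> Z2) = sum wt Z1"
proof -
  have sep: "m_separator G X Y Z" using Z(1) by (simp add: strongly_minimum_def)
  have min: "sum wt Z \<le> sum wt Z'" if "m_separator G X Y Z'" "Z' \<subseteq> R" for Z'
  proof -
    have "\<not> sum w Z' < sum w Z" using Z(1) that(1) unfolding strongly_minimum_def by blast
    then show ?thesis using sum_w[OF that(2)] sum_w[OF Z(3)] by simp
  qed
  have "m_separator G X Y (Z \<inter> A)" using m_separator_Int_Ant[OF sep] subsets verts by simp
  then have "sum wt Z \<le> sum wt (Z \<inter> A)" using Z(3) by (intro min) auto
  then have "Z = Z \<inter> A" by (intro subset_if_sum_wt_le) (use Z(3) in auto)
  then have ZA: "Z \<subseteq> A" by auto
  have sepZ: "separates Z" using sep Z(3) ZA by (rule m_separator_if_separates)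
  have "m_separator G X Y Z1" using Z1 by (intro separates_if_m_separator) auto
  then have ZZ1: "sum wt Z \<le> sum wt Z1" using Z1 by (intro min) auto
  have split: "sum wt (I \<union> B) = sum wt I + sum wt (B - I)" if "B \<subseteq> R" for B
  proof -
    have "sum wt (I \<union> (B - I)) = sum wt I + sum wt (B - I)"
      using that I finite_sub_R by (intro sum.union_disjoint) auto
    then show ?thesis by simp
  qed
  have "sum wt (I \<union> Z2) \<le> sum wt (I \<union> Z)"
    using Z2(1) Z2(3)[of Z] Z(3) ZA sepZ split[of Z2] split[of Z] by auto
  also have "I \<union> Z = Z" using Z(2) by auto
  finally show ?thesis using ZZ1 sum_wt_core_le by linarith
qed

end

lemma no_strongly_minimum_if_infeasible:
  assumes "\<not> separates (R \<inter> A)" "strongly_minimum G X Y w Z" "Z \<subseteq> R"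
  shows False
proof -
  have "m_separator G X Y Z" using assms(2) by (simp add: strongly_minimum_def)
  then have "m_separator G X Y (Z \<inter> A)" using m_separator_Int_Ant subsets verts by simp
  then have "separates (Z \<inter> A)" by (rule m_separator_if_separates) (use assms(3) in auto)
  then show False using assms(1,3) separates_mono[of "Z \<inter> A" "R \<inter> A"] by auto
qed

definition correct_result :: "state \<Rightarrow> bool" where
  "correct_result s \<longleftrightarrow> (case result n s of
      Some Z \<Rightarrow> strongly_minimum G X Y w Z \<and> I \<subseteq> Z \<and> Z \<subseteq> R
    | None \<Rightarrow> \<not> (\<exists>Z. strongly_minimum G X Y w Z \<and> I \<subseteq> Z \<and> Z \<subseteq> R))"

lemma writes_compute_anterior: "writes compute_anterior =
    {NV ''m'', NV ''a'', NV ''b'', NV ''k'', NA ''Q'', NM ''E'', NA ''A''}"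
  by (auto simp: compute_anterior_def writes_closure)

lemma writes_build_network: "writes build_network =
    {NV ''nn'', NV ''m'', NV ''a'', NV ''b'', NV ''k'', NA ''Q'', NM ''E'', NV ''bad''}"
  by (auto simp: build_network_def set_kind_simps writes_closure)

lemma writes_compute_big: "writes compute_big = {NV ''a'', CV ''B''}"
  by (auto simp: compute_big_def)

lemma writes_min_separator: "writes min_separator =
    {NV ''a'', NV ''b'', NV ''v'', NV ''L'', NV ''u'', NV ''k'', NA ''d'', NA ''c'', CA ''e'', CM ''r'',
     NA ''Z'', CV ''cost''}"
  by (auto simp: min_separator_def init_flow_def max_flow_def flow_step_def push_all_def
      push_saturating_def relabel_def find_gap_def extract_cut_def)

lemma runs_both_runs:
  assumes s: "input_ok s" "anterior_ok s" "network_ok s" "cvar s ''B'' = ereal big"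
      "\<And>a. narr s ''J'' a = 0" "nvar s ''found'' = 0"
    and feasible: "separates (R \<inter> A)"
  shows "runs both_runs s (2000 * (n + n + n + 1) ^ 3) correct_result"
proof -
  let ?m = "n + n + n" and ?c = "SetNArr ''J'' va (NArr ''I'' va)"
  let ?end = "Cond (CEq (CVar ''cost'') (CVar ''cost1'')) (SetNVar ''found'' (NConst 1)) Skip"
  \<comment> \<open>Both runs execute the same code; the interpretations differ only in the set of
    nodes that are free of charge.\<close>
  interpret F: flow_instance G n X Y R wt I w "{}" by unfold_locales simp
  interpret FI: flow_instance G n X Y R wt I w I by unfold_locales (rule I)
  have rdy: "F.ready s" using s by (simp add: F.ready_def)
  have "runs both_runs s (800 * (?m + 1) ^ 3 + (2 + ((n + 1) * (10 + 10) + (800 * (?m + 1) ^ 3 + 10)))) correct_result"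
    unfolding both_runs_def
  proof (rule runs_Seq[OF F.runs_min_separator[OF rdy feasible]])
    fix s1 assume s1: "agree (writes min_separator) s s1" "optimal_result {} s1"
    have rdy1: "F.ready s1" by (rule F.ready_agree[OF s1(1) rdy]) (simp add: writes_min_separator)
    have found1: "nvar s1 ''found'' = 0"
      using agreeD(1)[OF s1(1), of "''found''"] s(6) by (simp add: writes_min_separator)
    obtain Z1 where Z1: "Z1 \<subseteq> R \<inter> A" "separates Z1"
        "\<And>Z'. Z' \<subseteq> R \<inter> A \<Longrightarrow> separates Z' \<Longrightarrow> sum wt Z1 \<le> sum wt Z'"
      and cost1: "cvar s1 ''cost'' = ereal (sum wt Z1)"
      using s1(2) unfolding optimal_result_def by auto
    show "runs (Seq (SetCVar ''cost1'' (CVar ''cost'')) (Seq (For ''a'' ''n'' ?c) (Seq min_separator ?end))) s1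
        (2 + ((n + 1) * (10 + 10) + (800 * (?m + 1) ^ 3 + 10))) correct_result"
    proof (rule runs_Seq[where P = "\<lambda>s'. s' = run (SetCVar ''cost1'' (CVar ''cost'')) s1"])
      show "runs (SetCVar ''cost1'' (CVar ''cost'')) s1 2 (\<lambda>s'. s' = run (SetCVar ''cost1'' (CVar ''cost'')) s1)"
        by (intro runs_straight) simp_all
      fix s2 assume s2: "agree (writes (SetCVar ''cost1'' (CVar ''cost''))) s1 s2"
        "s2 = run (SetCVar ''cost1'' (CVar ''cost'')) s1"
      have rdy2: "F.ready s2" by (rule F.ready_agree[OF s2(1) rdy1]) simp
      have s2': "cvar s2 ''cost1'' = ereal (sum wt Z1)" "nvar s2 ''found'' = 0"
        using s2(2) cost1 found1 by simp_all
      show "runs (Seq (For ''a'' ''n'' ?c) (Seq min_separator ?end)) s2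
          ((n + 1) * (10 + 10) + (800 * (?m + 1) ^ 3 + 10)) correct_result"
      proof (rule runs_Seq, rule runs_For[where Inv = "\<lambda>i s'. \<forall>a<i. narr s' ''J'' a = of_bool (a \<in> I)"])
        show "nvar s2 ''n'' = n" using rdy2 by (simp add: F.ready_def input_ok_def)
        fix i s' assume s': "agree (insert (NV ''a'') (writes ?c)) s2 s'" "i < n" "nvar s' ''a'' = i"
          "\<forall>a<i. narr s' ''J'' a = of_bool (a \<in> I)"
        have "narr s' ''I'' = narr s2 ''I''" using agreeD(2)[OF s'(1), of "''I''"] by simp
        then have "narr s' ''I'' i = of_bool (i \<in> I)" using rdy2 by (simp add: F.ready_def input_ok_def)
        then show "runs ?c s' 10
            (\<lambda>s''. \<forall>a<Suc i. narr (s''\<lparr>nvar := (nvar s'')(''a'' := Suc i)\<rparr>) ''J'' a = of_bool (a \<in> I))"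
          using s'(3,4) by (intro runs_straight) (auto simp: less_Suc_eq)
      next
        fix s3 assume s3: "agree (writes (For ''a'' ''n'' ?c)) s2 s3" "\<forall>a<n. narr s3 ''J'' a = of_bool (a \<in> I)"
        have "input_ok s3" "anterior_ok s3" "network_ok s3"
          using rdy2 unfolding F.ready_def
          by (auto intro!: input_ok_agree[OF s3(1)] anterior_ok_agree[OF s3(1)] network_ok_agree[OF s3(1)])
        moreover have "cvar s3 ''B'' = ereal big"
          using agreeD(4)[OF s3(1), of "''B''"] rdy2 by (simp add: F.ready_def)
        ultimately have rdy3: "FI.ready s3" using s3(2) by (simp add: FI.ready_def)
        have s3': "cvar s3 ''cost1'' = ereal (sum wt Z1)" "nvar s3 ''found'' = 0"
          using agreeD(4)[OF s3(1), of "''cost1''"] agreeD(1)[OF s3(1), of "''found''"] s2' by simp_all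
        show "runs (Seq min_separator ?end) s3 (800 * (?m + 1) ^ 3 + 10) correct_result"
        proof (rule runs_Seq[OF FI.runs_min_separator[OF rdy3 feasible]])
          fix s4 assume s4: "agree (writes min_separator) s3 s4" "optimal_result I s4"
          have s4': "cvar s4 ''cost1'' = ereal (sum wt Z1)" "nvar s4 ''found'' = 0"
            using agreeD(4)[OF s4(1), of "''cost1''"] agreeD(1)[OF s4(1), of "''found''"] s3'
            by (simp_all add: writes_min_separator)
          obtain Z2 where Z2: "Z2 \<subseteq> R \<inter> A" "separates Z2"
              "\<And>Z'. Z' \<subseteq> R \<inter> A \<Longrightarrow> separates Z' \<Longrightarrow> sum wt (Z2 - I) \<le> sum wt (Z' - I)"
            and out: "{u. u < n \<and> narr s4 ''Z'' u \<noteq> 0} = I \<union> Z2" "cvar s4 ''cost'' = ereal (sum wt (I \<union> Z2))"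
            using s4(2) unfolding optimal_result_def by auto
          have "correct_result (run ?end s4)"
          proof (cases "sum wt (I \<union> Z2) = sum wt Z1")
            case True
            then have "run ?end s4 = s4\<lparr>nvar := (nvar s4)(''found'' := 1)\<rparr>" using out(2) s4'(1) by simp
            then have "result n (run ?end s4) = Some (I \<union> Z2)" using out(1) by (simp add: result_def)
            then show ?thesis
              using strongly_minimum_if_equal[OF Z1 Z2 True] by (simp add: correct_result_def)
          next
            case False
            then have "run ?end s4 = s4" using out(2) s4'(1) by simp
            then have "result n (run ?end s4) = None" using s4'(2) by (simp add: result_def)
            then show ?thesis
              using equal_if_strongly_minimum[OF Z1 Z2] False by (auto simp: correct_result_def)
          qed
          then show "runs ?end s4 10 correct_result" by (intro runs_straight) simp_all
        qed
      qed simp_all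
    qed
  qed
  then show ?thesis
  proof (rule runs_weaken)
    have "q * 800 + (2 + (n' * 20 + (q * 800 + 10))) \<le> 2000 * q" if "1 \<le> q" "n' \<le> q" for q n' :: nat
      using that by simp
    from this[of "(?m + 1) ^ 3" "n + 1"]
    show "800 * (?m + 1) ^ 3 + (2 + ((n + 1) * (10 + 10) + (800 * (?m + 1) ^ 3 + 10))) \<le> 2000 * (?m + 1) ^ 3"
      using self_le_power[of "?m + 1" 3] by simp
  qed
qed

lemma runs_program:
  assumes s: "input_ok s" "cvar s ''B'' = 0" "\<And>a. narr s ''J'' a = 0" "nvar s ''bad'' = 0" "nvar s ''found'' = 0"
  shows "runs program s (3000 * (n + n + n + 1) ^ 3) correct_result"
proof -
  let ?m = "n + n + n"
  have "runs program s (200 * (n + 1) ^ 3 + (300 * (?m + 1) ^ 3 + (40 * (n + 1) + (1 + 3 + 2000 * (?m + 1) ^ 3))))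
      correct_result"
    unfolding program_def
  proof (rule runs_Seq[OF runs_compute_anterior[OF s(1)]])
    fix s1 assume s1: "agree (writes compute_anterior) s s1" "anterior_ok s1"
    have ok1: "input_ok s1" by (rule input_ok_agree[OF s1(1) s(1)]) (simp add: writes_compute_anterior)
    have z1: "cvar s1 ''B'' = 0" "narr s1 ''J'' a = 0" "nvar s1 ''bad'' = 0" "nvar s1 ''found'' = 0" for a
      using agreeD(4)[OF s1(1), of "''B''"] agreeD(2)[OF s1(1), of "''J''"] agreeD(1)[OF s1(1), of "''bad''"]
        agreeD(1)[OF s1(1), of "''found''"] s by (simp_all add: writes_compute_anterior)
    show "runs (Seq build_network (Seq compute_big (Cond (NEq (NVar ''bad'') (NConst 0)) both_runs Skip))) s1
        (300 * (?m + 1) ^ 3 + (40 * (n + 1) + (1 + 3 + 2000 * (?m + 1) ^ 3))) correct_result"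
    proof (rule runs_Seq[OF runs_build_network[OF ok1 s1(2) z1(3)]])
      fix s2 assume s2: "agree (writes build_network) s1 s2"
        "network_ok s2 \<and> (nvar s2 ''bad'' = 0 \<longleftrightarrow> separates (R \<inter> A))"
      have ok2: "input_ok s2" by (rule input_ok_agree[OF s2(1) ok1]) (simp add: writes_build_network)
      have ant2: "anterior_ok s2" by (rule anterior_ok_agree[OF s2(1) s1(2)]) (simp add: writes_build_network)
      have z2: "cvar s2 ''B'' = 0" "narr s2 ''J'' a = 0" "nvar s2 ''found'' = 0" for a
        using agreeD(4)[OF s2(1), of "''B''"] agreeD(2)[OF s2(1), of "''J''"]
          agreeD(1)[OF s2(1), of "''found''"] z1 by (simp_all add: writes_build_network)
      show "runs (Seq compute_big (Cond (NEq (NVar ''bad'') (NConst 0)) both_runs Skip)) s2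
          (40 * (n + 1) + (1 + 3 + 2000 * (?m + 1) ^ 3)) correct_result"
      proof (rule runs_Seq[OF runs_compute_big[OF ok2 z2(1)]])
        fix s3 assume s3: "agree (writes compute_big) s2 s3" "cvar s3 ''B'' = ereal big"
        have ok3: "input_ok s3" by (rule input_ok_agree[OF s3(1) ok2]) (simp add: writes_compute_big)
        have ant3: "anterior_ok s3" by (rule anterior_ok_agree[OF s3(1) ant2]) (simp add: writes_compute_big)
        have net3: "network_ok s3" by (rule network_ok_agree[OF s3(1) conjunct1[OF s2(2)]]) (simp add: writes_compute_big)
        have z3: "narr s3 ''J'' a = 0" "nvar s3 ''found'' = 0" "nvar s3 ''bad'' = 0 \<longleftrightarrow> separates (R \<inter> A)" for a
          using agreeD(2)[OF s3(1), of "''J''"] agreeD(1)[OF s3(1), of "''found''"]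
            agreeD(1)[OF s3(1), of "''bad''"] z2 s2(2) by (simp_all add: writes_compute_big)
        have "runs (Cond (NEq (NVar ''bad'') (NConst 0)) both_runs Skip) s3
          (1 + btime (NEq (NVar ''bad'') (NConst 0)) + 2000 * (?m + 1) ^ 3) correct_result"
        proof (rule runs_Cond)
          assume "bval (NEq (NVar ''bad'') (NConst 0)) s3"
          then have "separates (R \<inter> A)" using z3(3) by simp
          then show "runs both_runs s3 (2000 * (?m + 1) ^ 3) correct_result"
            by (rule runs_both_runs[OF ok3 ant3 net3 s3(2) z3(1,2)])
        next
          assume "\<not> bval (NEq (NVar ''bad'') (NConst 0)) s3"
          then have "\<not> separates (R \<inter> A)" using z3(3) by simp
          then have "correct_result s3"
            using no_strongly_minimum_if_infeasible z3(2) by (auto simp: correct_result_def result_def)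
          then show "runs Skip s3 (2000 * (?m + 1) ^ 3) correct_result"
            by (intro runs_straight) simp_all
        qed
        then show "runs (Cond (NEq (NVar ''bad'') (NConst 0)) both_runs Skip) s3
          (1 + 3 + 2000 * (?m + 1) ^ 3) correct_result" by (rule runs_weaken) simp_all
      qed
    qed
  qed
  then show ?thesis
  proof (rule runs_weaken)
    have "200 * p + (300 * q + (40 * n' + (1 + 3 + 2000 * q))) \<le> 3000 * q"
      if "1 \<le> q" "n' \<le> q" "p \<le> q" for p q n' :: nat
      using that by simp
    from this[of "(?m + 1) ^ 3" "n + 1" "(n + 1) ^ 3"]
    show "200 * (n + 1) ^ 3 + (300 * (?m + 1) ^ 3 + (40 * (n + 1) + (1 + 3 + 2000 * (?m + 1) ^ 3)))
        \<le> 3000 * (?m + 1) ^ 3"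
      using self_le_power[of "?m + 1" 3] power_mono[of "n + 1" "?m + 1" 3] by simp
  qed
qed

end

theorem proposition6:
  "\<exists>(P :: com) (T :: nat \<Rightarrow> nat).
     (\<lambda>n. real (T n)) \<in> O(\<lambda>n. real n ^ 3) \<and>
     (\<forall>(n :: nat) (G :: nat mixed_graph) X Y R I (w :: nat \<Rightarrow> ereal).
        ancestral_graph G \<and> verts G = {..<n} \<and>
        X \<subseteq> verts G \<and> Y \<subseteq> verts G \<and> R \<subseteq> verts G \<and>
        X \<inter> Y = {} \<and> X \<inter> R = {} \<and> Y \<inter> R = {} \<and>
        X \<noteq> {} \<and> Y \<noteq> {} \<and> I \<subseteq> R \<and>
        (\<forall>u\<in>R. 0 < w u \<and> w u < \<infinity>) \<and> (\<forall>u\<in>verts G - R. w u = \<infinity>) \<longrightarrow>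
        (\<exists>t s. exec P (input_state G X Y R I w) t s \<and> t \<le> T n \<and>
           (case result n s of
              Some Z \<Rightarrow> strongly_minimum G X Y w Z \<and> I \<subseteq> Z \<and> Z \<subseteq> R
            | None \<Rightarrow> \<not> (\<exists>Z. strongly_minimum G X Y w Z \<and> I \<subseteq> Z \<and> Z \<subseteq> R))))"
proof (intro exI[of _ program] exI[of _ "\<lambda>n. 3000 * (n + n + n + 1) ^ 3"] conjI allI impI)
  show "(\<lambda>n. real (3000 * (n + n + n + 1) ^ 3)) \<in> O(\<lambda>n. real n ^ 3)"
  proof (rule bigoI)
    show "\<forall>\<^sub>F n in at_top. norm (real (3000 * (n + n + n + 1) ^ 3)) \<le> 192000 * norm (real n ^ 3)"
      using eventually_ge_at_top[of 1]
    proof eventually_elim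
      case (elim n)
      \<comment> \<open>For \<open>n \<ge> 1\<close> the dimension plus one is at most
        \<open>4 * n\<close>, whence the constant \<open>3000 * 64 = 192000\<close>.\<close>
      then have "(n + n + n + 1) ^ 3 \<le> (4 * n) ^ 3" by (intro power_mono) auto
      also have "\<dots> = 64 * n ^ 3" by (simp add: power_mult_distrib)
      finally have "3000 * (n + n + n + 1) ^ 3 \<le> 192000 * n ^ 3" by simp
      then have "real (3000 * (n + n + n + 1) ^ 3) \<le> real (192000 * n ^ 3)" by (rule of_nat_mono)
      then show ?case by simp
    qed
  qed
next
  fix n G X Y R I and w :: "nat \<Rightarrow> ereal"
  assume asm: "ancestral_graph G \<and> verts G = {..<n} \<and>
        X \<subseteq> verts G \<and> Y \<subseteq> verts G \<and> R \<subseteq> verts G \<and>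
        X \<inter> Y = {} \<and> X \<inter> R = {} \<and> Y \<inter> R = {} \<and>
        X \<noteq> {} \<and> Y \<noteq> {} \<and> I \<subseteq> R \<and>
        (\<forall>u\<in>R. 0 < w u \<and> w u < \<infinity>) \<and> (\<forall>u\<in>verts G - R. w u = \<infinity>)"
  have w: "w u = ereal (real_of_ereal (w u))" "0 < real_of_ereal (w u)" if "u \<in> R" for u
  proof -
    have "0 < w u" "w u < \<infinity>" using asm that by auto
    then show "w u = ereal (real_of_ereal (w u))" "0 < real_of_ereal (w u)"
      by (cases "w u"; simp)+
  qed
  \<comment> \<open>At graph nodes outside \<open>R\<close> the cost is infinite and
    \<open>real_of_ereal\<close> yields the default \<open>0\<close>; positivity of the real weights
    is demanded on \<open>R\<close> only.\<close>
  interpret separation_instance G n X Y R "\<lambda>u. real_of_ereal (w u)" I w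
    by unfold_locales (use asm w in auto)
  have "input_ok (input_state G X Y R I w)"
    using asm w(1) by (auto simp: input_ok_def input_state_def)
  then have "runs program (input_state G X Y R I w) (3000 * (n + n + n + 1) ^ 3) correct_result"
    by (rule runs_program) (simp_all add: input_state_def)
  then obtain t s where "exec program (input_state G X Y R I w) t s" "t \<le> 3000 * (n + n + n + 1) ^ 3" "correct_result s"
    unfolding runs_def by blast
  then show "\<exists>t s. exec program (input_state G X Y R I w) t s \<and> t \<le> 3000 * (n + n + n + 1) ^ 3 \<and>
           (case result n s of
              Some Z \<Rightarrow> strongly_minimum G X Y w Z \<and> I \<subseteq> Z \<and> Z \<subseteq> R
            | None \<Rightarrow> \<not> (\<exists>Z. strongly_minimum G X Y w Z \<and> I \<subseteq> Z \<and> Z \<subseteq> R))"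
    unfolding correct_result_def by blast
qed

end
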